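(* If there is a polynomial-time $\alpha$-approximation algorithm for the R2C problem, then there is a polynomial-time $4\alpha$-approximation algorithm for the General Scheduling Problem (GSP).
   Context: General Scheduling Problem (GSP): the input consists of $n$ jobs; job $j$ has a positive integer release time $r_j$, a positive integer size $p_j$, and a weight function $w_j(t)\ge 0$ defined for integers $t>r_j$. Time is divided into unit slots; a single processor processes at most one job per slot, job $j$ may only be processed in slots $s\ge r_j$, preemption is allowed, and job $j$ must receive $p_j$ units of processing. If job $j$ completes at time $C_j$, it incurs cost $\sum_{s=r_j+1}^{C_j} w_j(s)$; the objective is to minimize total cost. R2C problem: the input is a finite set $\mathcal P$ of points in the plane, each point $p=(x_p,y_p)$ with a positive integer demand $d_p$, and a finite collection $\mathcal R$ of axis-parallel rectangles each of the form $[0,x_r]\times[y^1_r,y^2_r]$ (abutting the $y$-axis), each with a positive integer capacity $c_r$ and a positive integer weight $w_r$. The goal is to find a minimum-weight subset $S\subseteq\mathcal R$ such that for every $p\in\mathcal P$, $\sum_{r\in S: p\in r} c_r\ge d_p$. *)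

theory Defs
  imports
    Complex_Main
    "HOL-Library.Log_Nat"
    "HOL-Computational_Algebra.Polynomial"
begin

section \<open>Polynomial-time computation\<close>

text \<open>
  The machine model is a structured while-language on S-expressions over binary integers, with
  queries to an external function, under the logarithmic cost criterion: every elementary
  operation is charged the bit length of everything it reads and writes, so that (as for the
  logarithmic-cost RAM) time agrees with Turing machine time up to a polynomial. The whole store
  of a program is a single value, and a program maps the current store to a new one.
\<close>

datatype val = Num int | Pr val val

fun bits :: "val \<Rightarrow> nat" where
  "bits (Num a) = 1 + floorlog 2 (nat \<bar>a\<bar>)"
| "bits (Pr u v) = 1 + bits u + bits v"

datatype elem_op =
    Ident | Const val | Left | Right | IsPair | Add | Sub | Mul | Div | Less | Query

text \<open>Operations applied to a store of the wrong shape yield \<open>Num 0\<close>.\<close>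

fun arith :: "(int \<Rightarrow> int \<Rightarrow> int) \<Rightarrow> val \<Rightarrow> val" where
  "arith f (Pr (Num a) (Num b)) = Num (f a b)"
| "arith f _ = Num 0"

fun apply_op :: "(val \<Rightarrow> val) \<Rightarrow> elem_op \<Rightarrow> val \<Rightarrow> val" where
  "apply_op q Ident v = v"
| "apply_op q (Const c) v = c"
| "apply_op q Left v = (case v of Pr a b \<Rightarrow> a | Num _ \<Rightarrow> Num 0)"
| "apply_op q Right v = (case v of Pr a b \<Rightarrow> b | Num _ \<Rightarrow> Num 0)"
| "apply_op q IsPair v = (case v of Pr a b \<Rightarrow> Num 1 | Num _ \<Rightarrow> Num 0)"
| "apply_op q Add v = arith (+) v"
| "apply_op q Sub v = arith (-) v"
| "apply_op q Mul v = arith (*) v"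
| "apply_op q Div v = arith (div) v"
| "apply_op q Less v = arith (\<lambda>a b. if a < b then 1 else 0) v"
| "apply_op q Query v = q v"

datatype prog =
    Op elem_op
  | Seq prog prog
  | Fork prog prog
  | Cond prog prog prog
  | While prog prog

text \<open>
  \<open>exec q p v t w\<close>: with queries answered by \<open>q\<close>, program \<open>p\<close> started on \<open>v\<close> halts after
  \<open>t\<close> time units with result \<open>w\<close>. A test succeeds iff its result is not \<open>Num 0\<close>.
\<close>

inductive exec :: "(val \<Rightarrow> val) \<Rightarrow> prog \<Rightarrow> val \<Rightarrow> nat \<Rightarrow> val \<Rightarrow> bool" for q where
  Op: "exec q (Op a) v (1 + bits v + bits (apply_op q a v)) (apply_op q a v)"
| Seq: "exec q f v t u \<Longrightarrow> exec q g u t' w \<Longrightarrow> exec q (Seq f g) v (1 + t + t') w"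
| Fork: "exec q f v t a \<Longrightarrow> exec q g v t' b \<Longrightarrow> exec q (Fork f g) v (1 + t + t') (Pr a b)"
| Cond_True: "exec q b v t c \<Longrightarrow> c \<noteq> Num 0 \<Longrightarrow> exec q f v t' w
    \<Longrightarrow> exec q (Cond b f g) v (1 + t + t') w"
| Cond_False: "exec q b v t (Num 0) \<Longrightarrow> exec q g v t' w
    \<Longrightarrow> exec q (Cond b f g) v (1 + t + t') w"
| While_False: "exec q b v t (Num 0) \<Longrightarrow> exec q (While b f) v (1 + t) v"
| While_True: "exec q b v t c \<Longrightarrow> c \<noteq> Num 0 \<Longrightarrow> exec q f v t' u
    \<Longrightarrow> exec q (While b f) u t'' w \<Longrightarrow> exec q (While b f) v (1 + t + t' + t'') w"

inductive_cases exec_OpE: "exec q (Op a) v t w"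
inductive_cases exec_SeqE: "exec q (Seq f g) v t w"
inductive_cases exec_ForkE: "exec q (Fork f g) v t w"
inductive_cases exec_CondE: "exec q (Cond b f g) v t w"
inductive_cases exec_WhileE: "exec q (While b f) v t w"

lemma exec_deterministic:
  "exec q p v t w \<Longrightarrow> exec q p v t' w' \<Longrightarrow> t' = t \<and> w' = w"
proof (induction arbitrary: t' w' rule: exec.induct)
  case Op
  then show ?case by (auto elim: exec_OpE)
next
  case Seq
  from Seq.prems show ?case by (rule exec_SeqE) (metis Seq.IH add_Suc plus_1_eq_Suc)
next
  case Fork
  from Fork.prems show ?case by (rule exec_ForkE) (metis Fork.IH add_Suc plus_1_eq_Suc)
next
  case Cond_True
  from Cond_True.prems show ?case
    by (rule exec_CondE) (metis Cond_True.IH Cond_True.hyps(2) add_Suc plus_1_eq_Suc)+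
next
  case Cond_False
  from Cond_False.prems show ?case
    by (rule exec_CondE) (metis Cond_False.IH add_Suc plus_1_eq_Suc)+
next
  case While_False
  from While_False.prems show ?case
    by (rule exec_WhileE) (metis While_False.IH add_Suc plus_1_eq_Suc)+
next
  case While_True
  from While_True.prems show ?case
    by (rule exec_WhileE) (metis While_True.IH While_True.hyps(2) add_Suc plus_1_eq_Suc)+
qed

fun enc_list :: "('a \<Rightarrow> val) \<Rightarrow> 'a list \<Rightarrow> val" where
  "enc_list e [] = Num 0"
| "enc_list e (x # xs) = Pr (e x) (enc_list e xs)"

definition enc_nat :: "nat \<Rightarrow> val" where
  "enc_nat n = Num (int n)"

definition enc_rat :: "rat \<Rightarrow> val" where
  "enc_rat x = Pr (Num (fst (quotient_of x))) (Num (snd (quotient_of x)))"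


section \<open>Minimisation problems and approximation algorithms\<close>

text \<open>
  An algorithm is given \<open>input I\<close> and may query \<open>answer I\<close>; \<open>input_size I\<close> is the length
  against which its running time is measured. \<open>describes s v\<close> says that the value \<open>v\<close> is a
  description of the solution \<open>s\<close>.
\<close>

record ('i, 's) min_problem =
  is_instance :: "'i \<Rightarrow> bool"
  input :: "'i \<Rightarrow> val"
  answer :: "'i \<Rightarrow> val \<Rightarrow> val"
  input_size :: "'i \<Rightarrow> nat"
  feasible :: "'i \<Rightarrow> 's \<Rightarrow> bool"
  cost :: "'i \<Rightarrow> 's \<Rightarrow> real"
  describes :: "'s \<Rightarrow> val \<Rightarrow> bool"

definition optimum :: "('i, 's) min_problem \<Rightarrow> 'i \<Rightarrow> real" where
  "optimum \<Pi> I = (INF s\<in>{s. feasible \<Pi> I s}. cost \<Pi> I s)"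

definition polynomial_time :: "('i, 's) min_problem \<Rightarrow> prog \<Rightarrow> bool" where
  "polynomial_time \<Pi> A \<longleftrightarrow>
     (\<exists>b :: nat poly. \<forall>I. is_instance \<Pi> I \<longrightarrow>
        (\<exists>t v. exec (answer \<Pi> I) A (input \<Pi> I) t v \<and> t \<le> poly b (input_size \<Pi> I)))"

definition approximation_algorithm :: "real \<Rightarrow> ('i, 's) min_problem \<Rightarrow> prog \<Rightarrow> bool" where
  "approximation_algorithm \<alpha> \<Pi> A \<longleftrightarrow>
     (\<forall>I. is_instance \<Pi> I \<and> (\<exists>s. feasible \<Pi> I s) \<longrightarrow>
        (\<exists>t v s. exec (answer \<Pi> I) A (input \<Pi> I) t v \<and> describes \<Pi> s v \<and>
           feasible \<Pi> I s \<and> cost \<Pi> I s \<le> \<alpha> * optimum \<Pi> I))"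


section \<open>The R2C problem\<close>

record dpoint =
  xcoord :: rat
  ycoord :: rat
  demand :: nat

record rectangle =
  right :: rat
  lower :: rat
  upper :: rat
  capacity :: nat
  rweight :: nat

definition region :: "rectangle \<Rightarrow> (rat \<times> rat) set" where
  "region r = {0..right r} \<times> {lower r..upper r}"

text \<open>
  The points form a set, so their positions are distinct; the rectangles form a collection in
  which the same rectangle may occur repeatedly, and a subcollection is a set of positions.
\<close>

type_synonym r2c_instance = "dpoint list \<times> rectangle list"

definition r2c_is_instance :: "r2c_instance \<Rightarrow> bool" where
  "r2c_is_instance I \<longleftrightarrow>
     distinct (map (\<lambda>p. (xcoord p, ycoord p)) (fst I)) \<and>
     (\<forall>p\<in>set (fst I). demand p > 0) \<and>
     (\<forall>r\<in>set (snd I). 0 \<le> right r \<and> lower r \<le> upper r \<and> capacity r > 0 \<and> rweight r > 0)"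

definition r2c_feasible :: "r2c_instance \<Rightarrow> nat set \<Rightarrow> bool" where
  "r2c_feasible I S \<longleftrightarrow>
     S \<subseteq> {..<length (snd I)} \<and>
     (\<forall>p\<in>set (fst I).
        (\<Sum>i\<in>{i\<in>S. (xcoord p, ycoord p) \<in> region (snd I ! i)}. capacity (snd I ! i)) \<ge> demand p)"

definition r2c_cost :: "r2c_instance \<Rightarrow> nat set \<Rightarrow> real" where
  "r2c_cost I S = (\<Sum>i\<in>S. real (rweight (snd I ! i)))"

definition enc_dpoint :: "dpoint \<Rightarrow> val" where
  "enc_dpoint p = Pr (enc_rat (xcoord p)) (Pr (enc_rat (ycoord p)) (enc_nat (demand p)))"

definition enc_rectangle :: "rectangle \<Rightarrow> val" where
  "enc_rectangle r =
     Pr (enc_rat (right r)) (Pr (enc_rat (lower r)) (Pr (enc_rat (upper r))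
       (Pr (enc_nat (capacity r)) (enc_nat (rweight r)))))"

definition r2c_input :: "r2c_instance \<Rightarrow> val" where
  "r2c_input I = Pr (enc_list enc_dpoint (fst I)) (enc_list enc_rectangle (snd I))"

definition R2C :: "(r2c_instance, nat set) min_problem" where
  "R2C = \<lparr>is_instance = r2c_is_instance,
          input = r2c_input,
          answer = (\<lambda>I v. Num 0),
          input_size = (\<lambda>I. bits (r2c_input I)),
          feasible = r2c_feasible,
          cost = r2c_cost,
          describes = (\<lambda>S v. \<exists>is. v = enc_list enc_nat is \<and> set is = S)\<rparr>"


section \<open>The General Scheduling Problem\<close>

record job =
  release :: nat
  job_size :: nat
  weight :: "nat \<Rightarrow> rat"

definition gsp_is_instance :: "job list \<Rightarrow> bool" where
  "gsp_is_instance J \<longleftrightarrow>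
     (\<forall>j\<in>set J. release j > 0 \<and> job_size j > 0 \<and> (\<forall>t>release j. weight j t \<ge> 0))"

text \<open>
  A schedule maps every slot to the index of the job processed in it, if any. Slot \<open>s\<close> is the
  time interval from \<open>s\<close> to \<open>s + 1\<close>, so a job whose last slot is \<open>s\<close> completes at \<open>s + 1\<close>.
\<close>

type_synonym schedule = "nat \<Rightarrow> nat option"

definition slots_of :: "schedule \<Rightarrow> nat \<Rightarrow> nat set" where
  "slots_of \<sigma> i = {s. \<sigma> s = Some i}"

definition gsp_feasible :: "job list \<Rightarrow> schedule \<Rightarrow> bool" where
  "gsp_feasible J \<sigma> \<longleftrightarrow>
     (\<forall>s i. \<sigma> s = Some i \<longrightarrow> i < length J \<and> release (J ! i) \<le> s) \<and>
     (\<forall>i<length J. finite (slots_of \<sigma> i) \<and> card (slots_of \<sigma> i) = job_size (J ! i))"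

definition completion_time :: "schedule \<Rightarrow> nat \<Rightarrow> nat" where
  "completion_time \<sigma> i = Suc (Max (slots_of \<sigma> i))"

definition cost_at :: "job \<Rightarrow> nat \<Rightarrow> rat" where
  "cost_at j C = (\<Sum>s = release j + 1..C. weight j s)"

definition gsp_cost :: "job list \<Rightarrow> schedule \<Rightarrow> real" where
  "gsp_cost J \<sigma> = (\<Sum>i<length J. of_rat (cost_at (J ! i) (completion_time \<sigma> i)))"

text \<open>
  Release times and sizes are written in binary in the input. Weight functions are arbitrary
  infinite objects, so they are accessed by queries: the query \<open>(i, t)\<close> returns the cost
  of completing job \<open>i\<close> at time \<open>t\<close>. (Queries for single weights instead would, for sizes in
  binary, not even allow a polynomial-time algorithm to find the one slot with a nonzero weight.)
\<close>

definition gsp_input :: "job list \<Rightarrow> val" where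
  "gsp_input J = enc_list (\<lambda>j. Pr (enc_nat (release j)) (enc_nat (job_size j))) J"

fun gsp_answer :: "job list \<Rightarrow> val \<Rightarrow> val" where
  "gsp_answer J (Pr (Num i) (Num t)) =
     (if 0 \<le> i \<and> i < int (length J) \<and> 0 \<le> t
      then enc_rat (cost_at (J ! nat i) (nat t)) else Num 0)"
| "gsp_answer J _ = Num 0"

text \<open>No schedule that avoids unnecessary idling runs beyond the horizon.\<close>

definition horizon :: "job list \<Rightarrow> nat" where
  "horizon J = Max (insert 0 (release ` set J)) + (\<Sum>j\<leftarrow>J. job_size j)"

text \<open>
  The input length accounts for the numbers in the input and, for every job, for the longest
  binary representation of a cost that the job can incur up to the horizon.
\<close>

definition gsp_input_size :: "job list \<Rightarrow> nat" where
  "gsp_input_size J =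
     bits (gsp_input J) + (\<Sum>j\<leftarrow>J. Max ((\<lambda>t. bits (enc_rat (cost_at j t))) ` {..horizon J}))"

text \<open>
  As the number of slots is exponential in the input length, schedules are output as lists of
  blocks: \<open>(i, a, b)\<close> stands for processing job \<open>i\<close> in the slots \<open>a, \<dots>, b - 1\<close>.
\<close>

definition describes_schedule :: "(nat \<times> nat \<times> nat) list \<Rightarrow> schedule \<Rightarrow> bool" where
  "describes_schedule bs \<sigma> \<longleftrightarrow>
     (\<forall>s i. \<sigma> s = Some i \<longleftrightarrow> (\<exists>a b. (i, a, b) \<in> set bs \<and> a \<le> s \<and> s < b))"

definition enc_block :: "nat \<times> nat \<times> nat \<Rightarrow> val" where
  "enc_block = (\<lambda>(i, a, b). Pr (enc_nat i) (Pr (enc_nat a) (enc_nat b)))"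

definition GSP :: "(job list, schedule) min_problem" where
  "GSP = \<lparr>is_instance = gsp_is_instance,
          input = gsp_input,
          answer = gsp_answer,
          input_size = gsp_input_size,
          feasible = gsp_feasible,
          cost = gsp_cost,
          describes = (\<lambda>\<sigma> v. \<exists>bs. v = enc_list enc_block bs \<and> describes_schedule bs \<sigma>)\<rparr>"

end

theory Submission
  imports Defs
begin

text \<open>
  Job \<open>i\<close> may get the deadline \<open>deadline J i k\<close>, the last time at which its scaled cost is at most
  \<open>2 ^ k div 2\<close>. By Hall's condition, deadlines can be met iff for every window \<open>{a..<b}\<close> the jobs
  released at \<open>a\<close> or later whose deadline exceeds \<open>b\<close> have total size at least that of all jobs
  released at \<open>a\<close> or later minus \<open>b - a\<close>. So a window is a point that demands this excess, and
  extending the deadline of \<open>i\<close> from level \<open>k\<close> to \<open>k + 1\<close> is a rectangle of capacity \<open>job_size\<close> and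
  weight \<open>2 ^ k\<close> covering the points with \<open>a\<close> at most the release time and \<open>b\<close> between the two
  deadlines. Rounding the cost of a completion time up to a power of two loses a factor of 2, and
  paying for all levels up to it another factor of 2; conversely the largest chosen level of a job
  alone pays for its deadline. The deadlines are then met by scheduling earliest-deadline-first.

  Deadlines of cost 0 carry no weight and are granted for free. Deadlines and the scale, which makes all
  positive costs at least 1, are found by binary search with queries up to the horizon.
\<close>

subsection \<open>Families of polynomial-time computations\<close>

text \<open>A job's strips are disjoint in \<open>b\<close>, so a window meets at most one rectangle
  of a job and never counts its size twice. The price is that a job must buy every level whose
  deadline lies before its completion time, which is the second factor of 2.

  Only windows from a release time to some deadline become points. They suffice because the critical
  interval of the earliest-deadline-first argument starts at a release time and ends at a deadline.
  So there are polynomially many points although time is exponentially long; for the same reason the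
  schedule is built from whole intervals, job by job, and never slot by slot.

  Rectangle weights are positive integers while costs are rationals. The geometric sum of the levels
  is at most four times the cost only if the cost is 0 or not too small, hence the scale. Costs grow
  with time, so one denominator per job fixes it.

  A schedule may idle and run past the horizon, where answers to queries are not bounded by the
  input size. Its completion times are cut at the horizon; no solution is lost, since all jobs fit
  between any release time and the horizon.\<close>

text \<open>
  A context fixes the instance and the values of all loop variables. A single program with a single time
  bound has to serve all contexts of a family, so that loop bodies are computations in a larger family.
\<close>

record 'c family =
  queries :: "'c \<Rightarrow> val \<Rightarrow> val"
  len :: "'c \<Rightarrow> nat"
  contexts :: "'c set"

definition poly_bounded :: "'c family \<Rightarrow> ('c \<Rightarrow> nat) \<Rightarrow> bool" where
  "poly_bounded K f \<longleftrightarrow> (\<exists>b :: nat poly. \<forall>c\<in>contexts K. f c \<le> poly b (len K c))"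

text \<open>The store \<open>e\<close> and the result \<open>f\<close> are both attached to the
  context, and nothing is said about stores that belong to no context, so a program may rely on the
  shape of its store.\<close>

definition ptime :: "'c family \<Rightarrow> ('c \<Rightarrow> val) \<Rightarrow> ('c \<Rightarrow> val) \<Rightarrow> bool" where
  "ptime K e f \<longleftrightarrow> (\<exists>p T. poly_bounded K T \<and>
     (\<forall>c\<in>contexts K. \<exists>t\<le>T c. exec (queries K c) p (e c) t (f c)))"

text \<open>\<open>len\<close> ignores the new variable, so a time bound over the larger family is
  uniform in the variable.\<close>

definition with_var :: "'c family \<Rightarrow> ('c \<Rightarrow> 'a set) \<Rightarrow> ('c \<times> 'a) family" where
  "with_var K A = \<lparr>queries = (\<lambda>z. queries K (fst z)), len = (\<lambda>z. len K (fst z)),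
     contexts = {z. fst z \<in> contexts K \<and> snd z \<in> A (fst z)}\<rparr>"

lemma with_var_simps [simp]:
  "queries (with_var K A) = (\<lambda>z. queries K (fst z))"
  "len (with_var K A) = (\<lambda>z. len K (fst z))"
  "z \<in> contexts (with_var K A) \<longleftrightarrow> fst z \<in> contexts K \<and> snd z \<in> A (fst z)"
  by (auto simp: with_var_def)

section \<open>Polynomial bounds on functions of the context\<close>

lemma poly_nat_mono: "x \<le> y \<Longrightarrow> poly (b :: nat poly) x \<le> poly b y"
  by (induction b) (auto intro: add_mono mult_le_mono)

lemma poly_boundedI: "(\<And>c. c \<in> contexts K \<Longrightarrow> f c \<le> poly b (len K c)) \<Longrightarrow> poly_bounded K f"
  by (auto simp: poly_bounded_def)

lemma poly_bounded_mono:
  assumes "poly_bounded K g" "\<And>c. c \<in> contexts K \<Longrightarrow> f c \<le> g c"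
  shows "poly_bounded K f"
  using assms unfolding poly_bounded_def by (meson order_trans)

lemma poly_bounded_const: "poly_bounded K (\<lambda>_. k)"
  by (rule poly_boundedI[where b = "[:k:]"]) simp

lemma poly_bounded_len: "poly_bounded K (len K)"
  by (rule poly_boundedI[where b = "[:0, 1:]"]) simp

lemma poly_bounded_add:
  assumes "poly_bounded K f" "poly_bounded K g"
  shows "poly_bounded K (\<lambda>c. f c + g c)"
proof -
  obtain a b where "\<forall>c\<in>contexts K. f c \<le> poly a (len K c)" "\<forall>c\<in>contexts K. g c \<le> poly b (len K c)"
    using assms by (auto simp: poly_bounded_def)
  then show ?thesis by (intro poly_boundedI[where b = "a + b"]) (auto intro: add_mono)
qed

lemma poly_bounded_mult:
  assumes "poly_bounded K f" "poly_bounded K g"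
  shows "poly_bounded K (\<lambda>c. f c * g c)"
proof -
  obtain a b where "\<forall>c\<in>contexts K. f c \<le> poly a (len K c)" "\<forall>c\<in>contexts K. g c \<le> poly b (len K c)"
    using assms by (auto simp: poly_bounded_def)
  then show ?thesis by (intro poly_boundedI[where b = "a * b"]) (auto intro: mult_le_mono)
qed

lemma poly_bounded_Suc: "poly_bounded K f \<Longrightarrow> poly_bounded K (\<lambda>c. Suc (f c))"
  using poly_bounded_add[OF poly_bounded_const[of K 1]] by simp

lemma poly_bounded_poly:
  assumes "poly_bounded K f"
  shows "poly_bounded K (\<lambda>c. poly b (f c))"
proof -
  obtain a where "\<forall>c\<in>contexts K. f c \<le> poly a (len K c)"
    using assms by (auto simp: poly_bounded_def)
  then show ?thesis
    by (intro poly_boundedI[where b = "pcompose b a"]) (auto simp: poly_pcompose intro: poly_nat_mono)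
qed

lemma poly_bounded_reindex:
  assumes "poly_bounded K f"
    and "\<And>c. c \<in> contexts K' \<Longrightarrow> h c \<in> contexts K" "\<And>c. c \<in> contexts K' \<Longrightarrow> len K (h c) = len K' c"
  shows "poly_bounded K' (\<lambda>c. f (h c))"
  using assms unfolding poly_bounded_def by metis

lemma poly_bounded_with_var: "poly_bounded K f \<Longrightarrow> poly_bounded (with_var K A) (\<lambda>z. f (fst z))"
  by (erule poly_bounded_reindex) auto

lemma poly_bounded_with_varI:
  assumes "poly_bounded K f" "\<And>z. fst z \<in> contexts K \<Longrightarrow> snd z \<in> A (fst z) \<Longrightarrow> g z \<le> f (fst z)"
  shows "poly_bounded (with_var K A) g"
  by (rule poly_bounded_mono[OF poly_bounded_with_var[OF assms(1)]]) (use assms(2) in auto)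

text \<open>The polynomial depends on \<open>len\<close> alone, so it also bounds all values of the
  variable at once. Loops use this to multiply the cost of one round by their number.\<close>

lemma poly_bounded_uniform:
  assumes "poly_bounded (with_var K A) f"
  obtains g where "poly_bounded K g" "\<And>c x. c \<in> contexts K \<Longrightarrow> x \<in> A c \<Longrightarrow> f (c, x) \<le> g c"
proof -
  obtain b where b: "\<forall>z\<in>contexts (with_var K A). f z \<le> poly b (len K (fst z))"
    using assms by (auto simp: poly_bounded_def)
  show ?thesis
  proof (rule that)
    show "poly_bounded K (\<lambda>c. poly b (len K c))" by (rule poly_boundedI) auto
    show "f (c, x) \<le> poly b (len K c)" if "c \<in> contexts K" "x \<in> A c" for c x
      using b[rule_format, of "(c, x)"] that by simp
  qed
qed

text \<open>Every operation pays for what it reads and writes. Hence a time bound is also a size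
  bound, and intermediate results need no separate size estimates.\<close>

lemma exec_bits: "exec q p v t w \<Longrightarrow> bits v \<le> t \<and> bits w \<le> t"
  by (induction rule: exec.induct) auto

section \<open>Composition rules for polynomial-time computations\<close>

lemma ptimeI:
  assumes "poly_bounded K T" "\<And>c. c \<in> contexts K \<Longrightarrow> \<exists>t\<le>T c. exec (queries K c) p (e c) t (f c)"
  shows "ptime K e f"
  using assms by (auto simp: ptime_def)

lemma ptime_bits: 
  assumes "ptime K e f"
  shows "poly_bounded K (\<lambda>c. bits (e c))" "poly_bounded K (\<lambda>c. bits (f c))"
proof -
  obtain p T where T: "poly_bounded K T" "\<forall>c\<in>contexts K. \<exists>t\<le>T c. exec (queries K c) p (e c) t (f c)"
    using assms by (auto simp: ptime_def)
  then have "\<forall>c\<in>contexts K. bits (e c) \<le> T c \<and> bits (f c) \<le> T c"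
    by (meson exec_bits order_trans)
  with T(1) show "poly_bounded K (\<lambda>c. bits (e c))" "poly_bounded K (\<lambda>c. bits (f c))"
    by (auto intro: poly_bounded_mono)
qed

lemma ptime_cong:
  assumes "ptime K e f" "\<And>c. c \<in> contexts K \<Longrightarrow> f c = g c"
  shows "ptime K e g"
  using assms unfolding ptime_def by (metis (no_types, lifting))

text \<open>A program sees the store and the queries but not the context, so it serves every family
  whose contexts map to old ones in this way.\<close>

lemma ptime_reindex:
  assumes "ptime K e f"
    and "\<And>c. c \<in> contexts K' \<Longrightarrow> h c \<in> contexts K"
    and "\<And>c. c \<in> contexts K' \<Longrightarrow> queries K (h c) = queries K' c"
    and "\<And>c. c \<in> contexts K' \<Longrightarrow> len K (h c) = len K' c"
  shows "ptime K' (\<lambda>c. e (h c)) (\<lambda>c. f (h c))"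
proof -
  obtain p T where T: "poly_bounded K T" "\<forall>c\<in>contexts K. \<exists>t\<le>T c. exec (queries K c) p (e c) t (f c)"
    using assms(1) by (auto simp: ptime_def)
  show ?thesis
  proof (rule ptimeI[where p = p])
    show "poly_bounded K' (\<lambda>c. T (h c))" by (rule poly_bounded_reindex[OF T(1) assms(2,4)])
    show "\<exists>t\<le>T (h c). exec (queries K' c) p (e (h c)) t (f (h c))" if "c \<in> contexts K'" for c
      using T(2) assms(2,3)[OF that] by metis
  qed
qed

lemma ptime_with_var: "ptime K e f \<Longrightarrow> ptime (with_var K A) (\<lambda>z. e (fst z)) (\<lambda>z. f (fst z))"
  by (erule ptime_reindex) auto

lemma ptime_Op:
  assumes "poly_bounded K (\<lambda>c. bits (e c))"
    and "poly_bounded K (\<lambda>c. bits (apply_op (queries K c) a (e c)))"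
  shows "ptime K e (\<lambda>c. apply_op (queries K c) a (e c))"
proof (rule ptimeI[where p = "Op a"])
  show "poly_bounded K (\<lambda>c. 1 + bits (e c) + bits (apply_op (queries K c) a (e c)))"
    by (intro poly_bounded_add poly_bounded_const assms)
qed (use exec.Op in blast)

lemma ptime_id: "poly_bounded K (\<lambda>c. bits (e c)) \<Longrightarrow> ptime K e e"
  using ptime_Op[of K e Ident] by simp

lemma ptime_const: "poly_bounded K (\<lambda>c. bits (e c)) \<Longrightarrow> ptime K e (\<lambda>_. v)"
  using ptime_Op[of K e "Const v"] by (simp add: poly_bounded_const)

lemma ptime_const': "ptime K e f \<Longrightarrow> ptime K e (\<lambda>_. v)"
  by (intro ptime_const ptime_bits)

lemma ptime_seq:
  assumes "ptime K e f" "ptime K f g"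
  shows "ptime K e g"
proof -
  obtain p T where T: "poly_bounded K T" "\<forall>c\<in>contexts K. \<exists>t\<le>T c. exec (queries K c) p (e c) t (f c)"
    using assms(1) by (auto simp: ptime_def)
  obtain p' T' where T': "poly_bounded K T'" "\<forall>c\<in>contexts K. \<exists>t\<le>T' c. exec (queries K c) p' (f c) t (g c)"
    using assms(2) by (auto simp: ptime_def)
  show ?thesis
  proof (rule ptimeI[where p = "Seq p p'"])
    show "poly_bounded K (\<lambda>c. 1 + T c + T' c)"
      by (intro poly_bounded_add poly_bounded_const T T')
    fix c assume "c \<in> contexts K"
    with T T' obtain t t' where "t \<le> T c" "exec (queries K c) p (e c) t (f c)"
      "t' \<le> T' c" "exec (queries K c) p' (f c) t' (g c)" by meson
    then show "\<exists>t\<le>1 + T c + T' c. exec (queries K c) (Seq p p') (e c) t (g c)"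
      by (intro exI[of _ "1 + t + t'"]) (auto intro: exec.Seq[of _ _ _ t _ _ t', simplified])
  qed
qed

lemma ptime_pair:
  assumes "ptime K e f" "ptime K e g"
  shows "ptime K e (\<lambda>c. Pr (f c) (g c))"
proof -
  obtain p T where T: "poly_bounded K T" "\<forall>c\<in>contexts K. \<exists>t\<le>T c. exec (queries K c) p (e c) t (f c)"
    using assms(1) by (auto simp: ptime_def)
  obtain p' T' where T': "poly_bounded K T'" "\<forall>c\<in>contexts K. \<exists>t\<le>T' c. exec (queries K c) p' (e c) t (g c)"
    using assms(2) by (auto simp: ptime_def)
  show ?thesis
  proof (rule ptimeI[where p = "Fork p p'"])
    show "poly_bounded K (\<lambda>c. 1 + T c + T' c)"
      by (intro poly_bounded_add poly_bounded_const T T')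
    fix c assume "c \<in> contexts K"
    with T T' obtain t t' where "t \<le> T c" "exec (queries K c) p (e c) t (f c)"
      "t' \<le> T' c" "exec (queries K c) p' (e c) t' (g c)" by meson
    then show "\<exists>t\<le>1 + T c + T' c. exec (queries K c) (Fork p p') (e c) t (Pr (f c) (g c))"
      by (intro exI[of _ "1 + t + t'"]) (auto intro: exec.Fork[of _ _ _ t _ _ t', simplified])
  qed
qed

definition enc_bool :: "bool \<Rightarrow> val" where
  "enc_bool b = Num (if b then 1 else 0)"

text \<open>Both branches have to be polynomial on all contexts, even on those that the test keeps
  away from them.\<close>

lemma ptime_if:
  assumes "ptime K e (\<lambda>c. enc_bool (P c))" "ptime K e f" "ptime K e g"
  shows "ptime K e (\<lambda>c. if P c then f c else g c)"
proof -
  obtain q S where S: "poly_bounded K S" "\<forall>c\<in>contexts K. \<exists>t\<le>S c. exec (queries K c) q (e c) t (enc_bool (P c))"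
    using assms(1) by (auto simp: ptime_def)
  obtain p T where T: "poly_bounded K T" "\<forall>c\<in>contexts K. \<exists>t\<le>T c. exec (queries K c) p (e c) t (f c)"
    using assms(2) by (auto simp: ptime_def)
  obtain p' T' where T': "poly_bounded K T'" "\<forall>c\<in>contexts K. \<exists>t\<le>T' c. exec (queries K c) p' (e c) t (g c)"
    using assms(3) by (auto simp: ptime_def)
  show ?thesis
  proof (rule ptimeI[where p = "Cond q p p'"])
    show "poly_bounded K (\<lambda>c. 1 + S c + T c + T' c)"
      by (intro poly_bounded_add poly_bounded_const S T T')
    fix c assume c: "c \<in> contexts K"
    obtain s where s: "s \<le> S c" "exec (queries K c) q (e c) s (enc_bool (P c))"
      using S(2) c by blast
    obtain t where t: "t \<le> T c" "exec (queries K c) p (e c) t (f c)"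
      using T(2) c by blast
    obtain t' where t': "t' \<le> T' c" "exec (queries K c) p' (e c) t' (g c)"
      using T'(2) c by blast
    show "\<exists>t\<le>1 + S c + T c + T' c. exec (queries K c) (Cond q p p') (e c) t (if P c then f c else g c)"
    proof (cases "P c")
      case True
      then have "exec (queries K c) (Cond q p p') (e c) (1 + s + t) (f c)"
        using exec.Cond_True[OF s(2) _ t(2)] by (simp add: enc_bool_def)
      with True s t show ?thesis by (intro exI[of _ "1 + s + t"]) auto
    next
      case False
      then have "exec (queries K c) (Cond q p p') (e c) (1 + s + t') (g c)"
        using exec.Cond_False[OF _ t'(2)] s(2) by (simp add: enc_bool_def)
      with False s t' show ?thesis by (intro exI[of _ "1 + s + t'"]) auto
    qed
  qed
qed

text \<open>\<open>s c i\<close> is the store after \<open>i\<close> rounds. The round number is a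
  loop variable, so one test and one body with uniform bounds serve all rounds.\<close>

lemma ptime_while:
  assumes N: "poly_bounded K N"
    and test: "ptime (with_var K (\<lambda>c. {..N c})) (\<lambda>z. s (fst z) (snd z)) (\<lambda>z. enc_bool (snd z < N (fst z)))"
    and body: "ptime (with_var K (\<lambda>c. {..<N c})) (\<lambda>z. s (fst z) (snd z)) (\<lambda>z. s (fst z) (Suc (snd z)))"
  shows "ptime K (\<lambda>c. s c 0) (\<lambda>c. s c (N c))"
proof -
  obtain q S' where S': "poly_bounded (with_var K (\<lambda>c. {..N c})) S'"
    "\<forall>z\<in>contexts (with_var K (\<lambda>c. {..N c})). \<exists>t\<le>S' z.
       exec (queries K (fst z)) q (s (fst z) (snd z)) t (enc_bool (snd z < N (fst z)))"
    using test by (auto simp: ptime_def)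
  obtain p T' where T': "poly_bounded (with_var K (\<lambda>c. {..<N c})) T'"
    "\<forall>z\<in>contexts (with_var K (\<lambda>c. {..<N c})). \<exists>t\<le>T' z.
       exec (queries K (fst z)) p (s (fst z) (snd z)) t (s (fst z) (Suc (snd z)))"
    using body by (auto simp: ptime_def)
  obtain S where S: "poly_bounded K S" "\<And>c i. c \<in> contexts K \<Longrightarrow> i \<in> {..N c} \<Longrightarrow> S' (c, i) \<le> S c"
    using poly_bounded_uniform[OF S'(1)] by blast
  obtain T where T: "poly_bounded K T" "\<And>c i. c \<in> contexts K \<Longrightarrow> i \<in> {..<N c} \<Longrightarrow> T' (c, i) \<le> T c"
    using poly_bounded_uniform[OF T'(1)] by blast
  show ?thesis
  proof (rule ptimeI[where p = "While q p"])
    show "poly_bounded K (\<lambda>c. N c * (1 + S c + T c) + (1 + S c))"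
      by (intro poly_bounded_add poly_bounded_mult poly_bounded_const N S T)
    fix c assume c: "c \<in> contexts K"
    \<comment> \<open>Induction on the number \<open>k\<close> of rounds still to come, since
      \<open>While\<close> unfolds from the front; the last summand pays for the final failing
      test.\<close>
    have "\<exists>t \<le> k * (1 + S c + T c) + (1 + S c). exec (queries K c) (While q p) (s c (N c - k)) t (s c (N c))"
      if "k \<le> N c" for k
      using that
    proof (induction k)
      case 0
      from c S'(2) have "\<exists>t\<le>S' (c, N c). exec (queries K c) q (s c (N c)) t (Num 0)"
        by (force simp: enc_bool_def)
      then obtain t where t: "t \<le> S c" "exec (queries K c) q (s c (N c)) t (Num 0)"
        using S(2)[OF c, of "N c"] by (auto intro: order_trans)
      show ?case
        by (rule exI[of _ "1 + t"]) (use t exec.While_False[OF t(2), of p] in auto)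
    next
      case (Suc k)
      let ?i = "N c - Suc k"
      have i: "?i < N c" "Suc ?i = N c - k" using Suc.prems by auto
      have "\<exists>t\<le>S' (c, ?i). exec (queries K c) q (s c ?i) t (Num 1)"
        using c i(1) S'(2)[rule_format, of "(c, ?i)"] by (auto simp: enc_bool_def)
      then obtain t where t: "t \<le> S c" "exec (queries K c) q (s c ?i) t (Num 1)"
        using S(2)[OF c, of ?i] by (auto intro: order_trans)
      have "\<exists>t\<le>T' (c, ?i). exec (queries K c) p (s c ?i) t (s c (N c - k))"
        using c i T'(2)[rule_format, of "(c, ?i)"] by auto
      then obtain t' where t': "t' \<le> T c" "exec (queries K c) p (s c ?i) t' (s c (N c - k))"
        using T(2)[OF c, of ?i] i(1) by (auto intro: order_trans)
      obtain u where u: "u \<le> k * (1 + S c + T c) + (1 + S c)"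
        "exec (queries K c) (While q p) (s c (N c - k)) u (s c (N c))"
        using Suc by auto
      have "exec (queries K c) (While q p) (s c ?i) (1 + t + t' + u) (s c (N c))"
        by (rule exec.While_True[OF t(2) _ t'(2) u(2)]) simp
      moreover have "1 + t + t' + u \<le> Suc k * (1 + S c + T c) + (1 + S c)"
        using t(1) t'(1) u(1) by simp
      ultimately show ?case by blast
    qed
    from this[of "N c"] show "\<exists>t\<le>N c * (1 + S c + T c) + (1 + S c).
       exec (queries K c) (While q p) (s c 0) t (s c (N c))" by simp
  qed
qed

lemma ptime_left:
  assumes "ptime K e (\<lambda>c. Pr (a c) (b c))"
  shows "ptime K e a"
proof -
  note p = ptime_bits(2)[OF assms]
  have "poly_bounded K (\<lambda>c. bits (a c))" by (rule poly_bounded_mono[OF p]) simp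
  with ptime_Op[OF p, of Left] ptime_seq[OF assms] show ?thesis by simp
qed

lemma ptime_right:
  assumes "ptime K e (\<lambda>c. Pr (a c) (b c))"
  shows "ptime K e b"
proof -
  note p = ptime_bits(2)[OF assms]
  have "poly_bounded K (\<lambda>c. bits (b c))" by (rule poly_bounded_mono[OF p]) simp
  with ptime_Op[OF p, of Right] ptime_seq[OF assms] show ?thesis by simp
qed

section \<open>Bit lengths and arithmetic on natural numbers\<close>

lemma floorlog_0 [simp]: "floorlog b 0 = 0"
  by (simp add: floorlog_def)

lemma bits_enc_nat: "bits (enc_nat a) = Suc (floorlog 2 a)"
  by (simp add: enc_nat_def)

lemma bits_enc_nat_mono: "a \<le> b \<Longrightarrow> bits (enc_nat a) \<le> bits (enc_nat b)"
  by (simp add: bits_enc_nat floorlog_mono)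

lemma less_two_power_floorlog: "a < 2 ^ floorlog 2 a"
  using floorlog_leD[of 2 a "floorlog 2 a"] by simp

lemma bits_enc_nat_mult: "bits (enc_nat (a * b)) \<le> bits (enc_nat a) + bits (enc_nat b)"
proof -
  have "a * b < 2 ^ floorlog 2 a * 2 ^ floorlog 2 b"
    by (intro mult_strict_mono less_two_power_floorlog) auto
  then have "floorlog 2 (a * b) \<le> floorlog 2 a + floorlog 2 b"
    by (intro floorlog_leI) (auto simp: power_add)
  then show ?thesis by (simp add: bits_enc_nat)
qed

lemma bits_enc_nat_add: "bits (enc_nat (a + b)) \<le> bits (enc_nat a) + bits (enc_nat b)"
proof -
  have "a + b < 2 ^ floorlog 2 a + 2 ^ floorlog 2 b"
    by (intro add_strict_mono less_two_power_floorlog)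
  also have "\<dots> \<le> 2 ^ (floorlog 2 a + floorlog 2 b) + 2 ^ (floorlog 2 a + floorlog 2 b)"
    by (intro add_mono power_increasing) auto
  finally have "floorlog 2 (a + b) \<le> Suc (floorlog 2 a + floorlog 2 b)"
    by (intro floorlog_leI) auto
  then show ?thesis by (simp add: bits_enc_nat)
qed

lemma ptime_Op_pair:
  assumes "ptime K e f" "ptime K e g"
    and "poly_bounded K (\<lambda>c. bits (apply_op (queries K c) a (Pr (f c) (g c))))"
  shows "ptime K e (\<lambda>c. apply_op (queries K c) a (Pr (f c) (g c)))"
  using ptime_pair[OF assms(1,2)] ptime_Op[OF ptime_bits(2)[OF ptime_pair[OF assms(1,2)]] assms(3)]
  by (rule ptime_seq)

lemma ptime_add:
  assumes "ptime K e (\<lambda>c. enc_nat (a c))" "ptime K e (\<lambda>c. enc_nat (b c))"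
  shows "ptime K e (\<lambda>c. enc_nat (a c + b c))"
proof -
  have "poly_bounded K (\<lambda>c. bits (enc_nat (a c + b c)))"
    by (rule poly_bounded_mono[OF poly_bounded_add[OF ptime_bits(2)[OF assms(1)] ptime_bits(2)[OF assms(2)]]])
      (rule bits_enc_nat_add)
  with ptime_Op_pair[OF assms, of Add] show ?thesis by (simp add: enc_nat_def)
qed

lemma ptime_mult:
  assumes "ptime K e (\<lambda>c. enc_nat (a c))" "ptime K e (\<lambda>c. enc_nat (b c))"
  shows "ptime K e (\<lambda>c. enc_nat (a c * b c))"
proof -
  have "poly_bounded K (\<lambda>c. bits (enc_nat (a c * b c)))"
    by (rule poly_bounded_mono[OF poly_bounded_add[OF ptime_bits(2)[OF assms(1)] ptime_bits(2)[OF assms(2)]]])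
      (rule bits_enc_nat_mult)
  with ptime_Op_pair[OF assms, of Mul] show ?thesis by (simp add: enc_nat_def)
qed

lemma ptime_div:
  assumes "ptime K e (\<lambda>c. enc_nat (a c))" "ptime K e (\<lambda>c. enc_nat (b c))"
  shows "ptime K e (\<lambda>c. enc_nat (a c div b c))"
proof -
  have "poly_bounded K (\<lambda>c. bits (enc_nat (a c div b c)))"
    by (rule poly_bounded_mono[OF ptime_bits(2)[OF assms(1)]]) (simp add: bits_enc_nat_mono)
  with ptime_Op_pair[OF assms, of Div] show ?thesis by (simp add: enc_nat_def zdiv_int)
qed

lemma ptime_less:
  assumes "ptime K e (\<lambda>c. enc_nat (a c))" "ptime K e (\<lambda>c. enc_nat (b c))"
  shows "ptime K e (\<lambda>c. enc_bool (a c < b c))"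
proof -
  have "poly_bounded K (\<lambda>c. bits (enc_bool (a c < b c)))"
    by (rule poly_bounded_mono[OF poly_bounded_const[of _ "bits (Num 1)"]]) (simp add: enc_bool_def floorlog_mono)
  moreover have "apply_op q Less (Pr (enc_nat x) (enc_nat y)) = enc_bool (x < y)" for q x y
    by (simp add: enc_bool_def enc_nat_def)
  ultimately show ?thesis using ptime_Op_pair[OF assms, of Less] by simp
qed

lemma ptime_not:
  assumes "ptime K e (\<lambda>c. enc_bool (P c))"
  shows "ptime K e (\<lambda>c. enc_bool (\<not> P c))"
  by (rule ptime_cong[OF ptime_if[OF assms ptime_const'[OF assms] ptime_const'[OF assms]]])
    (auto simp: enc_bool_def)

lemma ptime_conj:
  assumes "ptime K e (\<lambda>c. enc_bool (P c))" "ptime K e (\<lambda>c. enc_bool (Q c))"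
  shows "ptime K e (\<lambda>c. enc_bool (P c \<and> Q c))"
  by (rule ptime_cong[OF ptime_if[OF assms ptime_const'[OF assms(1), of "Num 0"]]])
    (auto simp: enc_bool_def)

lemma ptime_le:
  assumes "ptime K e (\<lambda>c. enc_nat (a c))" "ptime K e (\<lambda>c. enc_nat (b c))"
  shows "ptime K e (\<lambda>c. enc_bool (a c \<le> b c))"
  by (rule ptime_cong[OF ptime_not[OF ptime_less[OF assms(2,1)]]]) (auto simp: not_less)

lemma ptime_eq:
  assumes "ptime K e (\<lambda>c. enc_nat (a c))" "ptime K e (\<lambda>c. enc_nat (b c))"
  shows "ptime K e (\<lambda>c. enc_bool (a c = b c))"
  by (rule ptime_cong[OF ptime_conj[OF ptime_le[OF assms] ptime_le[OF assms(2,1)]]]) (auto simp: eq_iff)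

lemma ptime_if_nat:
  assumes "ptime K e (\<lambda>c. enc_bool (P c))" "ptime K e (\<lambda>c. enc_nat (a c))" "ptime K e (\<lambda>c. enc_nat (b c))"
  shows "ptime K e (\<lambda>c. enc_nat (if P c then a c else b c))"
  by (rule ptime_cong[OF ptime_if[OF assms]]) auto

lemma ptime_min:
  assumes "ptime K e (\<lambda>c. enc_nat (a c))" "ptime K e (\<lambda>c. enc_nat (b c))"
  shows "ptime K e (\<lambda>c. enc_nat (min (a c) (b c)))"
  unfolding min_def by (intro ptime_if_nat ptime_le assms)

lemma ptime_max:
  assumes "ptime K e (\<lambda>c. enc_nat (a c))" "ptime K e (\<lambda>c. enc_nat (b c))"
  shows "ptime K e (\<lambda>c. enc_nat (max (a c) (b c)))"
  unfolding max_def by (intro ptime_if_nat ptime_le assms)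

lemma ptime_diff:
  assumes "ptime K e (\<lambda>c. enc_nat (a c))" "ptime K e (\<lambda>c. enc_nat (b c))"
  shows "ptime K e (\<lambda>c. enc_nat (a c - b c))"
proof -
  \<comment> \<open>The machine subtracts integers; capping the subtrahend gives the truncated
    difference of natural numbers.\<close>
  let ?b = "\<lambda>c. min (a c) (b c)"
  have b: "ptime K e (\<lambda>c. enc_nat (?b c))" by (intro ptime_min assms)
  have "poly_bounded K (\<lambda>c. bits (enc_nat (a c - b c)))"
    by (rule poly_bounded_mono[OF ptime_bits(2)[OF assms(1)]]) (simp add: bits_enc_nat_mono)
  moreover have "apply_op q Sub (Pr (enc_nat (a c)) (enc_nat (?b c))) = enc_nat (a c - b c)" for q c
    by (auto simp: enc_nat_def min_def of_nat_diff)
  ultimately show ?thesis using ptime_Op_pair[OF assms(1) b, of Sub] by simp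
qed

lemma ptime_nat: "ptime K e f \<Longrightarrow> ptime K e (\<lambda>_. enc_nat k)"
  by (rule ptime_const')

text \<open>The elementary operations contain division but no remainder, which is therefore computed
  from quotient, product and difference.\<close>

lemma ptime_mod:
  assumes "ptime K e (\<lambda>c. enc_nat (a c))" "ptime K e (\<lambda>c. enc_nat (b c))"
  shows "ptime K e (\<lambda>c. enc_nat (a c mod b c))"
  unfolding modulo_nat_def by (intro ptime_diff ptime_mult ptime_div assms)

lemma ptime_is_pair:
  assumes "ptime K e f"
  shows "ptime K e (\<lambda>c. enc_bool (\<exists>u v. f c = Pr u v))"
proof -
  have eq: "apply_op q IsPair v = enc_bool (\<exists>u w. v = Pr u w)" for q v
    by (cases v) (auto simp: enc_bool_def)
  have "poly_bounded K (\<lambda>c. bits (enc_bool (\<exists>u v. f c = Pr u v)))"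
    by (rule poly_bounded_mono[OF poly_bounded_const[of _ "bits (Num 1)"]]) (simp add: enc_bool_def floorlog_mono)
  with ptime_Op[OF ptime_bits(2)[OF assms], of IsPair] ptime_seq[OF assms] eq
  show ?thesis by simp
qed

text \<open>The store of a body is the outer store with the loop variable paired on its right; an
  outer computation first projects to the left.\<close>

lemma ptime_lift:
  assumes "ptime K e f" "poly_bounded (with_var K A) (\<lambda>z. bits (x z))"
  shows "ptime (with_var K A) (\<lambda>z. Pr (e (fst z)) (x z)) (\<lambda>z. f (fst z))"
proof -
  have "poly_bounded (with_var K A) (\<lambda>z. bits (Pr (e (fst z)) (x z)))"
    unfolding bits.simps
    by (intro poly_bounded_add poly_bounded_const assms poly_bounded_with_var ptime_bits(1)[OF assms(1)])
  from ptime_left[OF ptime_id[OF this]] ptime_with_var[OF assms(1)]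
  show ?thesis by (rule ptime_seq)
qed

lemma ptime_var:
  assumes "poly_bounded K (\<lambda>c. bits (e c))" "poly_bounded (with_var K A) (\<lambda>z. bits (x z))"
  shows "ptime (with_var K A) (\<lambda>z. Pr (e (fst z)) (x z)) x"
proof -
  have "poly_bounded (with_var K A) (\<lambda>z. bits (Pr (e (fst z)) (x z)))"
    unfolding bits.simps
    by (intro poly_bounded_add poly_bounded_const assms poly_bounded_with_var)
  from ptime_right[OF ptime_id[OF this]] show ?thesis .
qed

section \<open>Encoded lists and loops over them\<close>

lemma bits_pos: "0 < bits v"
  by (cases v) auto

lemma bits_enc_list: "bits (enc_list e xs) = 1 + (\<Sum>x\<leftarrow>xs. 1 + bits (e x))"
  by (induction xs) (auto simp: floorlog_eq_zero_iff)

lemma bits_enc_list_le: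
  assumes "length xs \<le> n" "\<And>x. x \<in> set xs \<Longrightarrow> bits (e x) \<le> m"
  shows "bits (enc_list e xs) \<le> 1 + n * (1 + m)"
proof -
  have "(\<Sum>x\<leftarrow>xs. 1 + bits (e x)) \<le> (\<Sum>x\<leftarrow>xs. 1 + m)"
    by (intro sum_list_mono) (use assms in auto)
  also have "\<dots> = length xs * (1 + m)" by (simp add: sum_list_triv)
  also have "\<dots> \<le> n * (1 + m)" using assms by (intro mult_le_mono) auto
  finally show ?thesis by (simp add: bits_enc_list)
qed

lemma length_le_bits_enc_list: "length xs \<le> bits (enc_list e xs)"
  by (induction xs) auto

lemma bits_le_bits_enc_list: "x \<in> set xs \<Longrightarrow> bits (e x) \<le> bits (enc_list e xs)"
  by (induction xs) auto

text \<open>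
  In the rules for loops, the store \<open>e'\<close> of the body is arbitrary, provided that all that can be computed
  from the outer store \<open>e\<close> can be computed from it. Everything may thus be recomputed from the input
  wherever it is needed.
\<close>

lemma ptime_fold:
  fixes K :: "'c family" and xs :: "'c \<Rightarrow> 'a list" and s :: "'c \<Rightarrow> 's"
  assumes xs: "ptime K e (\<lambda>c. enc_list (ea c) (xs c))"
    and s: "ptime K e (\<lambda>c. es c (s c))"
    and R: "\<And>c i. c \<in> contexts K \<Longrightarrow> i \<le> length (xs c) \<Longrightarrow> R c (fold (f c) (take i (xs c)) (s c))"
    and bd: "poly_bounded (with_var K (\<lambda>c. Collect (R c))) (\<lambda>z. bits (es (fst z) (snd z)))"
    and step: "\<And>e'. (\<And>g. ptime K e g \<Longrightarrow>
            ptime (with_var K (\<lambda>c. set (xs c) \<times> Collect (R c))) e' (\<lambda>z. g (fst z))) \<Longrightarrow>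
        ptime (with_var K (\<lambda>c. set (xs c) \<times> Collect (R c))) e' (\<lambda>z. ea (fst z) (fst (snd z))) \<Longrightarrow>
        ptime (with_var K (\<lambda>c. set (xs c) \<times> Collect (R c))) e' (\<lambda>z. es (fst z) (snd (snd z))) \<Longrightarrow>
        ptime (with_var K (\<lambda>c. set (xs c) \<times> Collect (R c))) e'
          (\<lambda>z. es (fst z) (f (fst z) (fst (snd z)) (snd (snd z))))"
  shows "ptime K e (\<lambda>c. es c (fold (f c) (xs c) (s c)))"
proof -
  let ?N = "\<lambda>c. length (xs c)"
  let ?a = "\<lambda>c i. fold (f c) (take i (xs c)) (s c)"
  \<comment> \<open>The loop store carries the outer store, the unread part of the list and the
    accumulator, because a round has nothing else to start from.\<close>
  let ?s = "\<lambda>c i. Pr (e c) (Pr (enc_list (ea c) (drop i (xs c))) (es c (?a c i)))"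
  let ?K2 = "with_var K (\<lambda>c. set (xs c) \<times> Collect (R c))"
  let ?K1 = "with_var K (\<lambda>c. {..<?N c})"
  let ?K0 = "with_var K (\<lambda>c. {..?N c})"
  let ?e2 = "\<lambda>z. Pr (ea (fst z) (fst (snd z))) (es (fst z) (snd (snd z)))"
  note bits_xs = ptime_bits(2)[OF xs]
  \<comment> \<open>The body is analysed for all accumulators that satisfy the invariant
    \<open>R\<close>, not just for those that occur, so that its variable is simply a pair of an
    element and an accumulator.\<close>
  have step': "ptime ?K2 (\<lambda>z. Pr (e (fst z)) (?e2 z)) (\<lambda>z. es (fst z) (f (fst z) (fst (snd z)) (snd (snd z))))"
  proof (rule step)
    have ea: "poly_bounded ?K2 (\<lambda>z. bits (ea (fst z) (fst (snd z))))"
      by (rule poly_bounded_with_varI[OF bits_xs]) (auto intro: bits_le_bits_enc_list)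
    have es: "poly_bounded ?K2 (\<lambda>z. bits (es (fst z) (snd (snd z))))"
      using poly_bounded_reindex[OF bd, of ?K2 "\<lambda>z. (fst z, snd (snd z))"] by auto
    have e2: "poly_bounded ?K2 (\<lambda>z. bits (?e2 z))"
      unfolding bits.simps by (intro poly_bounded_add poly_bounded_const ea es)
    show "ptime ?K2 (\<lambda>z. Pr (e (fst z)) (?e2 z)) (\<lambda>z. g (fst z))" if "ptime K e g" for g
      by (rule ptime_lift[OF that e2])
    have "ptime ?K2 (\<lambda>z. Pr (e (fst z)) (?e2 z)) ?e2"
      by (rule ptime_var[OF ptime_bits(1)[OF xs] e2])
    from ptime_left[OF this] ptime_right[OF this]
    show "ptime ?K2 (\<lambda>z. Pr (e (fst z)) (?e2 z)) (\<lambda>z. ea (fst z) (fst (snd z)))"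
      "ptime ?K2 (\<lambda>z. Pr (e (fst z)) (?e2 z)) (\<lambda>z. es (fst z) (snd (snd z)))" by auto
  qed
  have bits_drop: "bits (enc_list g (drop i ys)) \<le> bits (enc_list g ys)" for g :: "'a \<Rightarrow> val" and i ys
    by (induction ys arbitrary: i) (auto simp: drop_Cons' intro: le_SucI trans_le_add2)
  have s0: "poly_bounded ?K0 (\<lambda>z. bits (?s (fst z) (snd z)))"
  proof -
    have 1: "poly_bounded ?K0 (\<lambda>z. bits (e (fst z)))"
      by (rule poly_bounded_with_var[OF ptime_bits(1)[OF xs]])
    have 2: "poly_bounded ?K0 (\<lambda>z. bits (enc_list (ea (fst z)) (drop (snd z) (xs (fst z)))))"
      by (rule poly_bounded_with_varI[OF bits_xs]) (rule bits_drop)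
    have 3: "poly_bounded ?K0 (\<lambda>z. bits (es (fst z) (?a (fst z) (snd z))))"
      using poly_bounded_reindex[OF bd, of ?K0 "\<lambda>z. (fst z, ?a (fst z) (snd z))"] R by auto
    show ?thesis unfolding bits.simps by (intro poly_bounded_add poly_bounded_const 1 2 3)
  qed
  have "ptime K (\<lambda>c. ?s c 0) (\<lambda>c. ?s c (?N c))"
  proof (rule ptime_while)
    show "poly_bounded K ?N"
      by (rule poly_bounded_mono[OF bits_xs]) (rule length_le_bits_enc_list)
    \<comment> \<open>No counter is stored: the unread list is encoded by a pair exactly as long as
      a round remains.\<close>
    have "ptime ?K0 (\<lambda>z. ?s (fst z) (snd z))
       (\<lambda>z. enc_bool (\<exists>u v. enc_list (ea (fst z)) (drop (snd z) (xs (fst z))) = Pr u v))"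
      by (rule ptime_is_pair[OF ptime_left[OF ptime_right[OF ptime_id[OF s0]]]])
    moreover have "(\<exists>u v. enc_list g ys = Pr u v) \<longleftrightarrow> ys \<noteq> []" for g :: "'a \<Rightarrow> val" and ys
      by (cases ys) auto
    ultimately show "ptime ?K0 (\<lambda>z. ?s (fst z) (snd z)) (\<lambda>z. enc_bool (snd z < ?N (fst z)))"
      by (simp add: not_le)
    have s1: "poly_bounded ?K1 (\<lambda>z. bits (?s (fst z) (snd z)))"
      using poly_bounded_reindex[OF s0, of ?K1 "\<lambda>z. z"] by auto
    note id = ptime_id[OF s1]
    let ?x = "\<lambda>z. xs (fst z) ! snd z"
    have "ptime ?K1 (\<lambda>z. ?s (fst z) (snd z))
       (\<lambda>z. Pr (ea (fst z) (?x z)) (enc_list (ea (fst z)) (drop (Suc (snd z)) (xs (fst z)))))"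
      by (rule ptime_cong[OF ptime_left[OF ptime_right[OF id]]]) (simp add: Cons_nth_drop_Suc[symmetric])
    note x = ptime_left[OF this] and xs' = ptime_right[OF this]
    have "ptime ?K1 (\<lambda>z. ?s (fst z) (snd z))
       (\<lambda>z. Pr (e (fst z)) (Pr (ea (fst z) (?x z)) (es (fst z) (?a (fst z) (snd z)))))"
      by (rule ptime_pair[OF ptime_left[OF id] ptime_pair[OF x ptime_right[OF ptime_right[OF id]]]])
    moreover have "ptime ?K1 (\<lambda>z. Pr (e (fst z)) (Pr (ea (fst z) (?x z)) (es (fst z) (?a (fst z) (snd z)))))
       (\<lambda>z. es (fst z) (f (fst z) (?x z) (?a (fst z) (snd z))))"
      using ptime_reindex[OF step', of ?K1 "\<lambda>z. (fst z, (?x z, ?a (fst z) (snd z)))"] R by auto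
    ultimately have a': "ptime ?K1 (\<lambda>z. ?s (fst z) (snd z)) (\<lambda>z. es (fst z) (f (fst z) (?x z) (?a (fst z) (snd z))))"
      by (rule ptime_seq)
    show "ptime ?K1 (\<lambda>z. ?s (fst z) (snd z)) (\<lambda>z. ?s (fst z) (Suc (snd z)))"
      by (rule ptime_cong[OF ptime_pair[OF ptime_left[OF id] ptime_pair[OF xs' a']]])
        (auto simp: take_Suc_conv_app_nth)
  qed
  then have fin: "ptime K (\<lambda>c. Pr (e c) (Pr (enc_list (ea c) (xs c)) (es c (s c))))
      (\<lambda>c. es c (fold (f c) (xs c) (s c)))"
    using ptime_right[OF ptime_right] by fastforce
  have "ptime K e (\<lambda>c. Pr (e c) (Pr (enc_list (ea c) (xs c)) (es c (s c))))"
    by (intro ptime_pair ptime_id ptime_bits(1)[OF xs] xs s)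
  from this fin show ?thesis by (rule ptime_seq)
qed

subsection \<open>Lists and natural numbers in polynomial time\<close>

text \<open>Substitution for the bound variable: a body, once analysed, can be run wherever its
  outer store and a value for its variable can be computed.\<close>

lemma ptime_apply:
  assumes "ptime (with_var K A) (\<lambda>z. Pr (e (fst z)) (ea (fst z) (snd z))) (\<lambda>z. g (fst z) (snd z))"
    and "ptime K' e' (\<lambda>w. e (p w))" "ptime K' e' (\<lambda>w. ea (p w) (x w))"
    and "\<And>w. w \<in> contexts K' \<Longrightarrow> p w \<in> contexts K \<and> x w \<in> A (p w)"
    and "\<And>w. w \<in> contexts K' \<Longrightarrow> queries K (p w) = queries K' w \<and> len K (p w) = len K' w"
  shows "ptime K' e' (\<lambda>w. g (p w) (x w))"
proof -
  have "ptime K' (\<lambda>w. Pr (e (p w)) (ea (p w) (x w))) (\<lambda>w. g (p w) (x w))"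
    using ptime_reindex[OF assms(1), of K' "\<lambda>w. (p w, x w)"] assms(4,5) by simp
  with ptime_pair[OF assms(2,3)] show ?thesis by (rule ptime_seq)
qed

text \<open>Instantiates a hypothesis about all body stores with the concrete paired store, which
  gives a program that \<open>ptime_apply\<close> can reuse.\<close>

lemma ptime_body:
  fixes K :: "'c family" and A :: "'c \<Rightarrow> 'a set"
  assumes "ptime K e f" "poly_bounded (with_var K A) (\<lambda>z. bits (ea (fst z) (snd z)))"
    and "\<And>e'. (\<And>g. ptime K e g \<Longrightarrow> ptime (with_var K A) e' (\<lambda>z. g (fst z))) \<Longrightarrow>
        ptime (with_var K A) e' (\<lambda>z. ea (fst z) (snd z)) \<Longrightarrow>
        ptime (with_var K A) e' (\<lambda>z. g (fst z) (snd z))"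
  shows "ptime (with_var K A) (\<lambda>z. Pr (e (fst z)) (ea (fst z) (snd z))) (\<lambda>z. g (fst z) (snd z))"
  by (rule assms(3)) (intro ptime_lift ptime_var assms(2) ptime_bits(1)[OF assms(1)] | assumption)+

lemma ptime_list_body:
  fixes K :: "'c family" and xs :: "'c \<Rightarrow> 'a list"
  assumes "ptime K e (\<lambda>c. enc_list (ea c) (xs c))"
    and "\<And>e'. (\<And>g. ptime K e g \<Longrightarrow> ptime (with_var K (\<lambda>c. set (xs c))) e' (\<lambda>z. g (fst z))) \<Longrightarrow>
        ptime (with_var K (\<lambda>c. set (xs c))) e' (\<lambda>z. ea (fst z) (snd z)) \<Longrightarrow>
        ptime (with_var K (\<lambda>c. set (xs c))) e' (\<lambda>z. g (fst z) (snd z))"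
  shows "ptime (with_var K (\<lambda>c. set (xs c))) (\<lambda>z. Pr (e (fst z)) (ea (fst z) (snd z))) (\<lambda>z. g (fst z) (snd z))"
proof (rule ptime_body[OF assms(1) _ assms(2)])
  show "poly_bounded (with_var K (\<lambda>c. set (xs c))) (\<lambda>z. bits (ea (fst z) (snd z)))"
    by (rule poly_bounded_with_varI[OF ptime_bits(2)[OF assms(1)]]) (rule bits_le_bits_enc_list)
qed

lemma enc_list_map: "enc_list e (map f xs) = enc_list (\<lambda>x. e (f x)) xs"
  by (induction xs) auto

lemma bits_enc_list_take: "bits (enc_list e (take i xs)) \<le> bits (enc_list e xs)"
  by (induction xs arbitrary: i) (auto simp: take_Cons' floorlog_eq_zero_iff Suc_leI bits_pos)

lemma bits_enc_list_append:
  "bits (enc_list e (xs @ ys)) + 1 = bits (enc_list e xs) + bits (enc_list e ys)"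
  by (simp add: bits_enc_list)

lemma bits_enc_list_rev: "bits (enc_list e (rev xs)) = bits (enc_list e xs)"
  by (simp add: bits_enc_list rev_map[symmetric])

lemma bits_enc_list_filter: "bits (enc_list e (filter P xs)) \<le> bits (enc_list e xs)"
  by (induction xs) auto

lemma bits_enc_list_concat: "bits (enc_list e (concat xss)) \<le> bits (enc_list (enc_list e) xss)"
proof (induction xss)
  case (Cons xs xss)
  then show ?case using bits_enc_list_append[of e xs "concat xss"] by simp
qed simp

lemma ptime_Cons:
  assumes "ptime K e (\<lambda>c. ea c (x c))" "ptime K e (\<lambda>c. enc_list (ea c) (xs c))"
  shows "ptime K e (\<lambda>c. enc_list (ea c) (x c # xs c))"
  using ptime_pair[OF assms] by simp

lemma ptime_Nil: "ptime K e f \<Longrightarrow> ptime K e (\<lambda>c. enc_list (ea c) [])"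
  by (simp add: ptime_const')

lemma ptime_if_list:
  assumes "ptime K e (\<lambda>c. enc_bool (P c))"
    and "ptime K e (\<lambda>c. enc_list (ea c) (xs c))" "ptime K e (\<lambda>c. enc_list (ea c) (ys c))"
  shows "ptime K e (\<lambda>c. enc_list (ea c) (if P c then xs c else ys c))"
  by (rule ptime_cong[OF ptime_if[OF assms]]) auto

lemma ptime_rev:
  assumes xs: "ptime K e (\<lambda>c. enc_list (ea c) (xs c))"
  shows "ptime K e (\<lambda>c. enc_list (ea c) (rev (xs c)))"
  unfolding foldl_conv_fold rev_conv_fold
proof (rule ptime_fold[where es = "\<lambda>c. enc_list (ea c)" and f = "\<lambda>_. Cons" and s = "\<lambda>_. []"
      and R = "\<lambda>c ys. bits (enc_list (ea c) ys) \<le> bits (enc_list (ea c) (xs c))", OF xs])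
  show "bits (enc_list (ea c) (fold (#) (take i (xs c)) [])) \<le> bits (enc_list (ea c) (xs c))" for c i
    by (simp add: rev_conv_fold[symmetric] bits_enc_list_rev bits_enc_list_take)
qed (rule ptime_Nil[OF xs], rule poly_bounded_with_varI[OF ptime_bits(2)[OF xs]], simp, rule ptime_Cons, assumption+)

lemma ptime_append:
  assumes xs: "ptime K e (\<lambda>c. enc_list (ea c) (xs c))" and ys: "ptime K e (\<lambda>c. enc_list (ea c) (ys c))"
  shows "ptime K e (\<lambda>c. enc_list (ea c) (xs c @ ys c))"
proof -
  let ?b = "\<lambda>c. bits (enc_list (ea c) (xs c)) + bits (enc_list (ea c) (ys c))"
  have b: "poly_bounded K ?b" by (intro poly_bounded_add ptime_bits(2)[OF xs] ptime_bits(2)[OF ys])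
  have eq: "fold Cons zs us = rev zs @ us" for zs us :: "'b list"
    by (induction zs arbitrary: us) auto
  have "ptime K e (\<lambda>c. enc_list (ea c) (fold Cons (rev (xs c)) (ys c)))"
  proof (rule ptime_fold[where es = "\<lambda>c. enc_list (ea c)" and R = "\<lambda>c zs. bits (enc_list (ea c) zs) \<le> ?b c",
        OF ptime_rev[OF xs] ys])
    fix c i
    have "bits (enc_list (ea c) (take i (rev (xs c)))) \<le> bits (enc_list (ea c) (xs c))"
      using bits_enc_list_take[of "ea c" i "rev (xs c)"] by (simp add: bits_enc_list_rev)
    then show "bits (enc_list (ea c) (fold (#) (take i (rev (xs c))) (ys c))) \<le> ?b c"
      using bits_enc_list_append[of "ea c" "rev (take i (rev (xs c)))" "ys c"]
      by (simp add: eq bits_enc_list_rev)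
  qed (rule poly_bounded_with_varI[OF b], simp, rule ptime_Cons, assumption+)
  then show ?thesis by (simp add: eq)
qed

lemma ptime_map:
  fixes K :: "'c family" and xs :: "'c \<Rightarrow> 'a list"
  assumes xs: "ptime K e (\<lambda>c. enc_list (ea c) (xs c))"
    and body: "\<And>e'. (\<And>g. ptime K e g \<Longrightarrow> ptime (with_var K (\<lambda>c. set (xs c))) e' (\<lambda>z. g (fst z))) \<Longrightarrow>
        ptime (with_var K (\<lambda>c. set (xs c))) e' (\<lambda>z. ea (fst z) (snd z)) \<Longrightarrow>
        ptime (with_var K (\<lambda>c. set (xs c))) e' (\<lambda>z. g (fst z) (snd z))"
  shows "ptime K e (\<lambda>c. enc_list (g c) (xs c))"
proof -
  note b = ptime_list_body[OF xs body]
  obtain G where G: "poly_bounded K G" "\<And>c x. c \<in> contexts K \<Longrightarrow> x \<in> set (xs c) \<Longrightarrow> bits (g c x) \<le> G c"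
    using poly_bounded_uniform[OF ptime_bits(2)[OF b]] by auto
  let ?B = "\<lambda>c. 1 + bits (enc_list (ea c) (xs c)) * (1 + G c)"
  have B: "poly_bounded K ?B"
    by (intro poly_bounded_add poly_bounded_const poly_bounded_mult G ptime_bits(2)[OF xs])
  \<comment> \<open>The accumulator collects values that are already encoded, so its entries are
    encoded by the identity. The fold builds the list backwards.\<close>
  let ?f = "\<lambda>c x acc. g c x # acc"
  have eq: "fold (?f c) ys [] = rev (map (g c) ys)" for c ys
    by (induction ys rule: rev_induct) auto
  have "ptime K e (\<lambda>c. enc_list (\<lambda>v. v) (fold (?f c) (xs c) []))"
  proof (rule ptime_fold[where es = "\<lambda>c. enc_list (\<lambda>v. v)" and R = "\<lambda>c acc. bits (enc_list (\<lambda>v. v) acc) \<le> ?B c", OF xs])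
    fix c i assume "c \<in> contexts K"
    then show "bits (enc_list (\<lambda>v. v) (fold (?f c) (take i (xs c)) [])) \<le> ?B c"
      unfolding eq
      by (intro bits_enc_list_le)
        (auto simp: min.coboundedI1 length_le_bits_enc_list dest: in_set_takeD intro!: G)
  next
    fix e' let ?K = "with_var K (\<lambda>c. set (xs c) \<times> {acc. bits (enc_list (\<lambda>v. v) acc) \<le> ?B c})"
    assume L: "\<And>g. ptime K e g \<Longrightarrow> ptime ?K e' (\<lambda>z. g (fst z))"
      and X: "ptime ?K e' (\<lambda>z. ea (fst z) (fst (snd z)))"
      and S: "ptime ?K e' (\<lambda>z. enc_list (\<lambda>v. v) (snd (snd z)))"
    have "ptime ?K e' (\<lambda>z. g (fst z) (fst (snd z)))"
      by (rule ptime_apply[OF b L[OF ptime_id[OF ptime_bits(1)[OF xs]]] X]) auto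
    then show "ptime ?K e' (\<lambda>z. enc_list (\<lambda>v. v) (?f (fst z) (fst (snd z)) (snd (snd z))))"
      by (rule ptime_Cons[where ea = "\<lambda>_ v. v", OF _ S])
  qed (rule ptime_Nil[OF xs], rule poly_bounded_with_varI[OF B], simp)
  then have "ptime K e (\<lambda>c. enc_list (\<lambda>v. v) (rev (map (g c) (xs c))))" unfolding eq .
  from ptime_rev[where ea = "\<lambda>_ v. v", OF this] show ?thesis by (simp add: enc_list_map)
qed

lemma ptime_filter:
  fixes K :: "'c family" and xs :: "'c \<Rightarrow> 'a list"
  assumes xs: "ptime K e (\<lambda>c. enc_list (ea c) (xs c))"
    and body: "\<And>e'. (\<And>g. ptime K e g \<Longrightarrow> ptime (with_var K (\<lambda>c. set (xs c))) e' (\<lambda>z. g (fst z))) \<Longrightarrow>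
        ptime (with_var K (\<lambda>c. set (xs c))) e' (\<lambda>z. ea (fst z) (snd z)) \<Longrightarrow>
        ptime (with_var K (\<lambda>c. set (xs c))) e' (\<lambda>z. enc_bool (P (fst z) (snd z)))"
  shows "ptime K e (\<lambda>c. enc_list (ea c) (filter (P c) (xs c)))"
proof -
  note b = ptime_list_body[OF xs body]
  let ?B = "\<lambda>c. bits (enc_list (ea c) (xs c))"
  let ?f = "\<lambda>c x acc. if P c x then x # acc else acc"
  have eq: "fold (?f c) ys [] = rev (filter (P c) ys)" for c ys
    by (induction ys rule: rev_induct) auto
  have "ptime K e (\<lambda>c. enc_list (ea c) (fold (?f c) (xs c) []))"
  proof (rule ptime_fold[where es = "\<lambda>c. enc_list (ea c)" and R = "\<lambda>c acc. bits (enc_list (ea c) acc) \<le> ?B c", OF xs])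
    fix c i
    show "bits (enc_list (ea c) (fold (?f c) (take i (xs c)) [])) \<le> ?B c"
      unfolding eq bits_enc_list_rev using bits_enc_list_filter bits_enc_list_take order_trans by metis
  next
    fix e' let ?K = "with_var K (\<lambda>c. set (xs c) \<times> {acc. bits (enc_list (ea c) acc) \<le> ?B c})"
    assume L: "\<And>g. ptime K e g \<Longrightarrow> ptime ?K e' (\<lambda>z. g (fst z))"
      and X: "ptime ?K e' (\<lambda>z. ea (fst z) (fst (snd z)))"
      and S: "ptime ?K e' (\<lambda>z. enc_list (ea (fst z)) (snd (snd z)))"
    have "ptime ?K e' (\<lambda>z. enc_bool (P (fst z) (fst (snd z))))"
      by (rule ptime_apply[OF b L[OF ptime_id[OF ptime_bits(1)[OF xs]]] X]) auto
    then show "ptime ?K e' (\<lambda>z. enc_list (ea (fst z)) (?f (fst z) (fst (snd z)) (snd (snd z))))"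
      by (intro ptime_if_list ptime_Cons S X)
  qed (rule ptime_Nil[OF xs], rule poly_bounded_with_varI[OF ptime_bits(2)[OF xs]], simp)
  then have "ptime K e (\<lambda>c. enc_list (ea c) (rev (filter (P c) (xs c))))" unfolding eq .
  from ptime_rev[OF this] show ?thesis by simp
qed

lemma ptime_concat:
  assumes xss: "ptime K e (\<lambda>c. enc_list (enc_list (ea c)) (xss c))"
  shows "ptime K e (\<lambda>c. enc_list (ea c) (concat (xss c)))"
proof -
  let ?B = "\<lambda>c. bits (enc_list (enc_list (ea c)) (xss c))"
  have eq: "fold (\<lambda>x acc. acc @ x) yss [] = concat yss" for yss :: "'b list list"
    by (induction yss rule: rev_induct) auto
  have "ptime K e (\<lambda>c. enc_list (ea c) (fold (\<lambda>x acc. acc @ x) (xss c) []))"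
  proof (rule ptime_fold[where es = "\<lambda>c. enc_list (ea c)" and R = "\<lambda>c acc. bits (enc_list (ea c) acc) \<le> ?B c", OF xss])
    show "bits (enc_list (ea c) (fold (\<lambda>x acc. acc @ x) (take i (xss c)) [])) \<le> ?B c" for c i
      unfolding eq using bits_enc_list_concat bits_enc_list_take order_trans by metis
  qed (rule ptime_Nil[OF xss], rule poly_bounded_with_varI[OF ptime_bits(2)[OF xss]], simp, rule ptime_append, assumption+)
  then show ?thesis by (simp add: eq)
qed

text \<open>By \<open>bits_h\<close> a step lengthens the accumulator by at most the length of one
  term, so its length grows linearly with the number of steps. Sums, products and maxima all have
  this property.\<close>

lemma ptime_fold_nat:
  fixes K :: "'c family" and xs :: "'c \<Rightarrow> 'a list"
  assumes xs: "ptime K e (\<lambda>c. enc_list (ea c) (xs c))"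
    and a: "ptime K e (\<lambda>c. enc_nat (a c))"
    and body: "\<And>e'. (\<And>g. ptime K e g \<Longrightarrow> ptime (with_var K (\<lambda>c. set (xs c))) e' (\<lambda>z. g (fst z))) \<Longrightarrow>
        ptime (with_var K (\<lambda>c. set (xs c))) e' (\<lambda>z. ea (fst z) (snd z)) \<Longrightarrow>
        ptime (with_var K (\<lambda>c. set (xs c))) e' (\<lambda>z. enc_nat (g (fst z) (snd z)))"
    and h: "\<And>(K' :: ('c \<times> 'a \<times> nat) family) e' u v. ptime K' e' (\<lambda>c. enc_nat (u c)) \<Longrightarrow>
        ptime K' e' (\<lambda>c. enc_nat (v c)) \<Longrightarrow> ptime K' e' (\<lambda>c. enc_nat (h (u c) (v c)))"
    and bits_h: "\<And>x y. bits (enc_nat (h x y)) \<le> bits (enc_nat x) + bits (enc_nat y)"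
  shows "ptime K e (\<lambda>c. enc_nat (fold (\<lambda>x. h (g c x)) (xs c) (a c)))"
proof -
  note b = ptime_list_body[OF xs body]
  obtain G where G: "poly_bounded K G" "\<And>c x. c \<in> contexts K \<Longrightarrow> x \<in> set (xs c) \<Longrightarrow> bits (enc_nat (g c x)) \<le> G c"
    using poly_bounded_uniform[OF ptime_bits(2)[OF b]] by auto
  let ?B = "\<lambda>c. bits (enc_nat (a c)) + bits (enc_list (ea c) (xs c)) * G c"
  have B: "poly_bounded K ?B"
    by (intro poly_bounded_add poly_bounded_mult G ptime_bits(2)[OF xs] ptime_bits(2)[OF a])
  let ?f = "\<lambda>c x. h (g c x)"
  have le: "bits (enc_nat (fold (?f c) ys (a c))) \<le> bits (enc_nat (a c)) + length ys * G c"
    if "c \<in> contexts K" "set ys \<subseteq> set (xs c)" for c ys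
    using that(2)
  proof (induction ys rule: rev_induct)
    case (snoc y ys)
    then show ?case
      using bits_h[of "g c y" "fold (?f c) ys (a c)"] G(2)[OF that(1), of y] by (auto simp: algebra_simps)
  qed simp
  show ?thesis
  proof (rule ptime_fold[where es = "\<lambda>_. enc_nat" and R = "\<lambda>c s. bits (enc_nat s) \<le> ?B c", OF xs a])
    fix c i assume c: "c \<in> contexts K"
    have "length (take i (xs c)) * G c \<le> bits (enc_list (ea c) (xs c)) * G c"
      by (intro mult_le_mono1) (simp add: min.coboundedI1 length_le_bits_enc_list)
    with le[OF c set_take_subset, of i] show "bits (enc_nat (fold (?f c) (take i (xs c)) (a c))) \<le> ?B c"
      by linarith
  next
    fix e' let ?K = "with_var K (\<lambda>c. set (xs c) \<times> {s. bits (enc_nat s) \<le> ?B c})"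
    assume L: "\<And>g. ptime K e g \<Longrightarrow> ptime ?K e' (\<lambda>z. g (fst z))"
      and X: "ptime ?K e' (\<lambda>z. ea (fst z) (fst (snd z)))"
      and S: "ptime ?K e' (\<lambda>z. enc_nat (snd (snd z)))"
    have "ptime ?K e' (\<lambda>z. enc_nat (g (fst z) (fst (snd z))))"
      by (rule ptime_apply[OF b L[OF ptime_id[OF ptime_bits(1)[OF xs]]] X]) auto
    then show "ptime ?K e' (\<lambda>z. enc_nat (?f (fst z) (fst (snd z)) (snd (snd z))))"
      by (intro h S)
  qed (rule poly_bounded_with_varI[OF B], simp)
qed

lemma ptime_sum_list:
  fixes K :: "'c family" and xs :: "'c \<Rightarrow> 'a list"
  assumes xs: "ptime K e (\<lambda>c. enc_list (ea c) (xs c))"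
    and body: "\<And>e'. (\<And>g. ptime K e g \<Longrightarrow> ptime (with_var K (\<lambda>c. set (xs c))) e' (\<lambda>z. g (fst z))) \<Longrightarrow>
        ptime (with_var K (\<lambda>c. set (xs c))) e' (\<lambda>z. ea (fst z) (snd z)) \<Longrightarrow>
        ptime (with_var K (\<lambda>c. set (xs c))) e' (\<lambda>z. enc_nat (g (fst z) (snd z)))"
  shows "ptime K e (\<lambda>c. enc_nat (\<Sum>x\<leftarrow>xs c. g c x))"
proof -
  have "ptime K e (\<lambda>c. enc_nat (fold (\<lambda>x. (+) (g c x)) (xs c) 0))"
    by (rule ptime_fold_nat[OF xs ptime_nat[OF xs] body ptime_add bits_enc_nat_add])
  moreover have "fold (\<lambda>x. (+) (g c x)) ys 0 = (\<Sum>x\<leftarrow>ys. g c x)" for c ys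
    by (induction ys rule: rev_induct) auto
  ultimately show ?thesis by simp
qed

lemma ptime_prod_list:
  fixes K :: "'c family" and xs :: "'c \<Rightarrow> 'a list"
  assumes xs: "ptime K e (\<lambda>c. enc_list (ea c) (xs c))"
    and body: "\<And>e'. (\<And>g. ptime K e g \<Longrightarrow> ptime (with_var K (\<lambda>c. set (xs c))) e' (\<lambda>z. g (fst z))) \<Longrightarrow>
        ptime (with_var K (\<lambda>c. set (xs c))) e' (\<lambda>z. ea (fst z) (snd z)) \<Longrightarrow>
        ptime (with_var K (\<lambda>c. set (xs c))) e' (\<lambda>z. enc_nat (g (fst z) (snd z)))"
  shows "ptime K e (\<lambda>c. enc_nat (\<Prod>x\<leftarrow>xs c. g c x))"
proof -
  have "ptime K e (\<lambda>c. enc_nat (fold (\<lambda>x. times (g c x)) (xs c) 1))"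
    by (rule ptime_fold_nat[OF xs ptime_nat[OF xs] body ptime_mult bits_enc_nat_mult])
  moreover have "fold (\<lambda>x. times (g c x)) ys 1 = (\<Prod>x\<leftarrow>ys. g c x)" for c ys
    by (induction ys rule: rev_induct) auto
  ultimately show ?thesis by simp
qed

lemma ptime_fold_max:
  fixes K :: "'c family" and xs :: "'c \<Rightarrow> 'a list"
  assumes xs: "ptime K e (\<lambda>c. enc_list (ea c) (xs c))"
    and a: "ptime K e (\<lambda>c. enc_nat (a c))"
    and body: "\<And>e'. (\<And>g. ptime K e g \<Longrightarrow> ptime (with_var K (\<lambda>c. set (xs c))) e' (\<lambda>z. g (fst z))) \<Longrightarrow>
        ptime (with_var K (\<lambda>c. set (xs c))) e' (\<lambda>z. ea (fst z) (snd z)) \<Longrightarrow>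
        ptime (with_var K (\<lambda>c. set (xs c))) e' (\<lambda>z. enc_nat (g (fst z) (snd z)))"
  shows "ptime K e (\<lambda>c. enc_nat (fold (\<lambda>x. max (g c x)) (xs c) (a c)))"
  by (rule ptime_fold_nat[OF xs a body ptime_max]) (auto simp: max_def)

section \<open>Ranges, logarithms, powers, indexing and sorting\<close>

lemma ptime_length:
  assumes "ptime K e (\<lambda>c. enc_list (ea c) (xs c))"
  shows "ptime K e (\<lambda>c. enc_nat (length (xs c)))"
  using ptime_sum_list[where g = "\<lambda>_ _. 1", OF assms ptime_nat] by (simp add: sum_list_triv)

lemma ptime_upt:
  assumes n: "ptime K e (\<lambda>c. enc_nat (n c))" and bd: "poly_bounded K n"
  shows "ptime K e (\<lambda>c. enc_list enc_nat [0..<n c])"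
proof -
  \<comment> \<open>Counting down allows each number to be put at the front of the list, and the
    loop ends when the counter is 0.\<close>
  let ?s = "\<lambda>c i. Pr (enc_nat (n c - i)) (enc_list enc_nat [n c - i..<n c])"
  let ?B = "\<lambda>c. 1 + bits (enc_nat (n c)) + (1 + n c * (1 + bits (enc_nat (n c))))"
  have B: "poly_bounded K ?B"
    by (intro poly_bounded_add poly_bounded_mult poly_bounded_const bd ptime_bits(2)[OF n])
  have le: "bits (?s c i) \<le> ?B c" for c i
    unfolding bits.simps by (intro add_mono bits_enc_list_le bits_enc_nat_mono) auto
  have "ptime K (\<lambda>c. ?s c 0) (\<lambda>c. ?s c (n c))"
  proof (rule ptime_while[OF bd])
    let ?K = "with_var K (\<lambda>c. {..n c})"
    have id: "ptime ?K (\<lambda>z. ?s (fst z) (snd z)) (\<lambda>z. ?s (fst z) (snd z))"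
      by (intro ptime_id poly_bounded_with_varI[OF B] le)
    show "ptime ?K (\<lambda>z. ?s (fst z) (snd z)) (\<lambda>z. enc_bool (snd z < n (fst z)))"
      by (rule ptime_cong[OF ptime_less[OF ptime_nat[where k = 0, OF id] ptime_left[OF id]]]) simp
    let ?K = "with_var K (\<lambda>c. {..<n c})"
    have id: "ptime ?K (\<lambda>z. ?s (fst z) (snd z)) (\<lambda>z. ?s (fst z) (snd z))"
      by (intro ptime_id poly_bounded_with_varI[OF B] le)
    have d: "ptime ?K (\<lambda>z. ?s (fst z) (snd z)) (\<lambda>z. enc_nat (n (fst z) - snd z - 1))"
      by (intro ptime_diff ptime_left[OF id] ptime_nat[OF id])
    show "ptime ?K (\<lambda>z. ?s (fst z) (snd z)) (\<lambda>z. ?s (fst z) (Suc (snd z)))"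
    proof (rule ptime_cong[OF ptime_pair[OF d ptime_Cons[OF d ptime_right[OF id]]]])
      fix z assume "z \<in> contexts ?K"
      then have "Suc (n (fst z) - Suc (snd z)) = n (fst z) - snd z" "n (fst z) - Suc (snd z) < n (fst z)" by auto
      then show "Pr (enc_nat (n (fst z) - snd z - 1))
          (enc_list enc_nat ((n (fst z) - snd z - 1) # [n (fst z) - snd z..<n (fst z)])) =
         ?s (fst z) (Suc (snd z))" by (simp add: upt_conv_Cons)
    qed
  qed
  from ptime_right[OF this]
  have "ptime K (\<lambda>c. Pr (enc_nat (n c)) (enc_list enc_nat [])) (\<lambda>c. enc_list enc_nat [0..<n c])"
    by simp
  from ptime_seq[OF ptime_pair[OF n ptime_Nil[OF n]] this] show ?thesis .
qed

lemma ptime_floorlog: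
  assumes x: "ptime K e (\<lambda>c. enc_nat (x c))"
  shows "ptime K e (\<lambda>c. enc_nat (floorlog 2 (x c)))" "poly_bounded K (\<lambda>c. floorlog 2 (x c))"
proof -
  \<comment> \<open>\<open>floorlog 2 x\<close> is the number of halvings that bring
    \<open>x\<close> to 0, so the loop counts them.\<close>
  let ?s = "\<lambda>c i. Pr (enc_nat (x c div 2 ^ i)) (enc_nat i)"
  show bd: "poly_bounded K (\<lambda>c. floorlog 2 (x c))"
    by (rule poly_bounded_mono[OF ptime_bits(2)[OF x]]) (simp add: bits_enc_nat)
  let ?B = "\<lambda>c. 1 + bits (enc_nat (x c)) + (1 + floorlog 2 (x c))"
  have B: "poly_bounded K ?B"
    by (intro poly_bounded_add poly_bounded_mult poly_bounded_const bd ptime_bits(2)[OF x])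
  have le: "bits (?s c i) \<le> ?B c" if "i \<le> floorlog 2 (x c)" for c i
  proof -
    have "floorlog 2 i \<le> i" by (rule floorlog_leI) auto
    with that show ?thesis
      unfolding bits.simps by (intro add_mono bits_enc_nat_mono) (auto simp: bits_enc_nat)
  qed
  have "ptime K (\<lambda>c. ?s c 0) (\<lambda>c. ?s c (floorlog 2 (x c)))"
  proof (rule ptime_while[OF bd])
    let ?K = "with_var K (\<lambda>c. {..floorlog 2 (x c)})"
    have id: "ptime ?K (\<lambda>z. ?s (fst z) (snd z)) (\<lambda>z. ?s (fst z) (snd z))"
      by (intro ptime_id poly_bounded_with_varI[OF B] le) simp
    have "0 < y div 2 ^ i \<longleftrightarrow> i < floorlog 2 y" for y i :: nat
    proof -
      have "floorlog 2 y \<le> i \<longleftrightarrow> y < 2 ^ i" using floorlog_le_iff[of 2 y i] by simp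
      then show ?thesis unfolding div_greater_zero_iff by (meson not_le zero_less_numeral zero_less_power)
    qed
    then show "ptime ?K (\<lambda>z. ?s (fst z) (snd z)) (\<lambda>z. enc_bool (snd z < floorlog 2 (x (fst z))))"
      using ptime_less[OF ptime_nat[where k = 0, OF id] ptime_left[OF id]] by simp
    let ?K = "with_var K (\<lambda>c. {..<floorlog 2 (x c)})"
    have id: "ptime ?K (\<lambda>z. ?s (fst z) (snd z)) (\<lambda>z. ?s (fst z) (snd z))"
      by (intro ptime_id poly_bounded_with_varI[OF B] le) simp
    have "ptime ?K (\<lambda>z. ?s (fst z) (snd z))
       (\<lambda>z. Pr (enc_nat (x (fst z) div 2 ^ snd z div 2)) (enc_nat (snd z + 1)))"
      by (intro ptime_pair ptime_add ptime_div ptime_left[OF id] ptime_right[OF id] ptime_nat[OF id])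
    moreover have "y div 2 ^ Suc i = y div 2 ^ i div 2" for y i :: nat
      by (simp add: div_mult2_eq[symmetric] mult.commute)
    ultimately show "ptime ?K (\<lambda>z. ?s (fst z) (snd z)) (\<lambda>z. ?s (fst z) (Suc (snd z)))"
      by (simp del: power_Suc)
  qed
  from ptime_right[OF this]
  have "ptime K (\<lambda>c. Pr (enc_nat (x c)) (enc_nat 0)) (\<lambda>c. enc_nat (floorlog 2 (x c)))"
    by simp
  from ptime_seq[OF ptime_pair[OF x ptime_nat[OF x]] this] show "ptime K e (\<lambda>c. enc_nat (floorlog 2 (x c)))" .
qed

text \<open>The exponent has to be bounded in value and not only in length, because in general the
  length of the power is proportional to it.\<close>

lemma ptime_power:
  assumes "ptime K e (\<lambda>c. enc_nat (k c))" "poly_bounded K k"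
  shows "ptime K e (\<lambda>c. enc_nat (b ^ k c))"
  using ptime_prod_list[where g = "\<lambda>_ _. b", OF ptime_upt[OF assms] ptime_nat] by (simp add: map_replicate_const)

lemma ptime_nth:
  fixes K :: "'c family" and xs :: "'c \<Rightarrow> 'a list"
  assumes xs: "ptime K e (\<lambda>c. enc_list (ea c) (xs c))"
    and i: "ptime K e (\<lambda>c. enc_nat (i c))" and less: "\<And>c. c \<in> contexts K \<Longrightarrow> i c < length (xs c)"
  shows "ptime K e (\<lambda>c. ea c (xs c ! i c))"
proof -
  let ?es = "\<lambda>s. Pr (enc_nat (fst s)) (snd s)"
  \<comment> \<open>One pass over the list with a counter; \<open>Num 0\<close> is held until the
    counter meets the index.\<close>
  let ?f = "\<lambda>c x s. (fst s + 1, if fst s = i c then ea c x else snd s)"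
  let ?R = "\<lambda>c s. fst s \<le> length (xs c) \<and> bits (snd s) \<le> bits (enc_list (ea c) (xs c))"
  let ?B = "\<lambda>c. 1 + bits (enc_nat (length (xs c))) + bits (enc_list (ea c) (xs c))"
  have B: "poly_bounded K ?B"
    by (intro poly_bounded_add poly_bounded_const ptime_bits(2)[OF xs] ptime_bits(2)[OF ptime_length[OF xs]])
  have eq: "fold (?f c) (take m (xs c)) (0, Num 0) = (m, if i c < m then ea c (xs c ! i c) else Num 0)"
    if "m \<le> length (xs c)" for c m
    using that by (induction m) (auto simp: take_Suc_conv_app_nth)
  have "ptime K e (\<lambda>c. ?es (fold (?f c) (xs c) (0, Num 0)))"
  proof (rule ptime_fold[where es = "\<lambda>_. ?es" and R = ?R, OF xs])
    show "ptime K e (\<lambda>c. ?es (0, Num 0))"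
      unfolding fst_conv snd_conv by (intro ptime_pair ptime_nat[OF xs] ptime_const'[OF xs])
    show "?R c (fold (?f c) (take m (xs c)) (0, Num 0))" if "c \<in> contexts K" "m \<le> length (xs c)" for c m
      using that less[OF that(1)] by (auto simp: eq[simplified] floorlog_eq_zero_iff bits_pos Suc_leI intro: bits_le_bits_enc_list nth_mem)
    show "poly_bounded (with_var K (\<lambda>c. Collect (?R c))) (\<lambda>z. bits (?es (snd z)))"
      by (rule poly_bounded_with_varI[OF B]) (auto intro!: add_mono bits_enc_nat_mono)
  next
    fix e' let ?K = "with_var K (\<lambda>c. set (xs c) \<times> Collect (?R c))"
    assume L: "\<And>g. ptime K e g \<Longrightarrow> ptime ?K e' (\<lambda>z. g (fst z))"
      and X: "ptime ?K e' (\<lambda>z. ea (fst z) (fst (snd z)))"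
      and S: "ptime ?K e' (\<lambda>z. ?es (snd (snd z)))"
    show "ptime ?K e' (\<lambda>z. ?es (?f (fst z) (fst (snd z)) (snd (snd z))))"
      unfolding fst_conv snd_conv
      by (intro ptime_pair ptime_add ptime_if ptime_eq X L[OF i] ptime_left[OF S] ptime_right[OF S] ptime_nat[OF X])
  qed
  from ptime_right[OF this] have "ptime K e (\<lambda>c. snd (fold (?f c) (xs c) (0, Num 0)))" .
  then show ?thesis
    by (rule ptime_cong) (use eq[OF order_refl] less in \<open>simp add: Suc_eq_plus1[symmetric] del: Suc_eq_plus1\<close>)
qed

lemma ptime_member:
  assumes "ptime K e (\<lambda>c. enc_nat (x c))" "ptime K e (\<lambda>c. enc_list enc_nat (xs c))"
  shows "ptime K e (\<lambda>c. enc_bool (x c \<in> set (xs c)))"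
proof -
  have "ptime K e (\<lambda>c. enc_list enc_nat (filter (\<lambda>y. x c = y) (xs c)))"
    by (rule ptime_filter[OF assms(2)]) (intro ptime_eq, use assms in auto)
  from ptime_is_pair[OF this] show ?thesis
  proof (rule ptime_cong)
    have "(\<exists>u v. enc_list enc_nat ys = Pr u v) \<longleftrightarrow> ys \<noteq> []" for ys
      by (cases ys) auto
    then show "enc_bool (\<exists>u v. enc_list enc_nat (filter (\<lambda>y. x c = y) (xs c)) = Pr u v) =
        enc_bool (x c \<in> set (xs c))" for c
      by (auto simp: filter_empty_conv)
  qed
qed

text \<open>\<open>List.union xs []\<close> is a removal of duplicates that is by definition a
  fold.\<close>

lemma ptime_union_Nil:
  assumes xs: "ptime K e (\<lambda>c. enc_list enc_nat (xs c))"
  shows "ptime K e (\<lambda>c. enc_list enc_nat (List.union (xs c) []))"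
proof -
  let ?m = "\<lambda>c. bits (enc_list enc_nat (xs c))"
  let ?R = "\<lambda>c ys. length ys \<le> length (xs c) \<and> set ys \<subseteq> set (xs c)"
  have B: "poly_bounded K (\<lambda>c. 1 + ?m c * (1 + ?m c))"
    by (intro poly_bounded_add poly_bounded_mult poly_bounded_const ptime_bits(2)[OF xs])
  have R: "length (fold List.insert ys []) \<le> length ys \<and> set (fold List.insert ys []) = set ys" for ys :: "nat list"
    by (induction ys rule: rev_induct) (auto simp: List.insert_def)
  show ?thesis
    unfolding List.union_def
  proof (rule ptime_fold[where es = "\<lambda>_. enc_list enc_nat" and R = ?R, OF xs])
    show "?R c (fold List.insert (take i (xs c)) [])" for c i
      using R[of "take i (xs c)"] set_take_subset[of i "xs c"] by auto
    show "poly_bounded (with_var K (\<lambda>c. Collect (?R c))) (\<lambda>z. bits (enc_list enc_nat (snd z)))"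
      by (rule poly_bounded_with_varI[OF B], rule bits_enc_list_le)
        (auto intro: bits_le_bits_enc_list order_trans[OF _ length_le_bits_enc_list])
  next
    fix e' let ?K = "with_var K (\<lambda>c. set (xs c) \<times> Collect (?R c))"
    assume X: "ptime ?K e' (\<lambda>z. enc_nat (fst (snd z)))"
      and S: "ptime ?K e' (\<lambda>z. enc_list enc_nat (snd (snd z)))"
    show "ptime ?K e' (\<lambda>z. enc_list enc_nat (List.insert (fst (snd z)) (snd (snd z))))"
      unfolding List.insert_def by (intro ptime_if_list ptime_member ptime_Cons X S)
  qed (rule ptime_Nil[OF xs])
qed

text \<open>Two filters replace the recursion of the insertion, so that \<open>ptime_filter\<close>
  covers it.\<close>

lemma insort_key_conv_filter:
  assumes "sorted (map k ys)"
  shows "insort_key k x ys = filter (\<lambda>y. k y < k x) ys @ x # filter (\<lambda>y. k x \<le> k y) ys"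
  using assms
proof (induction ys)
  case (Cons y ys)
  show ?case
  proof (cases "k x \<le> k y")
    case True
    with Cons.prems have "\<forall>z\<in>set ys. k x \<le> k z" by auto
    then have "filter (\<lambda>z. k x \<le> k z) ys = ys" "filter (\<lambda>z. k z < k x) ys = []"
      by (auto simp: filter_empty_conv not_less)
    with True show ?thesis by (simp add: not_less)
  qed (use Cons in auto)
qed simp

lemma ptime_sort_key:
  fixes K :: "'c family" and xs :: "'c \<Rightarrow> 'a list" and k :: "'c \<Rightarrow> 'a \<Rightarrow> nat"
  assumes xs: "ptime K e (\<lambda>c. enc_list (ea c) (xs c))"
    and body: "\<And>e'. (\<And>g. ptime K e g \<Longrightarrow> ptime (with_var K (\<lambda>c. set (xs c))) e' (\<lambda>z. g (fst z))) \<Longrightarrow>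
        ptime (with_var K (\<lambda>c. set (xs c))) e' (\<lambda>z. ea (fst z) (snd z)) \<Longrightarrow>
        ptime (with_var K (\<lambda>c. set (xs c))) e' (\<lambda>z. enc_nat (k (fst z) (snd z)))"
  shows "ptime K e (\<lambda>c. enc_list (ea c) (sort_key (k c) (xs c)))"
proof -
  note b = ptime_list_body[OF xs body]
  let ?m = "\<lambda>c. bits (enc_list (ea c) (xs c))"
  let ?R = "\<lambda>c ys. length ys \<le> length (xs c) \<and> set ys \<subseteq> set (xs c) \<and> sorted (map (k c) ys)"
  have B: "poly_bounded K (\<lambda>c. 1 + ?m c * (1 + ?m c))"
    by (intro poly_bounded_add poly_bounded_mult poly_bounded_const ptime_bits(2)[OF xs])
  \<comment> \<open>\<open>sort_key\<close> is a \<open>foldr\<close>, so the fold of the machine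
    has to run over the reversed list.\<close>
  have eq: "fold (insort_key (k c)) ys [] = sort_key (k c) (rev ys)" for c ys
    by (simp add: sort_key_def foldr_conv_fold)
  have "ptime K e (\<lambda>c. enc_list (ea c) (fold (insort_key (k c)) (rev (xs c)) []))"
  proof (rule ptime_fold[where es = "\<lambda>c. enc_list (ea c)" and R = ?R, OF ptime_rev[OF xs]])
    show "?R c (fold (insort_key (k c)) (take i (rev (xs c))) [])" for c i
      using set_take_subset[of i "rev (xs c)"] by (auto simp: eq)
    show "poly_bounded (with_var K (\<lambda>c. Collect (?R c))) (\<lambda>z. bits (enc_list (ea (fst z)) (snd z)))"
      by (rule poly_bounded_with_varI[OF B], rule bits_enc_list_le)
        (auto intro: bits_le_bits_enc_list order_trans[OF _ length_le_bits_enc_list])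
  next
    fix e' let ?K = "with_var K (\<lambda>c. set (rev (xs c)) \<times> Collect (?R c))"
    assume L: "\<And>g. ptime K e g \<Longrightarrow> ptime ?K e' (\<lambda>z. g (fst z))"
      and X: "ptime ?K e' (\<lambda>z. ea (fst z) (fst (snd z)))"
      and S: "ptime ?K e' (\<lambda>z. enc_list (ea (fst z)) (snd (snd z)))"
    note id = ptime_id[OF ptime_bits(1)[OF xs]]
    have kx: "ptime ?K e' (\<lambda>z. enc_nat (k (fst z) (fst (snd z))))"
      by (rule ptime_apply[OF b L[OF id] X]) auto
    let ?K' = "with_var ?K (\<lambda>z. set (snd (snd z)))"
    have ky: "ptime ?K' e'' (\<lambda>z. enc_nat (k (fst (fst z)) (snd z)))"
      if "\<And>g. ptime ?K e' g \<Longrightarrow> ptime ?K' e'' (\<lambda>z. g (fst z))"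
        "ptime ?K' e'' (\<lambda>z. ea (fst (fst z)) (snd z))" for e''
      by (rule ptime_apply[OF b that(1)[OF L[OF id]] that(2)]) auto
    have 1: "ptime ?K e' (\<lambda>z. enc_list (ea (fst z)) (filter (\<lambda>y. k (fst z) y < k (fst z) (fst (snd z))) (snd (snd z))))"
    proof (rule ptime_filter[OF S])
      fix e'' assume L': "\<And>g. ptime ?K e' g \<Longrightarrow> ptime ?K' e'' (\<lambda>z. g (fst z))"
        and Y: "ptime ?K' e'' (\<lambda>z. ea (fst (fst z)) (snd z))"
      show "ptime ?K' e'' (\<lambda>z. enc_bool (k (fst (fst z)) (snd z) < k (fst (fst z)) (fst (snd (fst z)))))"
        by (rule ptime_less[OF ky[OF L' Y] L'[OF kx]])
    qed
    have 2: "ptime ?K e' (\<lambda>z. enc_list (ea (fst z)) (filter (\<lambda>y. k (fst z) (fst (snd z)) \<le> k (fst z) y) (snd (snd z))))"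
    proof (rule ptime_filter[OF S])
      fix e'' assume L': "\<And>g. ptime ?K e' g \<Longrightarrow> ptime ?K' e'' (\<lambda>z. g (fst z))"
        and Y: "ptime ?K' e'' (\<lambda>z. ea (fst (fst z)) (snd z))"
      show "ptime ?K' e'' (\<lambda>z. enc_bool (k (fst (fst z)) (fst (snd (fst z))) \<le> k (fst (fst z)) (snd z)))"
        by (rule ptime_le[OF L'[OF kx] ky[OF L' Y]])
    qed
    from ptime_append[OF 1 ptime_Cons[OF X 2]]
    show "ptime ?K e' (\<lambda>z. enc_list (ea (fst z)) (insort_key (k (fst z)) (fst (snd z)) (snd (snd z))))"
      by (rule ptime_cong) (auto simp: insort_key_conv_filter)
  qed (rule ptime_Nil[OF xs])
  then show ?thesis by (simp add: eq)
qed

subsection \<open>The reduction\<close>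

definition num :: "rat \<Rightarrow> nat" where "num x = nat (fst (quotient_of x))"

definition den :: "rat \<Rightarrow> nat" where "den x = nat (snd (quotient_of x))"

lemma den_pos: "0 < den x"
  using quotient_of_denom_pos'[of x] by (simp add: den_def)

lemma enc_rat_nonneg: "enc_rat x = Pr (enc_nat (num x)) (enc_nat (den x))"
  and mult_den: "x * of_nat (den x) = of_nat (num x)" if "0 \<le> x"
proof -
  obtain a b where ab: "quotient_of x = (a, b)" by force
  have b: "0 < b" and x: "x = of_int a / of_int b"
    using quotient_of_denom_pos[OF ab] quotient_of_div[OF ab] by auto
  then have a: "0 \<le> a" using that by (simp add: zero_le_divide_iff)
  show "enc_rat x = Pr (enc_nat (num x)) (enc_nat (den x))"
    using a b by (simp add: enc_rat_def enc_nat_def num_def den_def ab)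
  have "num x = nat a" "den x = nat b" by (simp_all add: num_def den_def ab)
  then show "x * of_nat (den x) = of_nat (num x)"
    using a b by (simp add: x)
qed

text \<open>The cross-multiplied side is what the program evaluates; the other side is what the
  proofs use.\<close>

lemma mult_num_le_mult_den_iff:
  assumes "0 \<le> x"
  shows "D * num x \<le> w * den x \<longleftrightarrow> of_nat D * x \<le> (of_nat w :: rat)"
proof -
  have "of_nat D * x \<le> of_nat w \<longleftrightarrow> of_nat D * x * of_nat (den x) \<le> of_nat w * of_nat (den x)"
    using den_pos[of x] by simp
  also have "\<dots> \<longleftrightarrow> of_nat (D * num x) \<le> (of_nat (w * den x) :: rat)"
    using mult_den[OF assms] by (simp add: mult.assoc)
  finally show ?thesis by (simp only: of_nat_le_iff)
qed

lemma enc_rat_of_nat: "enc_rat (of_nat a) = Pr (enc_nat a) (enc_nat 1)"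
  by (simp add: enc_rat_def enc_nat_def)


section \<open>Binary search\<close>

definition search :: "(nat \<Rightarrow> bool) \<Rightarrow> nat \<Rightarrow> nat" where
  "search P T = fold (\<lambda>k t. if t + 2 ^ k \<le> T \<and> P (t + 2 ^ k) then t + 2 ^ k else t) (rev [0..<floorlog 2 T]) 0"

text \<open>The result is built from its most significant bit downwards, one test of
  \<open>P\<close> for each bit. As a fold over bit positions the search fits
  \<open>ptime_fold\<close>.\<close>

lemma search_greatest:
  assumes "P 0" and mono: "\<And>s t. s \<le> t \<Longrightarrow> t \<le> T \<Longrightarrow> P t \<Longrightarrow> P s" and "t \<le> T"
  shows "search P T \<le> T" "t \<le> search P T \<longleftrightarrow> P t"
proof -
  let ?f = "\<lambda>k t. if t + 2 ^ k \<le> T \<and> P (t + 2 ^ k) then t + 2 ^ k else t"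
  let ?r = "\<lambda>L t. fold ?f (rev [0..<L]) t"
  \<comment> \<open>Invariant with \<open>L\<close> bits left to decide: \<open>t\<close> is
    admissible, and every admissible number lies below \<open>t + 2 ^ L\<close>.\<close>
  have *: "?r L t \<le> T \<and> P (?r L t) \<and> (\<forall>s\<le>T. P s \<longrightarrow> s < ?r L t + 1)"
    if "t \<le> T" "P t" "\<forall>s\<le>T. P s \<longrightarrow> s < t + 2 ^ L" for L t
    using that
  proof (induction L arbitrary: t)
    case (Suc L)
    have "?r L (?f L t) \<le> T \<and> P (?r L (?f L t)) \<and> (\<forall>s\<le>T. P s \<longrightarrow> s < ?r L (?f L t) + 1)"
    proof (rule Suc.IH)
      show "\<forall>s\<le>T. P s \<longrightarrow> s < ?f L t + 2 ^ L"
      proof (cases "t + 2 ^ L \<le> T \<and> P (t + 2 ^ L)")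
        case False
        have "s < t + 2 ^ L" if "s \<le> T" "P s" for s
          using False mono[of "t + 2 ^ L" s] that by (meson le_trans not_le)
        with False show ?thesis by auto
      qed (use Suc.prems in auto)
    qed (use Suc.prems in auto)
    then show ?case by simp
  qed simp
  have "\<forall>s\<le>T. P s \<longrightarrow> s < 0 + 2 ^ floorlog 2 T"
    using floorlog_leD[of 2 T "floorlog 2 T"] by auto
  from *[OF _ \<open>P 0\<close> this] have s: "search P T \<le> T" "P (search P T)" "\<forall>s\<le>T. P s \<longrightarrow> s \<le> search P T"
    by (auto simp: search_def less_Suc_eq_le)
  show "search P T \<le> T" by fact
  show "t \<le> search P T \<longleftrightarrow> P t" using s mono[of t "search P T"] \<open>t \<le> T\<close> by blast
qed

section \<open>Deadlines, windows and rectangles\<close>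

definition reach :: "job list \<Rightarrow> nat \<Rightarrow> nat \<Rightarrow> nat \<Rightarrow> nat" where
  "reach J D w i = search (\<lambda>t. D * num (cost_at (J ! i) t) \<le> w * den (cost_at (J ! i) t)) (horizon J)"

text \<open>Searched with scale 1, since the scale is computed from this time.\<close>

definition free_until :: "job list \<Rightarrow> nat \<Rightarrow> nat" where
  "free_until J i = reach J 1 0 i"

text \<open>Costs grow with time, so within the horizon a job's least positive cost occurs right
  after its free time. Multiplying by the denominator there makes it at least 1, and the product
  does so for all jobs at once. A job that is free up to the horizon contributes the denominator of
  0, which is 1.\<close>

definition scale :: "job list \<Rightarrow> nat" where
  "scale J = (\<Prod>i\<leftarrow>[0..<length J]. den (cost_at (J ! i) (min (Suc (free_until J i)) (horizon J))))"

text \<open>Half of \<open>2 ^ levels J\<close> has to reach every scaled cost up to the horizon,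
  and a cost is at most its numerator. The summand 1 keeps the number positive, so that it can serve
  as a divisor.\<close>

definition levels :: "job list \<Rightarrow> nat" where
  "levels J = floorlog 2 (2 * (scale J * (\<Sum>i\<leftarrow>[0..<length J]. num (cost_at (J ! i) (horizon J)))) + 1)"

text \<open>The truncating division makes the threshold of level 0 equal to 0.\<close>

definition deadline :: "job list \<Rightarrow> nat \<Rightarrow> nat \<Rightarrow> nat" where
  "deadline J i k = reach J (scale J) (2 ^ k div 2) i"

text \<open>The doubling lets the closed rectangles represent half-open ranges of \<open>b\<close>, even empty ones.\<close>

definition rect :: "job list \<Rightarrow> nat \<Rightarrow> rectangle" where
  "rect J m = (let i = m div levels J; k = m mod levels J in
     \<lparr>right = of_nat (release (J ! i)),
      lower = of_nat (2 * deadline J i k),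
      upper = of_nat (2 * deadline J i (Suc k)),
      capacity = job_size (J ! i),
      rweight = 2 ^ k\<rparr>)"

text \<open>Jobs with a free deadline after \<open>b\<close> are left out: they exceed
  \<open>b\<close> at no cost, so no rectangle has to account for them. The truncated difference is
  0 for windows that are long enough.\<close>

definition excess :: "job list \<Rightarrow> nat \<Rightarrow> nat \<Rightarrow> nat" where
  "excess J a b = (\<Sum>i\<leftarrow>[0..<length J]. if a \<le> release (J ! i) \<and> deadline J i 0 \<le> b then job_size (J ! i) else 0) - (b - a)"

text \<open>Duplicates are removed here and in \<open>ends\<close> because the points of an R2C
  instance need distinct positions.\<close>

definition starts :: "job list \<Rightarrow> nat list" where
  "starts J = List.union (map (\<lambda>i. release (J ! i)) [0..<length J]) []"

text \<open>A job has one deadline more than it has rectangles, hence the base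
  \<open>Suc (levels J)\<close> in the coding of the pairs of job and level.\<close>

definition ends :: "job list \<Rightarrow> nat list" where
  "ends J = List.union (map (\<lambda>m. deadline J (m div Suc (levels J)) (m mod Suc (levels J)))
     [0..<length J * Suc (levels J)]) []"

text \<open>Demands have to be positive. A window without excess satisfies Hall's condition whatever
  is chosen.\<close>

definition windows :: "job list \<Rightarrow> (nat \<times> nat) list" where
  "windows J = filter (\<lambda>w. 0 < excess J (fst w) (snd w)) (List.product (starts J) (ends J))"

text \<open>The ordinate is odd and the bounds of the rectangles are even, so no point lies on an
  upper or lower edge.\<close>

definition point :: "job list \<Rightarrow> nat \<times> nat \<Rightarrow> dpoint" where
  "point J w = \<lparr>xcoord = of_nat (fst w), ycoord = of_nat (2 * snd w + 1), demand = excess J (fst w) (snd w)\<rparr>"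

definition reduction :: "job list \<Rightarrow> r2c_instance" where
  "reduction J = (map (point J) (windows J), map (rect J) [0..<length J * levels J])"

text \<open>The jobs counted are those that are forced to run entirely inside
  \<open>{a..<b}\<close>.\<close>

definition hall_at :: "job list \<Rightarrow> (nat \<Rightarrow> nat) \<Rightarrow> nat \<Rightarrow> nat \<Rightarrow> bool" where
  "hall_at J C a b \<longleftrightarrow> (\<Sum>i | i < length J \<and> a \<le> release (J ! i) \<and> C i \<le> b. job_size (J ! i)) \<le> b - a"

text \<open>The rectangles bought for given completion times \<open>C\<close>: all levels whose
  threshold is below the scaled cost. The cut at the horizon serves schedules that idle.\<close>

definition picks :: "job list \<Rightarrow> (nat \<Rightarrow> nat) \<Rightarrow> nat set" where
  "picks J C = {m. m < length J * levels J \<and>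
     of_nat (2 ^ (m mod levels J) div 2) <
     of_nat (scale J) * cost_at (J ! (m div levels J)) (min (C (m div levels J)) (horizon J))}"

text \<open>A fold, so that it can be computed by \<open>ptime_fold_max\<close>; 0 is neutral for
  the maximum, and the start value is the deadline granted for free.\<close>

definition due :: "job list \<Rightarrow> nat list \<Rightarrow> nat \<Rightarrow> nat" where
  "due J ms i = fold (\<lambda>m. max (if m div levels J = i then deadline J i (Suc (m mod levels J)) else 0)) ms
     (deadline J i 0)"

section \<open>Elementary properties of the construction\<close>

lemma levels_pos: "0 < levels J"
  by (simp add: levels_def floorlog_def)

lemma set_starts: "set (starts J) = (\<lambda>i. release (J ! i)) ` {..<length J}"
  by (auto simp: starts_def)

lemma set_ends: "set (ends J) = {deadline J i k | i k. i < length J \<and> k \<le> levels J}"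
proof -
  let ?L = "Suc (levels J)"
  have "(\<exists>m < length J * ?L. y = deadline J (m div ?L) (m mod ?L)) \<longleftrightarrow>
        (\<exists>i k. y = deadline J i k \<and> i < length J \<and> k \<le> levels J)" for y
  proof safe
    fix m assume "m < length J * ?L"
    then show "\<exists>i k. deadline J (m div ?L) (m mod ?L) = deadline J i k \<and> i < length J \<and> k \<le> levels J"
      by (metis less_mult_imp_div_less less_Suc_eq_le mod_less_divisor zero_less_Suc)
  next
    fix i k assume ik: "i < length J" "k \<le> levels J"
    have "i * ?L + k < Suc i * ?L" using ik by simp
    also have "\<dots> \<le> length J * ?L" using ik by (intro mult_le_mono1) simp
    finally show "\<exists>m < length J * ?L. deadline J i k = deadline J (m div ?L) (m mod ?L)"
      using ik by (intro exI[of _ "i * ?L + k"]) (simp add: div_mult_self3 del: mult_Suc_right)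
  qed
  moreover have "set (ends J) = {y. \<exists>m < length J * ?L. y = deadline J (m div ?L) (m mod ?L)}"
    by (auto simp: ends_def simp del: mult_Suc_right)
  ultimately show ?thesis by simp
qed

lemma distinct_starts: "distinct (starts J)" and distinct_ends: "distinct (ends J)"
  by (simp_all add: starts_def ends_def)

lemma due_eq_Max:
  "due J ms i = Max (insert (deadline J i 0) {deadline J i (Suc (m mod levels J)) | m. m \<in> set ms \<and> m div levels J = i})"
proof (induction ms rule: rev_induct)
  case Nil
  then show ?case by (simp add: due_def)
next
  case (snoc m ms)
  let ?A = "\<lambda>ms. {deadline J i (Suc (m mod levels J)) | m. m \<in> set ms \<and> m div levels J = i}"
  have fin: "finite (?A ms)" for ms
    by (rule finite_subset[of _ "(\<lambda>m. deadline J i (Suc (m mod levels J))) ` set ms"]) auto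
  have "due J (ms @ [m]) i = max (if m div levels J = i then deadline J i (Suc (m mod levels J)) else 0) (due J ms i)"
    by (simp add: due_def)
  also have "\<dots> = Max (insert (deadline J i 0) (?A (ms @ [m])))"
  proof (cases "m div levels J = i")
    case True
    then have "insert (deadline J i 0) (?A (ms @ [m])) = insert (deadline J i (Suc (m mod levels J))) (insert (deadline J i 0) (?A ms))"
      by auto
    with True fin[of ms] show ?thesis unfolding snoc by (simp del: Max_insert add: Max_insert)
  next
    case False
    then have "?A (ms @ [m]) = ?A ms" by auto
    with False show ?thesis unfolding snoc by simp
  qed
  finally show ?case .
qed

lemma due_cases:
  obtains "due J ms i = deadline J i 0"
  | m where "m \<in> set ms" "m div levels J = i" "due J ms i = deadline J i (Suc (m mod levels J))"
proof -
  let ?A = "{deadline J i (Suc (m mod levels J)) | m. m \<in> set ms \<and> m div levels J = i}"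
  have fin: "finite ?A"
    by (rule finite_subset[of _ "(\<lambda>m. deadline J i (Suc (m mod levels J))) ` set ms"]) auto
  have "due J ms i \<in> insert (deadline J i 0) ?A"
    unfolding due_eq_Max by (rule Max_in) (use fin in auto)
  with that show ?thesis by blast
qed

lemma deadline_0_le_due: "deadline J i 0 \<le> due J ms i"
  and deadline_le_due: "m \<in> set ms \<Longrightarrow> m div levels J = i \<Longrightarrow> deadline J i (Suc (m mod levels J)) \<le> due J ms i"
proof -
  let ?A = "{deadline J i (Suc (m mod levels J)) | m. m \<in> set ms \<and> m div levels J = i}"
  have fin: "finite ?A"
    by (rule finite_subset[of _ "(\<lambda>m. deadline J i (Suc (m mod levels J))) ` set ms"]) auto
  show "deadline J i 0 \<le> due J ms i" unfolding due_eq_Max using fin by (intro Max_ge) auto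
  show "deadline J i (Suc (m mod levels J)) \<le> due J ms i" if "m \<in> set ms" "m div levels J = i"
    unfolding due_eq_Max using fin that by (intro Max_ge) auto
qed

lemma job_size_le_horizon: "release j + (\<Sum>j\<leftarrow>J. job_size j) \<le> horizon J" if "j \<in> set J"
  using that by (auto simp: horizon_def)

lemma horizon_conv_fold:
  "horizon J = fold (\<lambda>i. max (release (J ! i))) [0..<length J] 0 + (\<Sum>i\<leftarrow>[0..<length J]. job_size (J ! i))"
proof -
  have "fold (\<lambda>i. max (release (J ! i))) [0..<length J] 0 = fold max (map release J) 0"
    by (subst (3) map_nth[of J, symmetric]) (simp only: fold_map map_map comp_def)
  also have "\<dots> = Max (insert 0 (set (map release J)))"
    by (simp only: Max.set_eq_fold list.set(2)[symmetric])
  finally have 1: "fold (\<lambda>i. max (release (J ! i))) [0..<length J] 0 = Max (insert 0 (release ` set J))"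
    by simp
  have "(\<Sum>j\<leftarrow>J. job_size j) = (\<Sum>i\<leftarrow>[0..<length J]. job_size (J ! i))"
    by (subst (1) map_nth[of J, symmetric]) (simp only: map_map comp_def)
  with 1 show ?thesis by (simp add: horizon_def)
qed

text \<open>Origin of the constant 4. If \<open>m\<close> is the largest level in the sum, the sum
  is below \<open>2 ^ (m + 1)\<close>, and for positive \<open>m\<close> the threshold
  \<open>2 ^ (m - 1)\<close> is already below \<open>c\<close>. For \<open>m = 0\<close> the
  threshold is 0 and the sum is 1, which is where \<open>1 \<le> c\<close> enters.\<close>

lemma geometric_levels:
  fixes c :: rat
  assumes "c = 0 \<or> 1 \<le> c"
  shows "(\<Sum>k | k < L \<and> of_nat (2 ^ k div 2) < c. 2 ^ k) \<le> 4 * c"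
proof (cases "{k. k < L \<and> of_nat (2 ^ k div 2) < c} = {}")
  case True
  then show ?thesis unfolding True using assms by auto
next
  case False
  let ?A = "{k. k < L \<and> of_nat (2 ^ k div 2) < c}"
  define m where "m = Max ?A"
  have fin: "finite ?A" by simp
  have m: "m \<in> ?A" unfolding m_def by (rule Max_in[OF fin False])
  have "?A \<subseteq> {..<Suc m}" unfolding m_def using fin by (auto simp: less_Suc_eq_le)
  then have "(\<Sum>k\<in>?A. 2 ^ k) \<le> (\<Sum>k<Suc m. 2 ^ k :: rat)"
    by (intro sum_mono2) auto
  also have "\<dots> = 2 ^ Suc m - 1" 
    by (subst geometric_sum) auto
  also have "\<dots> \<le> 4 * c"
  proof (cases m)
    case 0
    then show ?thesis using m assms by auto
  next
    case (Suc j)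
    then have "of_nat (2 ^ j) < c" using m by auto
    then show ?thesis using Suc by simp
  qed
  finally show ?thesis .
qed

section \<open>Costs and deadlines of a fixed instance\<close>

context
  fixes J :: "job list"
  assumes inst: "gsp_is_instance J"
begin

lemma cost_at_mono:
  assumes "i < length J" "s \<le> t"
  shows "cost_at (J ! i) s \<le> cost_at (J ! i) t"
  unfolding cost_at_def using assms inst
  by (intro sum_mono2) (auto simp: gsp_is_instance_def)

lemma cost_at_nonneg: "i < length J \<Longrightarrow> 0 \<le> cost_at (J ! i) t"
  using cost_at_mono[of i 0 t] by (simp add: cost_at_def)

lemma le_reach_iff:
  assumes "i < length J" "t \<le> horizon J"
  shows "t \<le> reach J D w i \<longleftrightarrow> of_nat D * cost_at (J ! i) t \<le> of_nat w"
proof -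
  let ?P = "\<lambda>t. of_nat D * cost_at (J ! i) t \<le> of_nat w"
  have eq: "reach J D w i = search ?P (horizon J)"
    using assms by (simp add: reach_def mult_num_le_mult_den_iff cost_at_nonneg)
  have "?P s" if "s \<le> t" "?P t" for s t
    using mult_left_mono[OF cost_at_mono[OF assms(1) that(1)], of "of_nat D"] that(2) by simp
  then show ?thesis
    unfolding eq using assms by (intro search_greatest(2)) (auto simp: cost_at_def)
qed

lemma reach_le_horizon:
  assumes "i < length J"
  shows "reach J D w i \<le> horizon J"
proof -
  let ?P = "\<lambda>t. of_nat D * cost_at (J ! i) t \<le> of_nat w"
  have eq: "reach J D w i = search ?P (horizon J)"
    using assms by (simp add: reach_def mult_num_le_mult_den_iff cost_at_nonneg)
  have "?P s" if "s \<le> t" "?P t" for s t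
    using mult_left_mono[OF cost_at_mono[OF assms(1) that(1)], of "of_nat D"] that(2) by simp
  then show ?thesis
    unfolding eq using assms by (intro search_greatest(1)) (auto simp: cost_at_def)
qed

lemma deadline_le_horizon: "i < length J \<Longrightarrow> deadline J i k \<le> horizon J"
  by (simp add: deadline_def reach_le_horizon)

lemma scale_pos: "0 < scale J"
proof -
  have "den x \<noteq> 0" for x using den_pos[of x] by simp
  then have "scale J \<noteq> 0" unfolding scale_def prod_list_zero_iff by (auto simp del: neq0_conv)
  then show ?thesis by simp
qed

lemma one_le_scaled_cost:
  assumes i: "i < length J" and t: "t \<le> horizon J" and pos: "0 < cost_at (J ! i) t"
  shows "1 \<le> of_nat (scale J) * cost_at (J ! i) t"
proof -
  let ?u = "Suc (free_until J i)"
  \<comment> \<open>The cost at \<open>t\<close> is positive, so \<open>t\<close> lies beyond the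
    free time. Hence \<open>?u\<close> is within the horizon and the \<open>min\<close> in the scale
    has no effect.\<close>
  have u: "?u \<le> t"
    using le_reach_iff[OF i t, of 1 0] pos by (simp add: free_until_def)
  then have uT: "?u \<le> horizon J" using t by simp
  have cu: "0 < cost_at (J ! i) ?u"
    using le_reach_iff[OF i uT, of 1 0] by (simp add: free_until_def)
  define c where "c = cost_at (J ! i) ?u"
  have "den c dvd scale J"
    unfolding scale_def c_def using i uT
    by (intro prod_list_dvd) (auto simp: min_def image_iff intro!: bexI[of _ i])
  then have "den c \<le> scale J" using scale_pos by (intro dvd_imp_le) auto
  then have le: "c * of_nat (den c) \<le> c * of_nat (scale J)"
    using cu by (intro mult_left_mono) (auto simp: c_def)
  have c: "0 < c" using cu by (simp add: c_def)
  then have eq: "c * of_nat (den c) = of_nat (num c)" by (intro mult_den) simp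
  have "0 < c * of_nat (den c)" using c den_pos[of c] by simp
  then have "num c \<noteq> 0" unfolding eq by simp
  then have "1 \<le> (of_nat (num c) :: rat)" by (simp add: Suc_leI)
  then have "1 \<le> of_nat (scale J) * c" using le unfolding eq by (simp add: mult.commute)
  also have "\<dots> \<le> of_nat (scale J) * cost_at (J ! i) t"
    unfolding c_def by (intro mult_left_mono cost_at_mono i u) auto
  finally show ?thesis .
qed

lemma deadline_mono:
  assumes "i < length J" "k \<le> l"
  shows "deadline J i k \<le> deadline J i l"
proof -
  have "2 ^ k div 2 \<le> (2 ^ l div 2 :: nat)" using assms by (intro div_le_mono power_increasing) auto
  moreover have "of_nat (scale J) * cost_at (J ! i) (deadline J i k) \<le> of_nat (2 ^ k div 2)"
    using le_reach_iff[OF assms(1) reach_le_horizon[OF assms(1)], of "scale J" "2 ^ k div 2"]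
    by (auto simp: deadline_def)
  ultimately have "of_nat (scale J) * cost_at (J ! i) (deadline J i k) \<le> of_nat (2 ^ l div 2)"
    by (rule order_trans[OF _ iffD2[OF of_nat_le_iff], rotated])
  then show ?thesis
    using le_reach_iff[OF assms(1) deadline_le_horizon[OF assms(1)], of k "scale J" "2 ^ l div 2"]
    by (simp add: deadline_def)
qed

lemma scaled_cost_deadline:
  "i < length J \<Longrightarrow> of_nat (scale J) * cost_at (J ! i) (deadline J i k) \<le> of_nat (2 ^ k div 2)"
  using le_reach_iff[OF _ reach_le_horizon, of i i "scale J" "2 ^ k div 2"] by (auto simp: deadline_def)

text \<open>The top level admits every completion time up to the horizon, so a window that ends
  earlier always lies in the strip of some level of each job counted by its excess.\<close>

lemma deadline_levels:
  assumes i: "i < length J"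
  shows "deadline J i (levels J) = horizon J"
proof -
  let ?N = "\<Sum>i\<leftarrow>[0..<length J]. num (cost_at (J ! i) (horizon J))"
  let ?c = "cost_at (J ! i) (horizon J)"
  have "num ?c \<le> ?N" using i by (intro member_le_sum_list) auto
  have "?c * 1 \<le> ?c * of_nat (den ?c)"
    using den_pos[of ?c] by (intro mult_left_mono cost_at_nonneg i) (simp add: Suc_leI)
  then have "?c \<le> of_nat (num ?c)" by (simp add: mult_den cost_at_nonneg i)
  then have "of_nat (scale J) * ?c \<le> of_nat (scale J * num ?c)"
    by (simp add: mult_left_mono)
  also have "scale J * num ?c \<le> 2 ^ levels J div 2"
  proof -
    have "scale J * num ?c \<le> scale J * ?N" using \<open>num ?c \<le> ?N\<close> by simp
    also have "\<dots> = (2 * (scale J * ?N) + 1) div 2" by simp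
    also have "\<dots> \<le> 2 ^ levels J div 2"
      unfolding levels_def using floorlog_leD[of 2 "2 * (scale J * ?N) + 1", OF order_refl]
      by (intro div_le_mono less_imp_le) auto
    finally show ?thesis .
  qed
  then have "of_nat (scale J * num ?c) \<le> (of_nat (2 ^ levels J div 2) :: rat)" by (simp only: of_nat_le_iff)
  finally show ?thesis
    using le_reach_iff[OF i order_refl, of "scale J" "2 ^ levels J div 2"] deadline_le_horizon[OF i, of "levels J"]
    by (simp add: deadline_def)
qed

text \<open>The horizon leaves room for all jobs together after any release time. It follows that
  the R2C instance always has a solution.\<close>

lemma hall_at_horizon: "hall_at J (\<lambda>_. horizon J) a b"
proof (cases "horizon J \<le> b \<and> (\<exists>i<length J. a \<le> release (J ! i))")
  case True
  then obtain i where i: "i < length J" "a \<le> release (J ! i)" "horizon J \<le> b" by blast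
  have "(\<Sum>i | i < length J \<and> a \<le> release (J ! i) \<and> horizon J \<le> b. job_size (J ! i)) \<le> (\<Sum>i<length J. job_size (J ! i))"
    by (rule sum_mono2) auto
  also have "\<dots> = (\<Sum>j\<leftarrow>J. job_size j)"
    by (simp add: sum_list_sum_nth atLeast0LessThan)
  finally show ?thesis
    using i job_size_le_horizon[of "J ! i" J] by (auto simp: hall_at_def)
next
  case False
  then have e: "{i. i < length J \<and> a \<le> release (J ! i) \<and> horizon J \<le> b} = {}" by blast
  show ?thesis unfolding hall_at_def e by simp
qed

section \<open>The R2C instance and its feasible solutions\<close>

lemma excess_eq:
  "excess J a b = (\<Sum>i | i < length J \<and> a \<le> release (J ! i) \<and> deadline J i 0 \<le> b. job_size (J ! i)) - (b - a)"
proof -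
  have "(\<Sum>i\<leftarrow>[0..<length J]. if a \<le> release (J ! i) \<and> deadline J i 0 \<le> b then job_size (J ! i) else 0) =
    (\<Sum>i<length J. if a \<le> release (J ! i) \<and> deadline J i 0 \<le> b then job_size (J ! i) else 0)"
    by (simp add: interv_sum_list_conv_sum_set_nat atLeast0LessThan)
  also have "\<dots> = (\<Sum>i\<in>{i. i < length J \<and> a \<le> release (J ! i) \<and> deadline J i 0 \<le> b}. job_size (J ! i))"
    by (rule sum.mono_neutral_cong_right) auto
  finally show ?thesis by (simp add: excess_def)
qed

lemma reduction_is_instance: "r2c_is_instance (reduction J)"
proof -
  have "distinct (windows J)"
    by (simp add: windows_def distinct_product distinct_starts distinct_ends)
  then have "distinct (map (\<lambda>p. (xcoord p, ycoord p)) (map (point J) (windows J)))"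
    by (auto simp: distinct_map inj_on_def point_def)
  moreover have "0 < demand p" if "p \<in> point J ` set (windows J)" for p
    using that by (auto simp: windows_def point_def)
  moreover have "0 \<le> right r \<and> lower r \<le> upper r \<and> 0 < capacity r \<and> 0 < rweight r"
    if "r \<in> rect J ` {..<length J * levels J}" for r
  proof -
    from that obtain m where m: "m < length J * levels J" "r = rect J m" by auto
    then have i: "m div levels J < length J" by (simp add: less_mult_imp_div_less)
    have "0 < job_size (J ! (m div levels J))"
      using inst i by (simp add: gsp_is_instance_def)
    then show ?thesis using deadline_mono[OF i, of "m mod levels J" "Suc (m mod levels J)"]
      unfolding m(2) rect_def Let_def by (simp del: of_nat_mult)
  qed
  ultimately show ?thesis
    by (auto simp: r2c_is_instance_def reduction_def atLeast0LessThan)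
qed

lemma region_rect:
  "(rat_of_nat a, rat_of_nat (2 * b + 1)) \<in> region (rect J m) \<longleftrightarrow>
     a \<le> release (J ! (m div levels J)) \<and> deadline J (m div levels J) (m mod levels J) \<le> b \<and>
     b < deadline J (m div levels J) (Suc (m mod levels J))"
proof -
  have "2 * x \<le> 2 * b + 1 \<longleftrightarrow> x \<le> b" "2 * b + 1 \<le> 2 * x \<longleftrightarrow> b < x" for x by auto
  then show ?thesis
    unfolding region_def rect_def Let_def mem_Times_iff fst_conv snd_conv rectangle.simps atLeastAtMost_iff
      of_nat_le_iff by auto
qed

definition covers :: "nat set \<Rightarrow> nat \<Rightarrow> nat \<Rightarrow> nat set" where
  "covers S a b = {m\<in>S. a \<le> release (J ! (m div levels J)) \<and>
     deadline J (m div levels J) (m mod levels J) \<le> b \<and> b < deadline J (m div levels J) (Suc (m mod levels J))}"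

lemma reduction_feasible_iff:
  "r2c_feasible (reduction J) S \<longleftrightarrow> S \<subseteq> {..<length J * levels J} \<and>
     (\<forall>(a, b)\<in>set (windows J). excess J a b \<le> (\<Sum>m\<in>covers S a b. job_size (J ! (m div levels J))))"
proof -
  have "(\<Sum>m\<in>{m\<in>S. (xcoord (point J (a, b)), ycoord (point J (a, b))) \<in> region (snd (reduction J) ! m)}.
           capacity (snd (reduction J) ! m)) =
        (\<Sum>m\<in>covers S a b. job_size (J ! (m div levels J)))" if S: "S \<subseteq> {..<length J * levels J}" for a b
  proof (rule sum.cong)
    have "snd (reduction J) ! m = rect J m" if "m \<in> S" for m
      using S that by (auto simp: reduction_def)
    then show "{m\<in>S. (xcoord (point J (a, b)), ycoord (point J (a, b))) \<in> region (snd (reduction J) ! m)} = covers S a b"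
      using region_rect by (auto simp: covers_def point_def)
    show "capacity (snd (reduction J) ! m) = job_size (J ! (m div levels J))" if "m \<in> covers S a b" for m
    proof -
      have "snd (reduction J) ! m = rect J m" using S that by (auto simp: reduction_def covers_def)
      then show ?thesis by (simp add: rect_def Let_def)
    qed
  qed
  then show ?thesis
    unfolding r2c_feasible_def by (auto simp: reduction_def point_def)
qed

section \<open>From completion times to rectangles\<close>

lemma windowsD:
  assumes "(a, b) \<in> set (windows J)"
  shows "b \<le> horizon J" "0 < excess J a b"
  using assms by (auto simp: windows_def set_ends deadline_le_horizon)

text \<open>The jobs in the excess that complete by \<open>b\<close> fit into \<open>b - a\<close>
  by Hall's condition. Each of the others, \<open>?U\<close>, is covered by its rectangle at the
  level whose strip contains \<open>b\<close>; it completes after the deadline of that level, so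
  this rectangle was picked.\<close>

lemma picks_feasible:
  assumes hall: "\<And>a b. hall_at J C a b"
  shows "r2c_feasible (reduction J) (picks J C)"
  unfolding reduction_feasible_iff
proof (intro conjI ballI)
  show "picks J C \<subseteq> {..<length J * levels J}" by (auto simp: picks_def)
next
  fix w assume w: "w \<in> set (windows J)"
  obtain a b where ab: "w = (a, b)" by force
  let ?L = "levels J"
  let ?A = "{i. i < length J \<and> a \<le> release (J ! i) \<and> deadline J i 0 \<le> b}"
  let ?U = "{i\<in>?A. b < C i}"
  let ?cov = "covers (picks J C) a b"
  \<comment> \<open>At the horizon there is no excess, so \<open>b\<close> lies before it and
    cutting completion times there does not bring them down to \<open>b\<close>.\<close>
  have b: "b < horizon J"
  proof (rule ccontr)
    assume "\<not> b < horizon J"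
    then have "b = horizon J" using windowsD(1)[of a b] w ab by simp
    then have "(\<Sum>i\<in>?A. job_size (J ! i)) \<le> b - a"
      using hall_at_horizon[of a b] by (auto simp: hall_at_def deadline_le_horizon cong: conj_cong)
    then show False using windowsD(2)[of a b] w ab by (simp add: excess_eq)
  qed
  have "\<exists>k<?L. deadline J i k \<le> b \<and> b < deadline J i (Suc k)" if "i \<in> ?U" for i
  proof -
    have "b < deadline J i ?L" "\<not> b < deadline J i 0" using that b deadline_levels[of i] by simp_all
    from ex_least_nat_less[of "\<lambda>k. b < deadline J i k", OF this] obtain k
      where "k < ?L" "\<forall>l\<le>k. \<not> b < deadline J i l" "b < deadline J i (Suc k)" by blast
    moreover from this(2) have "\<not> b < deadline J i k" by blast
    ultimately show ?thesis by (meson not_le)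
  qed
  then have "\<forall>i\<in>?U. \<exists>k. k < ?L \<and> deadline J i k \<le> b \<and> b < deadline J i (Suc k)" by blast
  from bchoice[OF this] obtain lv
    where lv: "\<And>i. i \<in> ?U \<Longrightarrow> lv i < ?L \<and> deadline J i (lv i) \<le> b \<and> b < deadline J i (Suc (lv i))"
    by blast
  let ?h = "\<lambda>i. i * ?L + lv i"
  have h: "?h i div ?L = i" "?h i mod ?L = lv i" if "i \<in> ?U" for i
    using lv[OF that] by simp_all
  have sub: "?h ` ?U \<subseteq> ?cov"
  proof safe
    fix i assume i: "i < length J" "a \<le> release (J ! i)" "deadline J i 0 \<le> b" "b < C i"
    then have iU: "i \<in> ?U" by simp
    have "?h i < Suc i * ?L" using lv[OF iU] by simp
    also have "\<dots> \<le> length J * ?L" using i by (intro mult_le_mono1) simp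
    finally have lt: "?h i < length J * ?L" .
    \<comment> \<open>Both \<open>C i\<close> and the horizon exceed \<open>b\<close>, which is at
      least the deadline of level \<open>lv i\<close>; so the scaled cost exceeds the threshold of
      that level.\<close>
    have "\<not> min (C i) (horizon J) \<le> deadline J i (lv i)" using lv[OF iU] i b by auto
    then have "of_nat (2 ^ lv i div 2) < of_nat (scale J) * cost_at (J ! i) (min (C i) (horizon J))"
      using le_reach_iff[OF i(1), of "min (C i) (horizon J)" "scale J" "2 ^ lv i div 2"]
      by (simp add: deadline_def)
    then show "?h i \<in> ?cov"
      using lt i lv[OF iU] unfolding covers_def picks_def mem_Collect_eq h[OF iU] by blast
  qed
  have inj: "inj_on ?h ?U"
    by (rule inj_on_inverseI[where g = "\<lambda>m. m div ?L"]) (rule h(1))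
  have fin: "finite ?cov"
    by (rule finite_subset[of _ "{..<length J * ?L}"]) (auto simp: covers_def picks_def)
  have "(\<Sum>i\<in>?U. job_size (J ! i)) = (\<Sum>m\<in>?h ` ?U. job_size (J ! (m div ?L)))"
    unfolding sum.reindex[OF inj] comp_def by (rule sum.cong) (simp_all only: h(1))
  also have "\<dots> \<le> (\<Sum>m\<in>?cov. job_size (J ! (m div ?L)))"
    by (rule sum_mono2[OF fin sub]) simp
  finally have U: "(\<Sum>i\<in>?U. job_size (J ! i)) \<le> \<dots>" .
  have "(\<Sum>i\<in>?A. job_size (J ! i)) = (\<Sum>i\<in>?U. job_size (J ! i)) + (\<Sum>i\<in>{i\<in>?A. \<not> b < C i}. job_size (J ! i))"
    (is "_ = _ + ?V")
  proof -
    have "?A = ?U \<union> {i\<in>?A. \<not> b < C i}" by auto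
    then show ?thesis by (rule trans[OF arg_cong[where f = "sum _"] sum.union_disjoint]) auto
  qed
  moreover have "?V \<le> (\<Sum>i | i < length J \<and> a \<le> release (J ! i) \<and> C i \<le> b. job_size (J ! i))"
    by (rule sum_mono2) auto
  ultimately have "(\<Sum>i\<in>?A. job_size (J ! i)) \<le> (\<Sum>i\<in>?U. job_size (J ! i)) + (b - a)"
    using hall[of a b] unfolding hall_at_def by linarith
  then have "excess J a b \<le> (\<Sum>m\<in>?cov. job_size (J ! (m div ?L)))" using U by (simp add: excess_eq)
  then show "case w of (a, b) \<Rightarrow> excess J a b \<le> (\<Sum>m\<in>covers (picks J C) a b. job_size (J ! (m div levels J)))"
    unfolding ab prod.case .
qed

lemma reduction_cost:
  assumes "S \<subseteq> {..<length J * levels J}"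
  shows "r2c_cost (reduction J) S = (\<Sum>i<length J. \<Sum>m\<in>{m\<in>S. m div levels J = i}. 2 ^ (m mod levels J))"
proof -
  have "r2c_cost (reduction J) S = (\<Sum>m\<in>S. 2 ^ (m mod levels J))"
    unfolding r2c_cost_def
  proof (rule sum.cong)
    fix m assume "m \<in> S"
    then have "snd (reduction J) ! m = rect J m" using assms by (auto simp: reduction_def)
    then show "real (rweight (snd (reduction J) ! m)) = 2 ^ (m mod levels J)"
      by (simp add: rect_def Let_def)
  qed simp
  also have "\<dots> = (\<Sum>i<length J. \<Sum>m\<in>{m\<in>S. m div levels J = i}. 2 ^ (m mod levels J))"
    by (rule sum.group[symmetric]) (use assms in \<open>auto intro: finite_subset less_mult_imp_div_less\<close>)
  finally show ?thesis .
qed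

lemma picks_cost:
  "r2c_cost (reduction J) (picks J C) \<le>
     4 * real (scale J) * (\<Sum>i<length J. of_rat (cost_at (J ! i) (min (C i) (horizon J))))"
proof -
  let ?L = "levels J"
  have "(\<Sum>m\<in>{m\<in>picks J C. m div ?L = i}. 2 ^ (m mod ?L)) \<le>
      4 * real (scale J) * of_rat (cost_at (J ! i) (min (C i) (horizon J)))" if i: "i < length J" for i
  proof -
    let ?c = "of_nat (scale J) * cost_at (J ! i) (min (C i) (horizon J))"
    let ?A = "{k. k < ?L \<and> of_nat (2 ^ k div 2) < ?c}"
    have lt: "i * ?L + k < length J * ?L" if "k < ?L" for k
    proof -
      have "i * ?L + k < Suc i * ?L" using that by simp
      also have "\<dots> \<le> length J * ?L" using i by (intro mult_le_mono1) simp
      finally show ?thesis .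
    qed
    have "(\<Sum>m\<in>{m\<in>picks J C. m div ?L = i}. 2 ^ (m mod ?L)) = (\<Sum>k\<in>?A. 2 ^ k :: real)"
    proof (rule sum.reindex_bij_witness[where i = "\<lambda>k. i * ?L + k" and j = "\<lambda>m. m mod ?L"])
      fix m assume "m \<in> {m \<in> picks J C. m div ?L = i}"
      then show "i * ?L + m mod ?L = m" "m mod ?L \<in> ?A" "(2 :: real) ^ (m mod ?L) = 2 ^ (m mod ?L)"
        using levels_pos[of J] by (auto simp: picks_def)
    next
      fix k assume "k \<in> ?A"
      then show "(i * ?L + k) mod ?L = k" "i * ?L + k \<in> {m \<in> picks J C. m div ?L = i}"
        using lt[of k] by (auto simp: picks_def)
    qed
    also have "\<dots> = of_rat (\<Sum>k\<in>?A. 2 ^ k)" by (simp add: of_rat_sum of_rat_power)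
    also have "\<dots> \<le> of_rat (4 * ?c)"
    proof (subst of_rat_less_eq, rule geometric_levels)
      show "?c = 0 \<or> 1 \<le> ?c"
        using one_le_scaled_cost[OF i, of "min (C i) (horizon J)"] cost_at_nonneg[OF i, of "min (C i) (horizon J)"]
        by (cases "cost_at (J ! i) (min (C i) (horizon J)) = 0") auto
    qed
    finally show ?thesis by (simp add: of_rat_mult mult.assoc)
  qed
  then have "(\<Sum>i<length J. \<Sum>m\<in>{m\<in>picks J C. m div ?L = i}. 2 ^ (m mod ?L)) \<le>
      (\<Sum>i<length J. 4 * real (scale J) * of_rat (cost_at (J ! i) (min (C i) (horizon J))))"
    by (intro sum_mono) simp
  then show ?thesis
    by (subst reduction_cost) (auto simp: picks_def sum_distrib_left)
qed

section \<open>From rectangles to deadlines\<close>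

lemma due_in_ends:
  assumes "i < length J"
  shows "due J ms i \<in> set (ends J)"
proof (cases rule: due_cases[of J ms i])
  case (2 m)
  then show ?thesis
    using assms levels_pos[of J] by (force simp: set_ends intro: Suc_leI)
qed (use assms in \<open>force simp: set_ends\<close>)

lemma due_le_horizon: "i < length J \<Longrightarrow> due J ms i \<le> horizon J"
  by (cases rule: due_cases[of J ms i]) (auto simp: deadline_le_horizon)

text \<open>Strips of one job are disjoint, so the rectangles over the point belong to different
  jobs (\<open>inj\<close>), all of them due after \<open>b\<close>. Together they take up the
  excess, and what is left for the jobs due by \<open>b\<close> is at most
  \<open>b - a\<close>.\<close>

lemma due_hall:
  assumes feas: "r2c_feasible (reduction J) (set ms)" and a: "a \<in> set (starts J)" and b: "b \<in> set (ends J)"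
  shows "hall_at J (due J ms) a b"
proof -
  let ?L = "levels J"
  let ?A = "{i. i < length J \<and> a \<le> release (J ! i) \<and> deadline J i 0 \<le> b}"
  let ?D = "{i. i < length J \<and> a \<le> release (J ! i) \<and> due J ms i \<le> b}"
  let ?cov = "covers (set ms) a b"
  have DA: "?D \<subseteq> ?A" by (auto intro: order_trans[OF deadline_0_le_due])
  show ?thesis
  proof (cases "excess J a b = 0")
    case True
    have "(\<Sum>i\<in>?D. job_size (J ! i)) \<le> (\<Sum>i\<in>?A. job_size (J ! i))"
      by (rule sum_mono2) (use DA in auto)
    with True show ?thesis by (simp add: hall_at_def excess_eq)
  next
    case False
    then have "(a, b) \<in> set (windows J)" using a b by (simp add: windows_def)
    with feas have ex: "excess J a b \<le> (\<Sum>m\<in>?cov. job_size (J ! (m div ?L)))"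
      and S: "set ms \<subseteq> {..<length J * ?L}"
      unfolding reduction_feasible_iff by auto
    have cov: "m div ?L < length J" if "m \<in> ?cov" for m
      using S that by (auto simp: covers_def less_mult_imp_div_less)
    have inj: "inj_on (\<lambda>m. m div ?L) ?cov"
    proof (rule inj_onI)
      fix m m' assume m: "m \<in> ?cov" "m' \<in> ?cov" "m div ?L = m' div ?L"
      have "m mod ?L = m' mod ?L"
      proof (rule ccontr)
        assume "m mod ?L \<noteq> m' mod ?L"
        then consider "Suc (m mod ?L) \<le> m' mod ?L" | "Suc (m' mod ?L) \<le> m mod ?L" by linarith
        then show False
          using deadline_mono[OF cov[OF m(1)], of "Suc (m mod ?L)" "m' mod ?L"]
            deadline_mono[OF cov[OF m(1)], of "Suc (m' mod ?L)" "m mod ?L"] m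
          by cases (auto simp: covers_def)
      qed
      with m(3) show "m = m'" by (metis div_mult_mod_eq)
    qed
    let ?M = "(\<lambda>m. m div ?L) ` ?cov"
    have M: "(\<Sum>m\<in>?cov. job_size (J ! (m div ?L))) = (\<Sum>i\<in>?M. job_size (J ! i))"
      by (simp add: sum.reindex[OF inj])
    have MA: "?M \<subseteq> ?A"
      using cov by (auto simp: covers_def intro: order_trans[OF deadline_mono])
    have "b < due J ms i" if "i \<in> ?M" for i
      using that by (auto simp: covers_def intro: less_le_trans deadline_le_due)
    then have disj: "?D \<inter> ?M = {}" by (force simp: not_le)
    have fin: "finite ?M" by (rule finite_subset[OF MA]) simp
    have "(\<Sum>i\<in>?D. job_size (J ! i)) + (\<Sum>i\<in>?M. job_size (J ! i)) = (\<Sum>i\<in>?D \<union> ?M. job_size (J ! i))"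
      by (rule sum.union_disjoint[symmetric]) (use disj fin in auto)
    also have "\<dots> \<le> (\<Sum>i\<in>?A. job_size (J ! i))"
      by (rule sum_mono2) (use DA MA in auto)
    finally show ?thesis using ex M by (simp add: hall_at_def excess_eq)
  qed
qed

text \<open>One rectangle pays for its job: if it has level \<open>k\<close>, the deadline it
  reaches has scaled cost at most \<open>2 ^ (k + 1) div 2\<close>, which equals its weight
  \<open>2 ^ k\<close>. A job whose due time is its deadline of level 0 costs nothing.\<close>

lemma due_cost:
  assumes S: "set ms \<subseteq> {..<length J * levels J}"
  shows "real (scale J) * (\<Sum>i<length J. of_rat (cost_at (J ! i) (due J ms i))) \<le> r2c_cost (reduction J) (set ms)"
proof -
  let ?L = "levels J"
  have "real (scale J) * of_rat (cost_at (J ! i) (due J ms i)) \<le> (\<Sum>m\<in>{m\<in>set ms. m div ?L = i}. 2 ^ (m mod ?L))"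
    if i: "i < length J" for i
  proof (cases rule: due_cases[of J ms i])
    case 1
    have "of_rat (of_nat (scale J) * cost_at (J ! i) (due J ms i)) \<le> (of_rat 0 :: real)"
      unfolding of_rat_less_eq using scaled_cost_deadline[OF i, of 0] 1 by simp
    also have "\<dots> \<le> (\<Sum>m\<in>{m\<in>set ms. m div ?L = i}. 2 ^ (m mod ?L))" by (simp add: sum_nonneg)
    finally show ?thesis by (simp add: of_rat_mult)
  next
    case (2 m)
    have "of_rat (of_nat (scale J) * cost_at (J ! i) (due J ms i)) \<le> (of_rat (2 ^ (m mod ?L)) :: real)"
      unfolding of_rat_less_eq using scaled_cost_deadline[OF i, of "Suc (m mod ?L)"] 2 by simp
    also have "\<dots> = 2 ^ (m mod ?L)" by (simp add: of_rat_power)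
    also have "\<dots> \<le> (\<Sum>m\<in>{m\<in>set ms. m div ?L = i}. 2 ^ (m mod ?L))"
      by (rule member_le_sum[where f = "\<lambda>m. 2 ^ (m mod ?L)"]) (use 2 in auto)
    finally show ?thesis by (simp add: of_rat_mult)
  qed
  then show ?thesis
    unfolding reduction_cost[OF S] sum_distrib_left by (intro sum_mono) simp
qed

lemma schedule_hall:
  assumes "gsp_feasible J \<sigma>"
  shows "hall_at J (completion_time \<sigma>) a b"
proof -
  let ?A = "{i. i < length J \<and> a \<le> release (J ! i) \<and> completion_time \<sigma> i \<le> b}"
  have fin: "finite (slots_of \<sigma> i)" "card (slots_of \<sigma> i) = job_size (J ! i)" if "i < length J" for i
    using assms that by (auto simp: gsp_feasible_def)
  have "(\<Sum>i\<in>?A. job_size (J ! i)) = (\<Sum>i\<in>?A. card (slots_of \<sigma> i))"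
    by (intro sum.cong) (auto simp: fin)
  also have "\<dots> = card (\<Union>i\<in>?A. slots_of \<sigma> i)"
    using fin(1) by (intro card_UN_disjoint[symmetric]) (auto simp: slots_of_def)
  also have "\<dots> \<le> card {a..<b}"
  proof (rule card_mono)
    show "(\<Union>i\<in>?A. slots_of \<sigma> i) \<subseteq> {a..<b}"
    proof safe
      fix i s assume i: "i < length J" "a \<le> release (J ! i)" "completion_time \<sigma> i \<le> b" and s: "s \<in> slots_of \<sigma> i"
      have "release (J ! i) \<le> s" using assms s by (auto simp: gsp_feasible_def slots_of_def)
      moreover have "s \<le> Max (slots_of \<sigma> i)" using fin(1)[OF i(1)] s by simp
      ultimately show "s \<in> {a..<b}" using i by (simp add: completion_time_def)
    qed
  qed simp
  finally show ?thesis by (simp add: hall_at_def)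
qed

end

subsection \<open>Earliest-deadline-first\<close>

text \<open>The exchange argument for earliest-deadline-first: when job \<open>i\<close> misses its deadline, the maximal busy
  interval before \<open>d i\<close> only contains jobs released in it and due by \<open>d i\<close>, too many for its length.\<close>

lemma edf_meets_deadlines:
  fixes n T :: nat and r p d :: "nat \<Rightarrow> nat" and X :: "nat \<Rightarrow> nat set" and W :: "nat set"
  assumes fin: "\<And>i. i < n \<Longrightarrow> finite (X i)"
    and rel: "\<And>i s. i < n \<Longrightarrow> s \<in> X i \<Longrightarrow> r i \<le> s"
    and le: "\<And>i. i < n \<Longrightarrow> card (X i) \<le> p i"
    and greedy: "\<And>i s s'. i < n \<Longrightarrow> s \<in> X i \<Longrightarrow> s' \<in> W \<Longrightarrow> r i \<le> s' \<Longrightarrow> s' < s \<Longrightarrow> \<exists>j<n. d j \<le> d i \<and> s' \<in> X j"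
    and full: "\<And>i s'. i < n \<Longrightarrow> card (X i) < p i \<Longrightarrow> s' \<in> W \<Longrightarrow> r i \<le> s' \<Longrightarrow> \<exists>j<n. d j \<le> d i \<and> s' \<in> X j"
    and W: "\<And>i s. i < n \<Longrightarrow> r i \<le> s \<Longrightarrow> s < T \<Longrightarrow> s \<in> W"
    and d: "\<And>i. i < n \<Longrightarrow> d i \<le> T"
    and pos: "\<And>i. i < n \<Longrightarrow> 0 < p i"
    and hall: "\<And>i j. i < n \<Longrightarrow> j < n \<Longrightarrow> (\<Sum>k | k < n \<and> r i \<le> r k \<and> d k \<le> d j. p k) \<le> d j - r i"
    and i: "i < n"
  shows "card (X i) = p i \<and> X i \<subseteq> {..<d i}"
proof (rule ccontr)
  assume neg: "\<not> ?thesis"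
  let ?Y = "\<lambda>j. X j \<inter> {..<d i}"
  have less: "card (?Y i) < p i"
  proof (cases "X i \<subseteq> {..<d i}")
    case True
    with neg le[OF i] show ?thesis by (auto simp: Int_absorb2)
  next
    case False
    then have "card (?Y i) < card (X i)" by (intro psubset_card_mono fin i) auto
    with le[OF i] show ?thesis by simp
  qed
  \<comment> \<open>Busy means used by a job due no later than \<open>i\<close>. Slots held by less
    urgent jobs count as idle, because the greedy hypotheses rule them out.\<close>
  let ?Q = "\<lambda>t. \<forall>s. t \<le> s \<and> s < d i \<longrightarrow> (\<exists>j<n. d j \<le> d i \<and> s \<in> X j)"
  have Q: "?Q (r i)"
  proof (intro allI impI)
    fix s assume s: "r i \<le> s \<and> s < d i"
    then have sW: "s \<in> W" using W[OF i, of s] d[OF i] by simp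
    show "\<exists>j<n. d j \<le> d i \<and> s \<in> X j"
    proof (cases "X i \<subseteq> {..<d i}")
      case True
      with neg le[OF i] have "card (X i) < p i" by auto
      from full[OF i this sW] s show ?thesis by blast
    next
      case False
      then obtain s' where "s' \<in> X i" "d i \<le> s'" by (meson lessThan_iff not_less subsetI)
      with greedy[OF i _ sW, of s'] s show ?thesis by auto
    qed
  qed
  show False
  proof (cases "r i < d i")
    case False
    \<comment> \<open>Truncated subtraction makes the window of \<open>i\<close> alone have length
      0, too short for a job of positive size.\<close>
    have "p i \<le> (\<Sum>k | k < n \<and> r i \<le> r k \<and> d k \<le> d i. p k)"
      by (rule member_le_sum) (use i in auto)
    with hall[OF i i] False pos[OF i] show False by simp
  next
    case True
    define a where "a = (LEAST t. ?Q t)"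
    have a: "?Q a" unfolding a_def by (rule LeastI[of ?Q, OF Q])
    have ai: "a \<le> r i" unfolding a_def by (rule Least_le[of ?Q, OF Q])
    \<comment> \<open>A job in the interval that was released before \<open>a\<close> could have run
      in slot \<open>a - 1\<close>. By greediness that slot would be busy too, against the
      minimality of \<open>a\<close>.\<close>
    have later: "a \<le> r j" if j: "j < n" "d j \<le> d i" "s \<in> X j" "a \<le> s" "s < d i" for j s
    proof (rule ccontr)
      assume "\<not> a \<le> r j"
      then have lt: "r j \<le> a - 1" "a - 1 < s" "a - 1 < d i" "0 < a" using j by auto
      have "a - 1 \<in> W" using W[OF j(1) lt(1)] lt d[OF i] by simp
      from greedy[OF j(1,3) this lt(1,2)] obtain k where k: "k < n" "d k \<le> d j" "a - 1 \<in> X k"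
        by blast
      have "?Q (a - 1)"
      proof (intro allI impI)
        fix s assume s: "a - 1 \<le> s \<and> s < d i"
        show "\<exists>j<n. d j \<le> d i \<and> s \<in> X j"
        proof (cases "s = a - 1")
          case True
          with k order_trans[OF k(2) j(2)] show ?thesis by blast
        next
          case False
          with s have "a \<le> s \<and> s < d i" by linarith
          with a show ?thesis by blast
        qed
      qed
      then have "(LEAST t. ?Q t) \<le> a - 1" by (rule Least_le)
      then have "a \<le> a - 1" by (simp only: a_def)
      with lt show False by simp
    qed
    \<comment> \<open>The job in slot \<open>a\<close> cannot have been released later than
      \<open>a\<close>, so its release time is \<open>a\<close> itself. This is why Hall's condition
      is needed only for windows that start at release times.\<close>
    obtain j where j: "j < n" "d j \<le> d i" "a \<in> X j" using a ai True by auto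
    have aj: "a = r j" using later[OF j, of] rel[OF j(1,3)] ai True by simp
    let ?G = "{k. k < n \<and> r j \<le> r k \<and> d k \<le> d i}"
    have sub: "{a..<d i} \<subseteq> (\<Union>k\<in>?G. ?Y k)"
    proof
      fix s assume s: "s \<in> {a..<d i}"
      with a obtain k where k: "k < n" "d k \<le> d i" "s \<in> X k" by auto
      with later[OF k] s aj show "s \<in> (\<Union>k\<in>?G. ?Y k)" by auto
    qed
    have "d i - a = card {a..<d i}" by simp
    also have "\<dots> \<le> card (\<Union>k\<in>?G. ?Y k)" by (rule card_mono[OF _ sub]) (use fin in auto)
    also have "\<dots> \<le> (\<Sum>k\<in>?G. card (?Y k))" by (rule card_UN_le) simp
    \<comment> \<open>Strict because job \<open>i\<close>, which belongs to \<open>?G\<close>, does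
      not receive its full size before \<open>d i\<close>.\<close>
    also have "\<dots> < (\<Sum>k\<in>?G. p k)"
    proof (rule sum_strict_mono_ex1)
      show "\<forall>k\<in>?G. card (?Y k) \<le> p k"
        using le fin by (auto intro!: order_trans[OF card_mono[OF _ Int_lower1]])
      show "\<exists>k\<in>?G. card (?Y k) < p k" using less i ai aj by auto
    qed simp
    also have "\<dots> \<le> d i - a" using hall[OF j(1) i] aj by simp
    finally show False by simp
  qed
qed

section \<open>Filling intervals job by job\<close>

definition free :: "(nat \<times> nat) list \<Rightarrow> nat set" where
  "free ivs = (\<Union>u\<in>set ivs. {fst u..<snd u})"

definition occupied :: "(nat \<times> nat \<times> nat) list \<Rightarrow> nat \<Rightarrow> nat set" where
  "occupied bs i = {s. \<exists>a b. (i, a, b) \<in> set bs \<and> a \<le> s \<and> s < b}"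

definition fill :: "nat \<Rightarrow> nat \<Rightarrow> nat \<times> nat \<Rightarrow> nat \<times> (nat \<times> nat) list \<times> (nat \<times> nat \<times> nat) list \<Rightarrow>
    nat \<times> (nat \<times> nat) list \<times> (nat \<times> nat \<times> nat) list" where
  "fill i r u st = (let x = (if r \<le> fst u then min (fst st) (snd u - fst u) else 0) in
     (fst st - x, (fst u + x, snd u) # fst (snd st), (i, fst u, fst u + x) # snd (snd st)))"

text \<open>Placing one whole job after another in the order of deadlines, each as early as
  possible, avoids a simulation over exponentially many slots.\<close>

definition place :: "job list \<Rightarrow> nat \<Rightarrow> (nat \<times> nat) list \<times> (nat \<times> nat \<times> nat) list \<Rightarrow>
    (nat \<times> nat) list \<times> (nat \<times> nat \<times> nat) list" where
  "place J i st = (let f = fold (fill i (release (J ! i))) (fst st) (job_size (J ! i), [], snd st) in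
     (rev (fst (snd f)), snd (snd f)))"

text \<open>The intervals between consecutive release times, so that a job may use an interval either from its
  beginning or not at all; hence filling never splits an interval and their number stays the same.\<close>

definition gaps :: "job list \<Rightarrow> (nat \<times> nat) list" where
  "gaps J = (let rs = sort_key (\<lambda>x. x) (map (\<lambda>i. release (J ! i)) [0..<length J]) in
     map (\<lambda>k. (rs ! k, (rs @ [horizon J]) ! Suc k)) [0..<length J])"

definition blocks :: "job list \<Rightarrow> (nat \<Rightarrow> nat) \<Rightarrow> (nat \<times> nat \<times> nat) list" where
  "blocks J d = snd (fold (place J) (sort_key d [0..<length J]) (gaps J, []))"

definition chain :: "(nat \<times> nat) list \<Rightarrow> bool" where
  "chain ivs \<longleftrightarrow> sorted_wrt (\<lambda>u v. snd u \<le> fst v) ivs \<and> (\<forall>u\<in>set ivs. fst u \<le> snd u)"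

text \<open>Makes \<open>fill\<close> correct: an interval lies either before the release time or
  entirely in the job's reach, so it never has to be split.\<close>

definition aligned :: "nat \<Rightarrow> (nat \<times> nat) list \<Rightarrow> bool" where
  "aligned r ivs \<longleftrightarrow> (\<forall>u\<in>set ivs. fst u < r \<longrightarrow> snd u \<le> r)"

lemma occupied_Cons: "occupied ((i, a, b) # bs) j = (if i = j then {a..<b} else {}) \<union> occupied bs j"
  unfolding occupied_def by auto blast+

text \<open>The last two conjuncts are the greedy properties that earliest-deadline-first needs.
  They hold because intervals are passed in order, and work goes on to the next one only if the
  present one is out of reach or used up.\<close>

lemma fill_intervals:
  assumes "chain ivs" "aligned r ivs"
  shows "\<exists>rem' ivs' bs' X. fold (fill i r) ivs (rem, F, B) = (rem', rev ivs' @ F, bs') \<and>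
     list_all2 (\<lambda>u v. fst u \<le> fst v \<and> fst v \<le> snd u \<and> snd v = snd u) ivs ivs' \<and>
     length bs' = length ivs + length B \<and>
     (\<forall>j. occupied bs' j = (if j = i then X else {}) \<union> occupied B j) \<and>
     X \<subseteq> free ivs \<inter> {r..} \<and> free ivs' = free ivs - X \<and>
     finite X \<and> card X + rem' = rem \<and>
     (\<forall>s\<in>X. \<forall>s'\<in>free ivs. r \<le> s' \<and> s' < s \<longrightarrow> s' \<in> X) \<and>
     (0 < rem' \<longrightarrow> free ivs \<inter> {r..} \<subseteq> X)"
  using assms
proof (induction ivs arbitrary: rem F B)
  case Nil
  then show ?case by (auto simp: free_def intro!: exI[of _ "[]"] exI[of _ "{}"])
next
  case (Cons u ivs)
  define a b where "a = fst u" and "b = snd u"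
  have u: "u = (a, b)" by (simp add: a_def b_def)
  have ab: "a \<le> b" "chain ivs" "aligned r ivs" and al: "a < r \<Longrightarrow> b \<le> r"
    and ge: "\<And>s. s \<in> free ivs \<Longrightarrow> b \<le> s"
    using Cons.prems by (auto simp: chain_def aligned_def u free_def)
  define x where "x = (if r \<le> a then min rem (b - a) else 0)"
  have xb: "a + x \<le> b" "x \<le> rem" using ab by (auto simp: x_def)
  obtain rem' ivs' bs' X where IH:
    "fold (fill i r) ivs (rem - x, (a + x, b) # F, (i, a, a + x) # B) = (rem', rev ivs' @ (a + x, b) # F, bs')"
    "list_all2 (\<lambda>u v. fst u \<le> fst v \<and> fst v \<le> snd u \<and> snd v = snd u) ivs ivs'"
    "length bs' = length ivs + length ((i, a, a + x) # B)"
    "\<forall>j. occupied bs' j = (if j = i then X else {}) \<union> occupied ((i, a, a + x) # B) j"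
    "X \<subseteq> free ivs \<inter> {r..}" "free ivs' = free ivs - X" "finite X" "card X + rem' = rem - x"
    "\<forall>s\<in>X. \<forall>s'\<in>free ivs. r \<le> s' \<and> s' < s \<longrightarrow> s' \<in> X" "0 < rem' \<longrightarrow> free ivs \<inter> {r..} \<subseteq> X"
    using Cons.IH[OF ab(2,3), of "rem - x" "(a + x, b) # F" "(i, a, a + x) # B"] by blast
  let ?Y = "{a..<a + x} \<union> X"
  have free_u: "free (v # vs) = {fst v..<snd v} \<union> free vs" for v vs by (auto simp: free_def)
  have disj: "{a..<b} \<inter> free ivs = {}" using ge by force
  \<comment> \<open>If work remains after this interval, the minimum in \<open>x\<close> was not the
    remaining amount.\<close>
  have rest: "a < r \<or> a + x = b" if "x < rem" using that ab(1) by (auto simp: x_def)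
  have taken: "s \<in> {a..<a + x}" if "s \<in> {a..<b}" "r \<le> s" "x < rem" for s
    using rest[OF that(3)] al that by auto
  have "fold (fill i r) (u # ivs) (rem, F, B) = (rem', rev ((a + x, b) # ivs') @ F, bs')"
  proof -
    have "fill i r u (rem, F, B) = (rem - x, (a + x, b) # F, (i, a, a + x) # B)"
      unfolding fill_def u x_def Let_def by simp
    then show ?thesis using IH(1) by simp
  qed
  moreover have "list_all2 (\<lambda>u v. fst u \<le> fst v \<and> fst v \<le> snd u \<and> snd v = snd u) (u # ivs) ((a + x, b) # ivs')"
    using IH(2) xb by (simp add: u)
  moreover have "length bs' = length (u # ivs) + length B" using IH(3) by simp
  moreover have "\<forall>j. occupied bs' j = (if j = i then ?Y else {}) \<union> occupied B j"
    using IH(4) by (auto simp: occupied_Cons)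
  moreover have "?Y \<subseteq> free (u # ivs) \<inter> {r..}"
    using IH(5) xb by (auto simp: free_u u x_def split: if_splits)
  moreover have "free ((a + x, b) # ivs') = free (u # ivs) - ?Y"
  proof -
    have "free ivs \<inter> {a..<b} = {}" "X \<subseteq> free ivs" using disj IH(5) by auto
    moreover have "{a + x..<b} = {a..<b} - {a..<a + x}" "{a..<a + x} \<subseteq> {a..<b}" using xb by auto
    ultimately show ?thesis unfolding free_u u fst_conv snd_conv IH(6) by blast
  qed
  moreover have "finite ?Y" using IH(7) by simp
  moreover have "card ?Y + rem' = rem"
  proof -
    have "X \<subseteq> free ivs" "{a..<a + x} \<subseteq> {a..<b}" using IH(5) xb by auto
    with disj have "{a..<a + x} \<inter> X = {}" by blast
    then have "card ?Y = x + card X" using IH(7) by (simp add: card_Un_disjoint)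
    then show ?thesis using IH(8) xb by simp
  qed
  moreover have "\<forall>s\<in>?Y. \<forall>s'\<in>free (u # ivs). r \<le> s' \<and> s' < s \<longrightarrow> s' \<in> ?Y"
  proof (intro ballI impI)
    fix s s' assume s: "s \<in> ?Y" and s': "s' \<in> free (u # ivs)" and lt: "r \<le> s' \<and> s' < s"
    from s' consider "s' \<in> {a..<b}" | "s' \<in> free ivs" by (auto simp: free_u u)
    then show "s' \<in> ?Y"
    proof cases
      case 1
      show ?thesis
      proof (cases "s \<in> X")
        case True
        \<comment> \<open>A slot taken in a later interval shows that work remained after
          \<open>u\<close>, so the available slots of \<open>u\<close> were all taken.\<close>
        then have "0 < card X" using IH(7) by (auto simp: card_gt_0_iff)
        then have "x < rem" using IH(8) by simp
        with taken[of s'] 1 lt show ?thesis by blast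
      qed (use s 1 lt in auto)
    next
      case 2
      have "s \<in> X" using s ge[OF 2] lt xb by auto
      with IH(9) 2 lt show ?thesis by blast
    qed
  qed
  moreover have "0 < rem' \<longrightarrow> free (u # ivs) \<inter> {r..} \<subseteq> ?Y"
  proof
    assume rem': "0 < rem'"
    then have "x < rem" using IH(8) by simp
    with taken IH(10) rem' show "free (u # ivs) \<inter> {r..} \<subseteq> ?Y" by (force simp: free_u u)
  qed
  ultimately show ?case by blast
qed

text \<open>Filling only moves left ends to the right inside their intervals.\<close>

lemma chain_shrink:
  assumes "list_all2 (\<lambda>u v. fst u \<le> fst v \<and> fst v \<le> snd u \<and> snd v = snd u) ivs ivs'"
  shows "chain ivs \<Longrightarrow> chain ivs'" "aligned r ivs \<Longrightarrow> aligned r ivs'"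
proof -
  have len: "length ivs = length ivs'" using assms by (rule list_all2_lengthD)
  have nth: "fst (ivs ! k) \<le> fst (ivs' ! k) \<and> fst (ivs' ! k) \<le> snd (ivs ! k) \<and> snd (ivs' ! k) = snd (ivs ! k)"
    if "k < length ivs'" for k
    using list_all2_nthD2[OF assms that] by simp
  show "chain ivs'" if "chain ivs"
    unfolding chain_def
  proof
    show "sorted_wrt (\<lambda>u v. snd u \<le> fst v) ivs'"
      unfolding sorted_wrt_iff_nth_less
    proof (intro allI impI)
      fix k l assume kl: "k < l" "l < length ivs'"
      then have "snd (ivs ! k) \<le> fst (ivs ! l)"
        using that len by (auto simp: chain_def sorted_wrt_iff_nth_less)
      with nth[of k] nth[of l] kl show "snd (ivs' ! k) \<le> fst (ivs' ! l)" by simp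
    qed
    show "\<forall>u\<in>set ivs'. fst u \<le> snd u" using nth by (metis in_set_conv_nth)
  qed
  show "aligned r ivs'" if "aligned r ivs"
    unfolding aligned_def
  proof (intro ballI impI)
    fix v assume v: "v \<in> set ivs'" "fst v < r"
    then obtain k where k: "k < length ivs'" "v = ivs' ! k" by (auto simp: in_set_conv_nth)
    then have "fst (ivs ! k) < r" using nth[of k] v by simp
    with that k len have "snd (ivs ! k) \<le> r" by (simp add: aligned_def)
    with nth[of k] k show "snd v \<le> r" by simp
  qed
qed

text \<open>Collects hypotheses of \<open>edf_meets_deadlines\<close> relative to the jobs
  \<open>A\<close> placed so far. \<open>W\<close> is the set of slots free at the very start, and
  enlarging \<open>A\<close> preserves the property as long as the sets of placed jobs do not
  change.\<close>

definition greedily_placed :: "job list \<Rightarrow> (nat \<Rightarrow> nat) \<Rightarrow> nat set \<Rightarrow> nat set \<Rightarrow> (nat \<Rightarrow> nat set) \<Rightarrow> nat \<Rightarrow> bool" where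
  "greedily_placed J d W A X i \<longleftrightarrow>
     finite (X i) \<and> card (X i) \<le> job_size (J ! i) \<and> X i \<subseteq> W \<inter> {release (J ! i)..} \<and>
     (\<forall>s\<in>X i. \<forall>s'\<in>W. release (J ! i) \<le> s' \<longrightarrow> s' < s \<longrightarrow> (\<exists>j\<in>A. d j \<le> d i \<and> s' \<in> X j)) \<and>
     (card (X i) < job_size (J ! i) \<longrightarrow>
        (\<forall>s'\<in>W. release (J ! i) \<le> s' \<longrightarrow> (\<exists>j\<in>A. d j \<le> d i \<and> s' \<in> X j)))"

lemma place_jobs:
  fixes J :: "job list" and d :: "nat \<Rightarrow> nat"
  assumes ivs: "chain ivs" "\<forall>i<length J. aligned (release (J ! i)) ivs"
    and js: "distinct js" "set js \<subseteq> {..<length J}" "sorted (map d js)"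
  defines "st \<equiv> fold (place J) js (ivs, [])"
  shows "chain (fst st) \<and> (\<forall>i<length J. aligned (release (J ! i)) (fst st)) \<and>
    free (fst st) = free ivs - (\<Union>i\<in>set js. occupied (snd st) i) \<and>
    (\<forall>i. i \<notin> set js \<longrightarrow> occupied (snd st) i = {}) \<and>
    (\<forall>i\<in>set js. \<forall>j\<in>set js. i \<noteq> j \<longrightarrow> occupied (snd st) i \<inter> occupied (snd st) j = {}) \<and>
    (\<forall>i\<in>set js. greedily_placed J d (free ivs) (set js) (occupied (snd st)) i)"
  using js unfolding st_def
proof (induction js rule: rev_induct)
  case Nil
  then show ?case using ivs by (auto simp: occupied_def)
next
  case (snoc k js)
  define st where "st = fold (place J) js (ivs, [])"
  have js: "distinct js" "set js \<subseteq> {..<length J}" "sorted (map d js)" and k: "k \<notin> set js" "k < length J"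
    and dk: "\<And>j. j \<in> set js \<Longrightarrow> d j \<le> d k"
    using snoc.prems by (auto simp: sorted_append)
  note IH = snoc.IH[OF js, folded st_def]
  let ?r = "release (J ! k)" and ?p = "job_size (J ! k)"
  have wf: "chain (fst st)" "aligned ?r (fst st)" using IH k by auto
  obtain rem' ivs' bs' X where F:
    "fold (fill k ?r) (fst st) (?p, [], snd st) = (rem', rev ivs' @ [], bs')"
    "list_all2 (\<lambda>u v. fst u \<le> fst v \<and> fst v \<le> snd u \<and> snd v = snd u) (fst st) ivs'"
    "\<forall>j. occupied bs' j = (if j = k then X else {}) \<union> occupied (snd st) j"
    "X \<subseteq> free (fst st) \<inter> {?r..}" "free ivs' = free (fst st) - X" "finite X" "card X + rem' = ?p"
    "\<forall>s\<in>X. \<forall>s'\<in>free (fst st). ?r \<le> s' \<and> s' < s \<longrightarrow> s' \<in> X"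
    "0 < rem' \<longrightarrow> free (fst st) \<inter> {?r..} \<subseteq> X"
    using fill_intervals[OF wf, of k ?p "[]" "snd st"] by blast
  have st': "fold (place J) (js @ [k]) (ivs, []) = (ivs', bs')"
    using F(1) by (simp add: place_def Let_def st_def[symmetric])
  have old: "occupied bs' j = occupied (snd st) j" if "j \<noteq> k" for j using F(3) that by simp
  have new: "occupied bs' k = X" using F(3) IH k by simp
  have free_st: "free (fst st) = free ivs - (\<Union>i\<in>set js. occupied (snd st) i)" using IH by blast
  have X: "X \<subseteq> free ivs" "\<And>j. j \<in> set js \<Longrightarrow> X \<inter> occupied (snd st) j = {}" using F(4) free_st by auto
  have mem: "set (js @ [k]) = insert k (set js)" by simp
  have "(\<Union>i\<in>set js. occupied bs' i) = (\<Union>i\<in>set js. occupied (snd st) i)"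
    by (intro SUP_cong refl old) (use k in auto)
  then have Un: "(\<Union>i\<in>insert k (set js). occupied bs' i) = X \<union> (\<Union>i\<in>set js. occupied (snd st) i)"
    using new by simp
  \<comment> \<open>A slot that was free at the start but not when \<open>k\<close> is placed is
    held by a job placed earlier, which is due no later than \<open>k\<close> by the
    sorting.\<close>
  have occ: "\<exists>j\<in>insert k (set js). d j \<le> d k \<and> s' \<in> occupied bs' j"
    if "s' \<in> free ivs" "s' \<in> free (fst st) \<Longrightarrow> s' \<in> X" for s'
  proof (cases "s' \<in> free (fst st)")
    case True
    with that new show ?thesis by auto
  next
    case False
    with that free_st obtain j where "j \<in> set js" "s' \<in> occupied (snd st) j" by auto
    with dk old[of j] k show ?thesis by auto
  qed
  show ?case
    unfolding st' fst_conv snd_conv mem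
  proof (intro conjI)
    show "chain ivs'" by (rule chain_shrink(1)[OF F(2) wf(1)])
    show "\<forall>i<length J. aligned (release (J ! i)) ivs'" using chain_shrink(2)[OF F(2)] IH by blast
    show "free ivs' = free ivs - (\<Union>i\<in>insert k (set js). occupied bs' i)"
      unfolding Un F(5) free_st by auto
    show "\<forall>i. i \<notin> insert k (set js) \<longrightarrow> occupied bs' i = {}" using IH old by auto
    show "\<forall>i\<in>insert k (set js). \<forall>j\<in>insert k (set js). i \<noteq> j \<longrightarrow> occupied bs' i \<inter> occupied bs' j = {}"
    proof (intro ballI impI)
      fix i j assume ij: "i \<in> insert k (set js)" "j \<in> insert k (set js)" "i \<noteq> j"
      consider "i = k" "j \<in> set js" | "j = k" "i \<in> set js" | "i \<in> set js" "j \<in> set js" "i \<noteq> k" "j \<noteq> k"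
        using ij by auto
      then show "occupied bs' i \<inter> occupied bs' j = {}"
      proof cases
        case 1
        with X(2)[of j] new old[of j] ij show ?thesis by auto
      next
        case 2
        with X(2)[of i] new old[of i] ij show ?thesis by auto
      next
        case 3
        with IH old ij show ?thesis by simp
      qed
    qed
    show "\<forall>i\<in>insert k (set js). greedily_placed J d (free ivs) (insert k (set js)) (occupied bs') i"
      (is "\<forall>i\<in>_. ?P i")
    proof
      fix i assume i: "i \<in> insert k (set js)"
      show "?P i"
      proof (cases "i = k")
        case True
        have 1: "finite X" "card X \<le> ?p" "X \<subseteq> free ivs \<inter> {?r..}" using F(4,6,7) X(1) by auto
        have 2: "\<exists>j\<in>insert k (set js). d j \<le> d k \<and> s' \<in> occupied bs' j"
          if "s \<in> X" "s' \<in> free ivs" "?r \<le> s'" "s' < s" for s s'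
          using occ[OF that(2)] F(8) that by blast
        have 3: "\<exists>j\<in>insert k (set js). d j \<le> d k \<and> s' \<in> occupied bs' j"
          if "card X < ?p" "s' \<in> free ivs" "?r \<le> s'" for s'
        proof (rule occ[OF that(2)])
          have "0 < rem'" using that F(7) by simp
          with F(9) that show "s' \<in> X" if "s' \<in> free (fst st)" using that by auto
        qed
        show ?thesis unfolding True greedily_placed_def new using 1 2 3 by blast
      next
        case False
        then have ijs: "i \<in> set js" using i by simp
        have lift: "\<exists>j\<in>insert k (set js). d j \<le> d i \<and> s' \<in> occupied bs' j"
          if ex: "\<exists>j\<in>set js. d j \<le> d i \<and> s' \<in> occupied (snd st) j" for s'
        proof -
          obtain j where j: "j \<in> set js" "d j \<le> d i" "s' \<in> occupied (snd st) j" using ex by blast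
          then have "j \<noteq> k" using k by blast
          with old[of j] j show ?thesis by blast
        qed
        have "greedily_placed J d (free ivs) (set js) (occupied (snd st)) i" using IH ijs by blast
        then show ?thesis unfolding greedily_placed_def old[OF False]
          by (elim conjE, intro conjI ballI impI lift) blast+
      qed
    qed
  qed
qed

section \<open>Initial intervals and the resulting schedule\<close>

lemma sort_releases:
  fixes J :: "job list"
  defines "rs \<equiv> sort_key (\<lambda>x. x) (map (\<lambda>i. release (J ! i)) [0..<length J])"
  shows "length rs = length J" "sorted rs" "set rs = release ` set J" "sorted (rs @ [horizon J])"
proof -
  show len: "length rs = length J" and sorted: "sorted rs" by (simp_all add: rs_def)
  have "map (\<lambda>i. release (J ! i)) [0..<length J] = map release J"
    by (rule nth_equalityI) auto
  then show set: "set rs = release ` set J" by (simp add: rs_def)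
  have "r \<le> horizon J" if "r \<in> set rs" for r
    using that job_size_le_horizon[of _ J] unfolding set by force
  with sorted show "sorted (rs @ [horizon J])" by (simp add: sorted_append)
qed

lemma length_gaps: "length (gaps J) = length J"
  by (simp add: gaps_def Let_def)

text \<open>Equal release times give empty intervals, which do no harm. The horizon closes the last
  interval, so every slot between a release time and the horizon is present.\<close>

lemma gaps_wf:
  shows "chain (gaps J)" "i < length J \<Longrightarrow> aligned (release (J ! i)) (gaps J)"
    and "i < length J \<Longrightarrow> release (J ! i) \<le> s \<Longrightarrow> s < horizon J \<Longrightarrow> s \<in> free (gaps J)"
    and "\<And>u. u \<in> set (gaps J) \<Longrightarrow> fst u \<le> horizon J \<and> snd u \<le> horizon J"
proof -
  define rs where "rs = sort_key (\<lambda>x. x) (map (\<lambda>i. release (J ! i)) [0..<length J])"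
  define ts where "ts = rs @ [horizon J]"
  note rs = sort_releases[of J, folded rs_def]
  have len: "length ts = Suc (length J)" and sorted: "sorted ts" using rs by (auto simp: ts_def)
  have mono: "ts ! k \<le> ts ! l" if "k \<le> l" "l \<le> length J" for k l
    using sorted_nth_mono[OF sorted, of k l] that len by simp
  have gaps: "gaps J = map (\<lambda>k. (ts ! k, ts ! Suc k)) [0..<length J]"
    by (simp add: gaps_def Let_def rs_def[symmetric] ts_def nth_append rs(1))
  have last: "ts ! length J = horizon J" by (simp add: ts_def nth_append rs(1))
  show "chain (gaps J)"
    unfolding chain_def gaps by (auto simp: sorted_wrt_iff_nth_less intro: mono)
  show "fst u \<le> horizon J \<and> snd u \<le> horizon J" if "u \<in> set (gaps J)" for u
    using that mono[of _ "length J"] last by (auto simp: gaps)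
  have ex: "\<exists>m<length J. ts ! m = release (J ! i)" if "i < length J" for i
  proof -
    have "release (J ! i) \<in> set rs" using that rs(3) by simp
    then show ?thesis by (auto simp: in_set_conv_nth rs(1) ts_def nth_append)
  qed
  show "aligned (release (J ! i)) (gaps J)" if i: "i < length J"
  proof -
    obtain m where m: "m < length J" "ts ! m = release (J ! i)" using ex[OF i] by blast
    have "ts ! Suc k \<le> ts ! m" if "k < length J" "ts ! k < ts ! m" for k
    proof -
      have "k < m" using that mono[of m k] by (meson leD le_less_linear less_imp_le)
      then show ?thesis using mono[of "Suc k" m] m by simp
    qed
    then show ?thesis by (auto simp: aligned_def gaps m(2)[symmetric])
  qed
  show "s \<in> free (gaps J)" if i: "i < length J" and s: "release (J ! i) \<le> s" "s < horizon J"
  proof -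
    obtain m where m: "m < length J" "ts ! m = release (J ! i)" using ex[OF i] by blast
    have "s < ts ! (m + (length J - m))" "\<not> s < ts ! (m + 0)" using m s last by auto
    from ex_least_nat_less[of "\<lambda>k. s < ts ! (m + k)", OF this] obtain k
      where k: "k < length J - m" "\<not> s < ts ! (m + k)" "s < ts ! (m + Suc k)" by blast
    then have "m + k < length J" "ts ! (m + k) \<le> s" "s < ts ! Suc (m + k)" by auto
    then show ?thesis by (auto simp: free_def gaps intro!: bexI[of _ "m + k"])
  qed
qed

text \<open>Hall's condition is assumed only from release times to deadlines, which is what a
  feasible set of rectangles certifies.\<close>

lemma blocks_schedule:
  assumes inst: "gsp_is_instance J"
    and d: "\<And>i. i < length J \<Longrightarrow> d i \<le> horizon J"
    and hall: "\<And>i j. i < length J \<Longrightarrow> j < length J \<Longrightarrow> hall_at J d (release (J ! i)) (d j)"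
  obtains \<sigma> where "describes_schedule (blocks J d) \<sigma>" "gsp_feasible J \<sigma>"
    "\<And>i. i < length J \<Longrightarrow> completion_time \<sigma> i \<le> d i"
proof -
  define X where "X = occupied (blocks J d)"
  let ?js = "sort_key d [0..<length J]"
  have js: "distinct ?js" "set ?js \<subseteq> {..<length J}" "sorted (map d ?js)" "set ?js = {..<length J}" by auto
  have "\<forall>i<length J. aligned (release (J ! i)) (gaps J)" by (intro allI impI gaps_wf(2))
  note P = place_jobs[OF gaps_wf(1) this js(1-3), folded blocks_def, folded X_def, unfolded js(4)]
  note empty = P[THEN conjunct2, THEN conjunct2, THEN conjunct2, THEN conjunct1, rule_format, unfolded lessThan_iff]
  note disjoint = P[THEN conjunct2, THEN conjunct2, THEN conjunct2, THEN conjunct2, THEN conjunct1,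
      rule_format, unfolded lessThan_iff]
  note job = P[THEN conjunct2, THEN conjunct2, THEN conjunct2, THEN conjunct2, THEN conjunct2,
      THEN bspec, unfolded lessThan_iff]
  have rel: "release (J ! i) \<le> s" if "i < length J" "s \<in> X i" for i s
    using job[OF that(1)] that(2) unfolding greedily_placed_def by auto
  have pos: "0 < job_size (J ! i)" if "i < length J" for i
    using inst that by (simp add: gsp_is_instance_def)
  have fin: "finite (X i)" and le: "card (X i) \<le> job_size (J ! i)" if "i < length J" for i
    using job[OF that] unfolding greedily_placed_def by simp_all
  have greedy: "\<exists>j<length J. d j \<le> d i \<and> s' \<in> X j"
    if "i < length J" "s \<in> X i" "s' \<in> free (gaps J)" "release (J ! i) \<le> s'" "s' < s" for i s s'
    using job[OF that(1)] that(2-5) unfolding greedily_placed_def by blast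
  have full: "\<exists>j<length J. d j \<le> d i \<and> s' \<in> X j"
    if "i < length J" "card (X i) < job_size (J ! i)" "s' \<in> free (gaps J)" "release (J ! i) \<le> s'" for i s'
    using job[OF that(1)] that(2-4) unfolding greedily_placed_def by blast
  have edf: "card (X i) = job_size (J ! i) \<and> X i \<subseteq> {..<d i}" if "i < length J" for i
    by (rule edf_meets_deadlines[where n = "length J" and r = "\<lambda>i. release (J ! i)"
      and p = "\<lambda>i. job_size (J ! i)" and d = d and X = X and W = "free (gaps J)" and T = "horizon J"],
      erule fin, erule (1) rel, erule le, erule (4) greedy, erule (3) full, erule (2) gaps_wf(3),
      erule d, erule pos, erule (1) hall[unfolded hall_at_def], rule that)
  have disj: "i = j" if "s \<in> X i" "s \<in> X j" for i j s
  proof (rule ccontr)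
    assume "i \<noteq> j"
    moreover have "i < length J" "j < length J" using empty[of i] empty[of j] that by auto
    ultimately show False using disjoint[of i j] that by auto
  qed
  define \<sigma> where "\<sigma> s = (if \<exists>i. s \<in> X i then Some (THE i. s \<in> X i) else None)" for s
  have \<sigma>: "\<sigma> s = Some i \<longleftrightarrow> s \<in> X i" for s i
  proof
    assume "s \<in> X i"
    then have "(THE i. s \<in> X i) = i" using disj by blast
    with \<open>s \<in> X i\<close> show "\<sigma> s = Some i" by (auto simp: \<sigma>_def)
  next
    assume "\<sigma> s = Some i"
    then obtain j where "s \<in> X j" "i = (THE i. s \<in> X i)" by (auto simp: \<sigma>_def split: if_splits)
    moreover from this(1) have "(THE i. s \<in> X i) = j" using disj by blast
    ultimately show "s \<in> X i" by simp
  qed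
  have slots: "slots_of \<sigma> i = X i" for i by (auto simp: slots_of_def \<sigma>)
  show ?thesis
  proof
    show "describes_schedule (blocks J d) \<sigma>"
      unfolding describes_schedule_def \<sigma> by (auto simp: X_def occupied_def)
    show "gsp_feasible J \<sigma>"
      unfolding gsp_feasible_def slots \<sigma> using empty edf rel fin by blast
    show "completion_time \<sigma> i \<le> d i" if "i < length J" for i
    proof -
      have "finite (X i)" "X i \<noteq> {}" using fin[OF that] edf[OF that] pos[OF that] by auto
      then have "Max (X i) \<in> X i" by simp
      then show ?thesis using edf[OF that] by (auto simp: completion_time_def slots)
    qed
  qed
qed

subsection \<open>The reduction in polynomial time\<close>

text \<open>Holds for the initial store and, by \<open>gsp_store_lift\<close>, for the stores of all
  loop bodies. Every rule below is therefore available at any nesting depth.\<close>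

definition gsp_store :: "'c family \<Rightarrow> ('c \<Rightarrow> job list) \<Rightarrow> ('c \<Rightarrow> val) \<Rightarrow> bool" where
  "gsp_store K I e \<longleftrightarrow> (\<forall>c\<in>contexts K. queries K c = gsp_answer (I c) \<and> len K c = gsp_input_size (I c) \<and>
     gsp_is_instance (I c)) \<and> ptime K e (\<lambda>c. gsp_input (I c))"

lemma gsp_store_lift:
  assumes "gsp_store K I e" "\<And>g. ptime K e g \<Longrightarrow> ptime (with_var K A) e' (\<lambda>z. g (fst z))"
  shows "gsp_store (with_var K A) (\<lambda>z. I (fst z)) e'"
  using assms by (auto simp: gsp_store_def)


text \<open>Weight functions are arbitrary, so this is the bound that keeps the answers to queries,
  and with them the scale and the levels, polynomially long.\<close>

lemma bits_cost_le_input_size: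
  assumes "i < length J" "t \<le> horizon J"
  shows "bits (enc_rat (cost_at (J ! i) t)) \<le> gsp_input_size J"
proof -
  let ?f = "\<lambda>j. Max ((\<lambda>t. bits (enc_rat (cost_at j t))) ` {..horizon J})"
  have "bits (enc_rat (cost_at (J ! i) t)) \<le> ?f (J ! i)"
    using assms by (intro Max_ge) auto
  also have "\<dots> \<le> (\<Sum>j\<leftarrow>J. ?f j)"
    using assms by (intro member_le_sum_list) auto
  finally show ?thesis by (simp add: gsp_input_size_def)
qed

section \<open>Access to jobs and to costs\<close>

context
  fixes K :: "'c family" and I :: "'c \<Rightarrow> job list" and e :: "'c \<Rightarrow> val"
  assumes G: "gsp_store K I e"
begin

lemma gsp_store_input: "ptime K e (\<lambda>c. gsp_input (I c))"
  using G by (simp add: gsp_store_def)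

lemma gsp_store_inst: "c \<in> contexts K \<Longrightarrow> gsp_is_instance (I c)"
  using G by (simp add: gsp_store_def)

lemma ptime_num_jobs: "ptime K e (\<lambda>c. enc_nat (length (I c)))" "poly_bounded K (\<lambda>c. length (I c))"
proof -
  have *: "ptime K e (\<lambda>c. enc_list (\<lambda>j. Pr (enc_nat (release j)) (enc_nat (job_size j))) (I c))"
    using gsp_store_input by (simp add: gsp_input_def)
  then show "ptime K e (\<lambda>c. enc_nat (length (I c)))" by (rule ptime_length)
  show "poly_bounded K (\<lambda>c. length (I c))"
    by (rule poly_bounded_mono[OF ptime_bits(2)[OF *]]) (rule length_le_bits_enc_list)
qed

lemma ptime_job:
  assumes "ptime K e (\<lambda>c. enc_nat (i c))" "\<And>c. c \<in> contexts K \<Longrightarrow> i c < length (I c)"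
  shows "ptime K e (\<lambda>c. enc_nat (release (I c ! i c)))" "ptime K e (\<lambda>c. enc_nat (job_size (I c ! i c)))"
proof -
  have "ptime K e (\<lambda>c. enc_list (\<lambda>j. Pr (enc_nat (release j)) (enc_nat (job_size j))) (I c))"
    using gsp_store_input by (simp add: gsp_input_def)
  from ptime_nth[OF this assms]
  show "ptime K e (\<lambda>c. enc_nat (release (I c ! i c)))" "ptime K e (\<lambda>c. enc_nat (job_size (I c ! i c)))"
    by (auto dest: ptime_left ptime_right)
qed

lemma ptime_job_indices: "ptime K e (\<lambda>c. enc_list enc_nat [0..<length (I c)])"
  by (intro ptime_upt ptime_num_jobs)

lemma ptime_query:
  assumes i: "ptime K e (\<lambda>c. enc_nat (i c))" "\<And>c. c \<in> contexts K \<Longrightarrow> i c < length (I c)"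
    and t: "ptime K e (\<lambda>c. enc_nat (t c))" "\<And>c. c \<in> contexts K \<Longrightarrow> t c \<le> horizon (I c)"
  shows "ptime K e (\<lambda>c. enc_nat (num (cost_at (I c ! i c) (t c))))"
    "ptime K e (\<lambda>c. enc_nat (den (cost_at (I c ! i c) (t c))))"
proof -
  note p = ptime_pair[OF i(1) t(1)]
  have eq: "apply_op (queries K c) Query (Pr (enc_nat (i c)) (enc_nat (t c))) = enc_rat (cost_at (I c ! i c) (t c))"
    if "c \<in> contexts K" for c
    using G that i(2)[OF that] by (simp add: gsp_store_def enc_nat_def)
  have "poly_bounded K (\<lambda>c. bits (apply_op (queries K c) Query (Pr (enc_nat (i c)) (enc_nat (t c)))))"
  proof (rule poly_bounded_mono[OF poly_bounded_len])
    fix c assume c: "c \<in> contexts K"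
    then show "bits (apply_op (queries K c) Query (Pr (enc_nat (i c)) (enc_nat (t c)))) \<le> len K c"
      unfolding eq[OF c] using G bits_cost_le_input_size[OF i(2)[OF c] t(2)[OF c]] by (simp add: gsp_store_def)
  qed
  from ptime_seq[OF p ptime_Op[OF ptime_bits(2)[OF p] this]]
  have "ptime K e (\<lambda>c. Pr (enc_nat (num (cost_at (I c ! i c) (t c)))) (enc_nat (den (cost_at (I c ! i c) (t c)))))"
    by (rule ptime_cong) (simp add: eq enc_rat_nonneg cost_at_nonneg gsp_store_inst i del: apply_op.simps)
  then show "ptime K e (\<lambda>c. enc_nat (num (cost_at (I c ! i c) (t c))))"
    "ptime K e (\<lambda>c. enc_nat (den (cost_at (I c ! i c) (t c))))"
    by (auto dest: ptime_left ptime_right)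
qed

end

lemma ptime_horizon:
  fixes K :: "'c family"
  assumes G: "gsp_store K I e"
  shows "ptime K e (\<lambda>c. enc_nat (horizon (I c)))"
  unfolding horizon_conv_fold
proof (rule ptime_add)
  let ?K = "with_var K (\<lambda>c. set [0..<length (I c)])"
  note js = ptime_job_indices[OF G]
  show "ptime K e (\<lambda>c. enc_nat (fold (\<lambda>i. max (release (I c ! i))) [0..<length (I c)] 0))"
  proof (rule ptime_fold_max[OF js ptime_nat[OF js]])
    fix e' assume L: "\<And>g. ptime K e g \<Longrightarrow> ptime ?K e' (\<lambda>z. g (fst z))" and X: "ptime ?K e' (\<lambda>z. enc_nat (snd z))"
    show "ptime ?K e' (\<lambda>z. enc_nat (release (I (fst z) ! snd z)))"
      by (rule ptime_job(1)[OF gsp_store_lift[OF G L] X]) auto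
  qed
  show "ptime K e (\<lambda>c. enc_nat (\<Sum>i\<leftarrow>[0..<length (I c)]. job_size (I c ! i)))"
  proof (rule ptime_sum_list[OF js])
    fix e' assume L: "\<And>g. ptime K e g \<Longrightarrow> ptime ?K e' (\<lambda>z. g (fst z))" and X: "ptime ?K e' (\<lambda>z. enc_nat (snd z))"
    show "ptime ?K e' (\<lambda>z. enc_nat (job_size (I (fst z) ! snd z)))"
      by (rule ptime_job(2)[OF gsp_store_lift[OF G L] X]) auto
  qed
qed

lemma ptime_reach:
  fixes K :: "'c family"
  assumes G: "gsp_store K I e"
    and i: "ptime K e (\<lambda>c. enc_nat (i c))" "\<And>c. c \<in> contexts K \<Longrightarrow> i c < length (I c)"
    and D: "ptime K e (\<lambda>c. enc_nat (D c))" and w: "ptime K e (\<lambda>c. enc_nat (w c))"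
  shows "ptime K e (\<lambda>c. enc_nat (reach (I c) (D c) (w c) (i c)))"
  unfolding reach_def search_def
proof (rule ptime_fold[where es = "\<lambda>_. enc_nat" and ea = "\<lambda>_. enc_nat" and R = "\<lambda>c t. t \<le> horizon (I c)"])
  note T = ptime_horizon[OF G]
  show "ptime K e (\<lambda>c. enc_list enc_nat (rev [0..<floorlog 2 (horizon (I c))]))"
    by (intro ptime_rev ptime_upt ptime_floorlog[OF T])
  show "ptime K e (\<lambda>c. enc_nat 0)" by (rule ptime_nat[OF T])
  show "poly_bounded (with_var K (\<lambda>c. {t. t \<le> horizon (I c)})) (\<lambda>z. bits (enc_nat (snd z)))"
    by (rule poly_bounded_with_varI[OF ptime_bits(2)[OF T]]) (simp add: bits_enc_nat_mono)
  let ?ok = "\<lambda>c t. D c * num (cost_at (I c ! i c) t) \<le> w c * den (cost_at (I c ! i c) t)"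
  let ?f = "\<lambda>c k t. if t + 2 ^ k \<le> horizon (I c) \<and> ?ok c (t + 2 ^ k) then t + 2 ^ k else t"
  show "fold (?f c) (take m (rev [0..<floorlog 2 (horizon (I c))])) 0 \<le> horizon (I c)" for c m
    by (rule fold_invariant[where Q = "\<lambda>_. True"]) auto
  let ?K = "with_var K (\<lambda>c. set (rev [0..<floorlog 2 (horizon (I c))]) \<times> {t. t \<le> horizon (I c)})"
  fix e' assume L: "\<And>g. ptime K e g \<Longrightarrow> ptime ?K e' (\<lambda>z. g (fst z))"
    and X: "ptime ?K e' (\<lambda>z. enc_nat (fst (snd z)))" and S: "ptime ?K e' (\<lambda>z. enc_nat (snd (snd z)))"
  note G' = gsp_store_lift[OF G L]
  have "poly_bounded ?K (\<lambda>z. fst (snd z))"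
    by (rule poly_bounded_with_varI[OF ptime_floorlog(2)[OF T]]) auto
  then have t': "ptime ?K e' (\<lambda>z. enc_nat (snd (snd z) + 2 ^ fst (snd z)))"
    by (intro ptime_add S ptime_power X)
  \<comment> \<open>The input size only bounds the answers to queries up to the horizon.\<close>
  note u = ptime_min[OF t' L[OF T]]
  have "ptime ?K e' (\<lambda>z. enc_nat (num (cost_at (I (fst z) ! i (fst z)) (min (snd (snd z) + 2 ^ fst (snd z)) (horizon (I (fst z)))))))"
    "ptime ?K e' (\<lambda>z. enc_nat (den (cost_at (I (fst z) ! i (fst z)) (min (snd (snd z) + 2 ^ fst (snd z)) (horizon (I (fst z)))))))"
    by (rule ptime_query[OF G' L[OF i(1)] _ u]; use i(2) in simp)+
  then have "ptime ?K e' (\<lambda>z. enc_nat (if snd (snd z) + 2 ^ fst (snd z) \<le> horizon (I (fst z)) \<and>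
      ?ok (fst z) (min (snd (snd z) + 2 ^ fst (snd z)) (horizon (I (fst z))))
      then snd (snd z) + 2 ^ fst (snd z) else snd (snd z)))"
    by (intro ptime_if_nat ptime_conj ptime_le ptime_mult t' S L[OF T] L[OF D] L[OF w])
  then show "ptime ?K e' (\<lambda>z. enc_nat (?f (fst z) (fst (snd z)) (snd (snd z))))"
    by (rule ptime_cong) (simp add: min_absorb1 cong: conj_cong)
qed

section \<open>Computing the parameters and the R2C instance\<close>

lemma ptime_scale:
  fixes K :: "'c family"
  assumes G: "gsp_store K I e"
  shows "ptime K e (\<lambda>c. enc_nat (scale (I c)))"
  unfolding scale_def
proof (rule ptime_prod_list[OF ptime_job_indices[OF G]])
  let ?K = "with_var K (\<lambda>c. set [0..<length (I c)])"
  fix e' assume L: "\<And>g. ptime K e g \<Longrightarrow> ptime ?K e' (\<lambda>z. g (fst z))" and X: "ptime ?K e' (\<lambda>z. enc_nat (snd z))"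
  note G' = gsp_store_lift[OF G L]
  have "ptime ?K e' (\<lambda>z. enc_nat (min (free_until (I (fst z)) (snd z) + 1) (horizon (I (fst z)))))"
    unfolding free_until_def
    by (intro ptime_min ptime_add ptime_horizon[OF G'] ptime_reach[OF G' X] ptime_nat[OF X]) auto
  from ptime_query(2)[OF G' X _ this]
  show "ptime ?K e' (\<lambda>z. enc_nat (den (cost_at (I (fst z) ! snd z) (min (Suc (free_until (I (fst z)) (snd z))) (horizon (I (fst z)))))))"
    by simp
qed

lemma ptime_levels:
  fixes K :: "'c family"
  assumes G: "gsp_store K I e"
  shows "ptime K e (\<lambda>c. enc_nat (levels (I c)))" "poly_bounded K (\<lambda>c. levels (I c))"
proof -
  note js = ptime_job_indices[OF G]
  have "ptime K e (\<lambda>c. enc_nat (\<Sum>i\<leftarrow>[0..<length (I c)]. num (cost_at (I c ! i) (horizon (I c)))))"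
  proof (rule ptime_sum_list[OF js])
    let ?K = "with_var K (\<lambda>c. set [0..<length (I c)])"
    fix e' assume L: "\<And>g. ptime K e g \<Longrightarrow> ptime ?K e' (\<lambda>z. g (fst z))" and X: "ptime ?K e' (\<lambda>z. enc_nat (snd z))"
    note G' = gsp_store_lift[OF G L]
    show "ptime ?K e' (\<lambda>z. enc_nat (num (cost_at (I (fst z) ! snd z) (horizon (I (fst z))))))"
      by (rule ptime_query(1)[OF G' X _ ptime_horizon[OF G']]) auto
  qed
  then have "ptime K e (\<lambda>c. enc_nat (2 * (scale (I c) * (\<Sum>i\<leftarrow>[0..<length (I c)]. num (cost_at (I c ! i) (horizon (I c))))) + 1))"
    by (intro ptime_add ptime_mult ptime_nat[OF js] ptime_scale[OF G])
  from ptime_floorlog[OF this]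
  show "ptime K e (\<lambda>c. enc_nat (levels (I c)))" "poly_bounded K (\<lambda>c. levels (I c))"
    by (simp_all only: levels_def)
qed

text \<open>The threshold has about \<open>k\<close> bits, so \<open>k\<close> has to stay within
  the polynomially many levels.\<close>

lemma ptime_deadline:
  fixes K :: "'c family"
  assumes G: "gsp_store K I e"
    and i: "ptime K e (\<lambda>c. enc_nat (i c))" "\<And>c. c \<in> contexts K \<Longrightarrow> i c < length (I c)"
    and k: "ptime K e (\<lambda>c. enc_nat (k c))" "\<And>c. c \<in> contexts K \<Longrightarrow> k c \<le> levels (I c)"
  shows "ptime K e (\<lambda>c. enc_nat (deadline (I c) (i c) (k c)))"
proof -
  have "poly_bounded K k" by (rule poly_bounded_mono[OF ptime_levels(2)[OF G] k(2)])
  then show ?thesis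
    unfolding deadline_def
    by (intro ptime_reach[OF G] i ptime_scale[OF G] ptime_div ptime_power k ptime_nat[OF k(1)])
qed

lemma ptime_excess:
  fixes K :: "'c family"
  assumes G: "gsp_store K I e"
    and a: "ptime K e (\<lambda>c. enc_nat (a c))" and b: "ptime K e (\<lambda>c. enc_nat (b c))"
  shows "ptime K e (\<lambda>c. enc_nat (excess (I c) (a c) (b c)))"
  unfolding excess_def
proof (intro ptime_diff a b, rule ptime_sum_list[OF ptime_job_indices[OF G]])
  let ?K = "with_var K (\<lambda>c. set [0..<length (I c)])"
  fix e' assume L: "\<And>g. ptime K e g \<Longrightarrow> ptime ?K e' (\<lambda>z. g (fst z))" and X: "ptime ?K e' (\<lambda>z. enc_nat (snd z))"
  note G' = gsp_store_lift[OF G L]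
  show "ptime ?K e' (\<lambda>z. enc_nat (if a (fst z) \<le> release (I (fst z) ! snd z) \<and> deadline (I (fst z)) (snd z) 0 \<le> b (fst z)
      then job_size (I (fst z) ! snd z) else 0))"
    by (intro ptime_if_nat ptime_conj ptime_le L[OF a] L[OF b] ptime_job[OF G' X] ptime_deadline[OF G' X] ptime_nat[OF X]) auto
qed

lemma ptime_starts:
  fixes K :: "'c family"
  assumes G: "gsp_store K I e"
  shows "ptime K e (\<lambda>c. enc_list enc_nat (starts (I c)))"
  unfolding starts_def
proof (rule ptime_union_Nil, unfold enc_list_map, rule ptime_map[OF ptime_job_indices[OF G]])
  let ?K = "with_var K (\<lambda>c. set [0..<length (I c)])"
  fix e' assume L: "\<And>g. ptime K e g \<Longrightarrow> ptime ?K e' (\<lambda>z. g (fst z))" and X: "ptime ?K e' (\<lambda>z. enc_nat (snd z))"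
  show "ptime ?K e' (\<lambda>z. enc_nat (release (I (fst z) ! snd z)))"
    by (rule ptime_job(1)[OF gsp_store_lift[OF G L] X]) auto
qed

lemma ptime_ends:
  fixes K :: "'c family"
  assumes G: "gsp_store K I e"
  shows "ptime K e (\<lambda>c. enc_list enc_nat (ends (I c)))"
  unfolding ends_def
proof (rule ptime_union_Nil, unfold enc_list_map, rule ptime_map)
  have S: "ptime K e (\<lambda>c. enc_nat (Suc (levels (I c))))" "poly_bounded K (\<lambda>c. Suc (levels (I c)))"
    using ptime_add[OF ptime_levels(1)[OF G] ptime_nat[where k = 1, OF ptime_levels(1)[OF G]]]
      poly_bounded_Suc[OF ptime_levels(2)[OF G]] by simp_all
  then show "ptime K e (\<lambda>c. enc_list enc_nat [0..<length (I c) * Suc (levels (I c))])"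
    by (intro ptime_upt ptime_mult poly_bounded_mult ptime_num_jobs[OF G])
  let ?K = "with_var K (\<lambda>c. set [0..<length (I c) * Suc (levels (I c))])"
  fix e' assume L: "\<And>g. ptime K e g \<Longrightarrow> ptime ?K e' (\<lambda>z. g (fst z))" and X: "ptime ?K e' (\<lambda>z. enc_nat (snd z))"
  note G' = gsp_store_lift[OF G L]
  show "ptime ?K e' (\<lambda>z. enc_nat (deadline (I (fst z)) (snd z div Suc (levels (I (fst z)))) (snd z mod Suc (levels (I (fst z))))))"
    by (intro ptime_deadline[OF G'] ptime_div ptime_mod X L[OF S(1)])
      (auto simp: less_mult_imp_div_less simp del: mult_Suc_right intro: less_Suc_eq_le[THEN iffD1])
qed

definition enc_pair :: "nat \<times> nat \<Rightarrow> val" where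
  "enc_pair u = Pr (enc_nat (fst u)) (enc_nat (snd u))"

lemma ptime_windows:
  fixes K :: "'c family"
  assumes G: "gsp_store K I e"
  shows "ptime K e (\<lambda>c. enc_list enc_pair (windows (I c)))"
  unfolding windows_def
proof (rule ptime_filter)
  show "ptime K e (\<lambda>c. enc_list enc_pair (List.product (starts (I c)) (ends (I c))))"
    unfolding product_concat_map
  proof (rule ptime_concat, unfold enc_list_map, rule ptime_map[OF ptime_starts[OF G]])
    let ?K = "with_var K (\<lambda>c. set (starts (I c)))"
    fix e' assume L: "\<And>g. ptime K e g \<Longrightarrow> ptime ?K e' (\<lambda>z. g (fst z))" and X: "ptime ?K e' (\<lambda>z. enc_nat (snd z))"
    show "ptime ?K e' (\<lambda>z. enc_list (\<lambda>b. enc_pair (snd z, b)) (ends (I (fst z))))"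
    proof (rule ptime_map[OF L[OF ptime_ends[OF G]]])
      let ?K' = "with_var ?K (\<lambda>z. set (ends (I (fst z))))"
      fix e'' assume L': "\<And>g. ptime ?K e' g \<Longrightarrow> ptime ?K' e'' (\<lambda>z. g (fst z))" and Y: "ptime ?K' e'' (\<lambda>z. enc_nat (snd z))"
      show "ptime ?K' e'' (\<lambda>z. enc_pair (snd (fst z), snd z))"
        unfolding enc_pair_def fst_conv snd_conv by (intro ptime_pair L'[OF X] Y)
    qed
  qed
  let ?K = "with_var K (\<lambda>c. set (List.product (starts (I c)) (ends (I c))))"
  fix e' assume L: "\<And>g. ptime K e g \<Longrightarrow> ptime ?K e' (\<lambda>z. g (fst z))" and X: "ptime ?K e' (\<lambda>z. enc_pair (snd z))"
  show "ptime ?K e' (\<lambda>z. enc_bool (0 < excess (I (fst z)) (fst (snd z)) (snd (snd z))))"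
    using X unfolding enc_pair_def
    by (intro ptime_less ptime_nat[OF X] ptime_excess[OF gsp_store_lift[OF G L]]) (auto dest: ptime_left ptime_right)
qed

lemma ptime_reduction:
  fixes K :: "'c family"
  assumes G: "gsp_store K I e"
  shows "ptime K e (\<lambda>c. r2c_input (reduction (I c)))"
  unfolding r2c_input_def reduction_def fst_conv snd_conv enc_list_map
proof (rule ptime_pair)
  show "ptime K e (\<lambda>c. enc_list (\<lambda>w. enc_dpoint (point (I c) w)) (windows (I c)))"
  proof (rule ptime_map[OF ptime_windows[OF G]])
    let ?K = "with_var K (\<lambda>c. set (windows (I c)))"
    fix e' assume L: "\<And>g. ptime K e g \<Longrightarrow> ptime ?K e' (\<lambda>z. g (fst z))" and X: "ptime ?K e' (\<lambda>z. enc_pair (snd z))"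
    note a = ptime_left[OF X[unfolded enc_pair_def]] and b = ptime_right[OF X[unfolded enc_pair_def]]
    show "ptime ?K e' (\<lambda>z. enc_dpoint (point (I (fst z)) (snd z)))"
      unfolding point_def enc_dpoint_def dpoint.simps enc_rat_of_nat
      by (intro ptime_pair ptime_add ptime_mult a b ptime_nat[OF X] ptime_excess[OF gsp_store_lift[OF G L]])
  qed
  show "ptime K e (\<lambda>c. enc_list (\<lambda>m. enc_rectangle (rect (I c) m)) [0..<length (I c) * levels (I c)])"
  proof (rule ptime_map)
    show "ptime K e (\<lambda>c. enc_list enc_nat [0..<length (I c) * levels (I c)])"
      by (intro ptime_upt ptime_mult poly_bounded_mult ptime_num_jobs[OF G] ptime_levels[OF G])
    let ?K = "with_var K (\<lambda>c. set [0..<length (I c) * levels (I c)])"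
    fix e' assume L: "\<And>g. ptime K e g \<Longrightarrow> ptime ?K e' (\<lambda>z. g (fst z))" and X: "ptime ?K e' (\<lambda>z. enc_nat (snd z))"
    note G' = gsp_store_lift[OF G L]
    let ?i = "\<lambda>z. snd z div levels (I (fst z))" and ?k = "\<lambda>z. snd z mod levels (I (fst z))"
    have i: "ptime ?K e' (\<lambda>z. enc_nat (?i z))" by (intro ptime_div X ptime_levels[OF G'])
    have k: "ptime ?K e' (\<lambda>z. enc_nat (?k z))" by (intro ptime_mod X ptime_levels[OF G'])
    have Sk: "ptime ?K e' (\<lambda>z. enc_nat (Suc (?k z)))"
      using ptime_add[OF k ptime_nat[where k = 1, OF k]] by simp
    have i': "?i z < length (I (fst z))" and k': "?k z < levels (I (fst z))" if "z \<in> contexts ?K" for z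
      using that levels_pos[of "I (fst z)"] by (auto simp: less_mult_imp_div_less)
    have kb: "poly_bounded ?K ?k"
      by (rule poly_bounded_mono[OF ptime_levels(2)[OF G']], assumption) (rule less_imp_le[OF k'])
    have "ptime ?K e' (\<lambda>z. enc_nat (deadline (I (fst z)) (?i z) (?k z)))"
      "ptime ?K e' (\<lambda>z. enc_nat (deadline (I (fst z)) (?i z) (Suc (?k z))))"
      by (rule ptime_deadline[OF G' i i' k less_imp_le[OF k']]; assumption)
        (rule ptime_deadline[OF G' i i' Sk Suc_leI[OF k']]; assumption)
    then show "ptime ?K e' (\<lambda>z. enc_rectangle (rect (I (fst z)) (snd z)))"
      unfolding rect_def enc_rectangle_def Let_def rectangle.simps enc_rat_of_nat
      by (intro ptime_pair ptime_mult ptime_power kb k ptime_nat[OF X] ptime_job[OF G' i i'])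
  qed
qed

section \<open>Computing the schedule\<close>

lemma ptime_due:
  fixes K :: "'c family"
  assumes G: "gsp_store K I e"
    and ms: "ptime K e (\<lambda>c. enc_list enc_nat (ms c))"
    and i: "ptime K e (\<lambda>c. enc_nat (i c))" "\<And>c. c \<in> contexts K \<Longrightarrow> i c < length (I c)"
  shows "ptime K e (\<lambda>c. enc_nat (due (I c) (ms c) (i c)))"
  unfolding due_def
proof (rule ptime_fold_max[OF ms])
  show "ptime K e (\<lambda>c. enc_nat (deadline (I c) (i c) 0))"
    by (rule ptime_deadline[OF G i ptime_nat[OF ms]]) auto
  let ?K = "with_var K (\<lambda>c. set (ms c))"
  fix e' assume L: "\<And>g. ptime K e g \<Longrightarrow> ptime ?K e' (\<lambda>z. g (fst z))" and X: "ptime ?K e' (\<lambda>z. enc_nat (snd z))"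
  note G' = gsp_store_lift[OF G L]
  have k: "ptime ?K e' (\<lambda>z. enc_nat (snd z mod levels (I (fst z)) + 1))"
    by (intro ptime_add ptime_mod X ptime_levels[OF G'] ptime_nat[OF X])
  have "ptime ?K e' (\<lambda>z. enc_nat (deadline (I (fst z)) (i (fst z)) (snd z mod levels (I (fst z)) + 1)))"
    by (rule ptime_deadline[OF G' L[OF i(1)] _ k]) (use i(2) levels_pos in \<open>auto intro: Suc_leI\<close>)
  then show "ptime ?K e' (\<lambda>z. enc_nat (if snd z div levels (I (fst z)) = i (fst z)
      then deadline (I (fst z)) (i (fst z)) (Suc (snd z mod levels (I (fst z)))) else 0))"
    unfolding Suc_eq_plus1
    by (intro ptime_if_nat ptime_eq ptime_div X ptime_levels[OF G'] L[OF i(1)] ptime_nat[OF X])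
qed

lemma ptime_gaps:
  fixes K :: "'c family"
  assumes G: "gsp_store K I e"
  shows "ptime K e (\<lambda>c. enc_list enc_pair (gaps (I c)))"
proof -
  let ?rs = "\<lambda>c. sort_key (\<lambda>x. x) (map (\<lambda>i. release (I c ! i)) [0..<length (I c)])"
  note js = ptime_job_indices[OF G]
  have rs: "ptime K e (\<lambda>c. enc_list enc_nat (?rs c))"
  proof (rule ptime_sort_key, unfold enc_list_map, rule ptime_map[OF js])
    let ?K = "with_var K (\<lambda>c. set [0..<length (I c)])"
    fix e' assume L: "\<And>g. ptime K e g \<Longrightarrow> ptime ?K e' (\<lambda>z. g (fst z))" and X: "ptime ?K e' (\<lambda>z. enc_nat (snd z))"
    show "ptime ?K e' (\<lambda>z. enc_nat (release (I (fst z) ! snd z)))"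
      by (rule ptime_job(1)[OF gsp_store_lift[OF G L] X]) auto
  qed
  have "ptime K e (\<lambda>c. enc_list enc_nat [horizon (I c)])"
    by (intro ptime_Cons ptime_horizon[OF G] ptime_Nil[OF js])
  note ts = ptime_append[OF rs this]
  show ?thesis
    unfolding gaps_def Let_def enc_list_map
  proof (rule ptime_map[OF js])
    let ?K = "with_var K (\<lambda>c. set [0..<length (I c)])"
    fix e' assume L: "\<And>g. ptime K e g \<Longrightarrow> ptime ?K e' (\<lambda>z. g (fst z))" and X: "ptime ?K e' (\<lambda>z. enc_nat (snd z))"
    have Suc: "ptime ?K e' (\<lambda>z. enc_nat (Suc (snd z)))"
      using ptime_add[OF X ptime_nat[where k = 1, OF X]] by simp
    show "ptime ?K e' (\<lambda>z. enc_pair (?rs (fst z) ! snd z, (?rs (fst z) @ [horizon (I (fst z))]) ! Suc (snd z)))"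
      unfolding enc_pair_def fst_conv snd_conv
      by (intro ptime_pair ptime_nth[OF L[OF rs] X] ptime_nth[OF L[OF ts] Suc]) auto
  qed
qed

text \<open>With \<open>small_blocks\<close> an invariant for the loops of the scheduler: entries
  bounded in value by the horizon have polynomial length, so only the number of entries must be
  counted.\<close>

definition small_intervals :: "nat \<Rightarrow> nat \<Rightarrow> (nat \<times> nat) list \<Rightarrow> bool" where
  "small_intervals T N ivs \<longleftrightarrow> length ivs \<le> N \<and> (\<forall>u\<in>set ivs. fst u \<le> T \<and> snd u \<le> T)"

definition small_blocks :: "nat \<Rightarrow> nat \<Rightarrow> nat \<Rightarrow> (nat \<times> nat \<times> nat) list \<Rightarrow> bool" where
  "small_blocks n T N bs \<longleftrightarrow> length bs \<le> N \<and> (\<forall>b\<in>set bs. fst b \<le> n \<and> fst (snd b) \<le> T \<and> snd (snd b) \<le> T)"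

lemma fill_small:
  fixes rem r :: nat
  assumes "small_intervals T N us" "small_intervals T M F" "small_blocks n T B bs" "i \<le> n"
  defines "f \<equiv> fold (fill i r) us (rem, F, bs)"
  shows "fst f \<le> rem" "length (fst (snd f)) = length us + length F"
    "small_intervals T (N + M) (fst (snd f))" "small_blocks n T (N + B) (snd (snd f))"
proof -
  have "fst f \<le> rem \<and> length (fst (snd f)) = length us + length F \<and>
      length (snd (snd f)) = length us + length bs \<and>
      (\<forall>u\<in>set (fst (snd f)). fst u \<le> T \<and> snd u \<le> T) \<and>
      (\<forall>b\<in>set (snd (snd f)). fst b \<le> n \<and> fst (snd b) \<le> T \<and> snd (snd b) \<le> T)"
    using assms(1) unfolding f_def
  proof (induction us rule: rev_induct)
    case Nil
    then show ?case using assms(2-4) by (auto simp: small_intervals_def small_blocks_def)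
  next
    case (snoc u us)
    define g where "g = fold (fill i r) us (rem, F, bs)"
    have "small_intervals T N us" and u: "fst u \<le> T" "snd u \<le> T" using snoc.prems by (auto simp: small_intervals_def)
    note IH = snoc.IH[OF this(1), folded g_def]
    define x where "x = (if r \<le> fst u then min (fst g) (snd u - fst u) else 0)"
    have "fst u + x \<le> T" using u by (auto simp: x_def)
    moreover have "fold (fill i r) (us @ [u]) (rem, F, bs) =
       (fst g - x, (fst u + x, snd u) # fst (snd g), (i, fst u, fst u + x) # snd (snd g))"
      unfolding x_def by (simp add: g_def[symmetric]) (simp add: fill_def Let_def)
    ultimately show ?case using IH u assms(4) by auto
  qed
  then show "fst f \<le> rem" "length (fst (snd f)) = length us + length F"
    "small_intervals T (N + M) (fst (snd f))" "small_blocks n T (N + B) (snd (snd f))"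
    using assms(1-3) by (auto simp: small_intervals_def small_blocks_def)
qed

lemma small_mono:
  "small_intervals T N ivs \<Longrightarrow> N \<le> M \<Longrightarrow> small_intervals T M ivs"
  "small_blocks n T N bs \<Longrightarrow> N \<le> M \<Longrightarrow> small_blocks n T M bs"
  by (auto simp: small_intervals_def small_blocks_def)

text \<open>Each job adds one block per interval, and the number of intervals never changes.\<close>

lemma place_small:
  fixes J :: "job list"
  assumes "small_intervals T N us" "\<forall>i\<in>set js. i \<le> n"
  defines "f \<equiv> fold (place J) js (us, [])"
  shows "small_intervals T N (fst f)" "small_blocks n T (length js * N) (snd f)"
proof -
  have "small_intervals T N (fst f) \<and> small_blocks n T (length js * N) (snd f)"
    using assms(2) unfolding f_def
  proof (induction js rule: rev_induct)
    case Nil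
    then show ?case using assms(1) by (simp add: small_blocks_def)
  next
    case (snoc i js)
    define g where "g = fold (place J) js (us, [])"
    have IH: "small_intervals T N (fst g)" "small_blocks n T (length js * N) (snd g)" and i: "i \<le> n"
      using snoc by (auto simp: g_def)
    have "small_intervals T 0 []" by (simp add: small_intervals_def)
    from fill_small[OF IH(1) this IH(2) i]
    show ?case
      by (simp add: g_def[symmetric]) (simp add: place_def Let_def small_intervals_def)
  qed
  then show "small_intervals T N (fst f)" "small_blocks n T (length js * N) (snd f)" by auto
qed

definition enc_state :: "(nat \<times> nat) list \<times> (nat \<times> nat \<times> nat) list \<Rightarrow> val" where
  "enc_state st = Pr (enc_list enc_pair (fst st)) (enc_list enc_block (snd st))"

lemma enc_block_eq: "enc_block b = Pr (enc_nat (fst b)) (Pr (enc_nat (fst (snd b))) (enc_nat (snd (snd b))))"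
  by (simp add: enc_block_def split: prod.split)

lemma bits_enc_state:
  assumes "small_intervals T N (fst st)" "small_blocks n T M (snd st)"
  shows "bits (enc_state st) \<le> 1 + (1 + N * (1 + (1 + bits (enc_nat T) + bits (enc_nat T)))) +
     (1 + M * (1 + (1 + bits (enc_nat n) + (1 + bits (enc_nat T) + bits (enc_nat T)))))"
  unfolding enc_state_def bits.simps
  using assms
  by (intro add_mono order_refl bits_enc_list_le)
    (auto simp: small_intervals_def small_blocks_def enc_pair_def enc_block_eq intro!: add_mono bits_enc_nat_mono)

lemma ptime_place:
  fixes K :: "'c family"
  assumes G: "gsp_store K I e"
    and i: "ptime K e (\<lambda>c. enc_nat (i c))" "\<And>c. c \<in> contexts K \<Longrightarrow> i c < length (I c)"
    and st: "ptime K e (\<lambda>c. enc_state (st c))"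
    and small: "\<And>c. c \<in> contexts K \<Longrightarrow> small_intervals (horizon (I c)) (length (I c)) (fst (st c))"
      "\<And>c. c \<in> contexts K \<Longrightarrow> small_blocks (length (I c)) (horizon (I c)) (length (I c) * length (I c)) (snd (st c))"
  shows "ptime K e (\<lambda>c. enc_state (place (I c) (i c) (st c)))"
proof -
  let ?n = "\<lambda>c. length (I c)" and ?T = "\<lambda>c. horizon (I c)"
  let ?r = "\<lambda>c. release (I c ! i c)" and ?p = "\<lambda>c. job_size (I c ! i c)"
  let ?es = "\<lambda>s. Pr (enc_nat (fst s)) (enc_state (snd s))"
  \<comment> \<open>While one job is being placed, up to \<open>?n c\<close> blocks come on top of
    those present at the start.\<close>
  let ?R = "\<lambda>c s. fst s \<le> ?p c \<and> small_intervals (?T c) (?n c) (fst (snd s)) \<and>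
    small_blocks (?n c) (?T c) (?n c + ?n c * ?n c) (snd (snd s))"
  let ?f = "\<lambda>c. fold (fill (i c) (?r c)) (fst (st c)) (?p c, [], snd (st c))"
  note r = ptime_job(1)[OF G i] and p = ptime_job(2)[OF G i] and T = ptime_horizon[OF G]
  note ivs = ptime_left[OF st[unfolded enc_state_def]] and bs = ptime_right[OF st[unfolded enc_state_def]]
  have f: "ptime K e (\<lambda>c. ?es (?f c))"
  proof (rule ptime_fold[where es = "\<lambda>_. ?es" and R = ?R, OF ivs])
    show "ptime K e (\<lambda>c. ?es (?p c, [], snd (st c)))"
      unfolding enc_state_def fst_conv snd_conv by (intro ptime_pair p bs ptime_Nil[OF bs])
    show "?R c (fold (fill (i c) (?r c)) (take m (fst (st c))) (?p c, [], snd (st c)))"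
      if c: "c \<in> contexts K" for c m
    proof -
      have "small_intervals (?T c) (?n c) (take m (fst (st c)))"
        using small(1)[OF c] by (auto simp: small_intervals_def dest: in_set_takeD)
      moreover have "small_intervals (?T c) 0 []" by (simp add: small_intervals_def)
      ultimately show ?thesis
        using fill_small[OF _ _ small(2)[OF c], of "?n c" "take m (fst (st c))" 0 "[]" "i c" "?r c" "?p c"] i(2)[OF c]
        by simp
    qed
    let ?B = "\<lambda>c. 1 + bits (enc_nat (?p c)) + (1 + (1 + ?n c * (1 + (1 + bits (enc_nat (?T c)) + bits (enc_nat (?T c))))) +
      (1 + (?n c + ?n c * ?n c) * (1 + (1 + bits (enc_nat (?n c)) + (1 + bits (enc_nat (?T c)) + bits (enc_nat (?T c)))))))"
    show "poly_bounded (with_var K (\<lambda>c. Collect (?R c))) (\<lambda>z. bits (?es (snd z)))"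
    proof (rule poly_bounded_with_varI)
      show "poly_bounded K ?B"
        by (intro poly_bounded_add poly_bounded_mult poly_bounded_const ptime_num_jobs(2)[OF G]
          ptime_bits(2)[OF p] ptime_bits(2)[OF T] ptime_bits(2)[OF ptime_num_jobs(1)[OF G]])
      show "bits (?es (snd z)) \<le> ?B (fst z)" if "snd z \<in> Collect (?R (fst z))" for z
        unfolding bits.simps by (intro add_mono order_refl bits_enc_nat_mono bits_enc_state) (use that in auto)
    qed
    let ?K = "with_var K (\<lambda>c. set (fst (st c)) \<times> Collect (?R c))"
    fix e' assume L: "\<And>g. ptime K e g \<Longrightarrow> ptime ?K e' (\<lambda>z. g (fst z))"
      and X: "ptime ?K e' (\<lambda>z. enc_pair (fst (snd z)))" and S: "ptime ?K e' (\<lambda>z. ?es (snd (snd z)))"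
    note a = ptime_left[OF X[unfolded enc_pair_def]] and b = ptime_right[OF X[unfolded enc_pair_def]]
    note rem = ptime_left[OF S] and F = ptime_left[OF ptime_right[OF S, unfolded enc_state_def]]
      and B = ptime_right[OF ptime_right[OF S, unfolded enc_state_def]]
    let ?x = "\<lambda>z. if ?r (fst z) \<le> fst (fst (snd z)) then min (fst (snd (snd z))) (snd (fst (snd z)) - fst (fst (snd z))) else 0"
    have x: "ptime ?K e' (\<lambda>z. enc_nat (?x z))"
      by (intro ptime_if_nat ptime_le ptime_min ptime_diff a b rem L[OF r] ptime_nat[OF X])
    have "ptime ?K e' (\<lambda>z. enc_pair (fst (fst (snd z)) + ?x z, snd (fst (snd z))))"
      "ptime ?K e' (\<lambda>z. enc_block (i (fst z), fst (fst (snd z)), fst (fst (snd z)) + ?x z))"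
      unfolding enc_pair_def enc_block_eq fst_conv snd_conv
      using ptime_pair[OF ptime_add[OF a x] b] ptime_pair[OF L[OF i(1)] ptime_pair[OF a ptime_add[OF a x]]] .
    then have "ptime ?K e' (\<lambda>z. ?es (fst (snd (snd z)) - ?x z,
        (fst (fst (snd z)) + ?x z, snd (fst (snd z))) # fst (snd (snd (snd z))),
        (i (fst z), fst (fst (snd z)), fst (fst (snd z)) + ?x z) # snd (snd (snd (snd z)))))"
      unfolding enc_state_def fst_conv snd_conv
      by (intro ptime_pair ptime_diff rem x ptime_Cons F B)
    then show "ptime ?K e' (\<lambda>z. ?es (fill (i (fst z)) (?r (fst z)) (fst (snd z)) (snd (snd z))))"
      unfolding fill_def Let_def .
  qed
  note F = ptime_left[OF ptime_right[OF f, unfolded enc_state_def]]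
    and B = ptime_right[OF ptime_right[OF f, unfolded enc_state_def]]
  show ?thesis
    unfolding place_def Let_def enc_state_def fst_conv snd_conv
    by (intro ptime_pair ptime_rev F B)
qed

lemma ptime_blocks:
  fixes K :: "'c family"
  assumes G: "gsp_store K I e"
    and ms: "ptime K e (\<lambda>c. enc_list enc_nat (ms c))"
  shows "ptime K e (\<lambda>c. enc_list enc_block (blocks (I c) (due (I c) (ms c))))"
proof -
  let ?n = "\<lambda>c. length (I c)" and ?T = "\<lambda>c. horizon (I c)"
  let ?js = "\<lambda>c. sort_key (due (I c) (ms c)) [0..<?n c]"
  let ?R = "\<lambda>c st. small_intervals (?T c) (?n c) (fst st) \<and> small_blocks (?n c) (?T c) (?n c * ?n c) (snd st)"
  have js: "ptime K e (\<lambda>c. enc_list enc_nat (?js c))"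
  proof (rule ptime_sort_key[OF ptime_job_indices[OF G]])
    let ?K = "with_var K (\<lambda>c. set [0..<?n c])"
    fix e' assume L: "\<And>g. ptime K e g \<Longrightarrow> ptime ?K e' (\<lambda>z. g (fst z))" and X: "ptime ?K e' (\<lambda>z. enc_nat (snd z))"
    show "ptime ?K e' (\<lambda>z. enc_nat (due (I (fst z)) (ms (fst z)) (snd z)))"
      by (rule ptime_due[OF gsp_store_lift[OF G L] L[OF ms] X]) auto
  qed
  have "ptime K e (\<lambda>c. enc_state (fold (place (I c)) (?js c) (gaps (I c), [])))"
  proof (rule ptime_fold[where es = "\<lambda>_. enc_state" and R = ?R, OF js])
    show "ptime K e (\<lambda>c. enc_state (gaps (I c), []))"
      unfolding enc_state_def fst_conv snd_conv by (intro ptime_pair ptime_gaps[OF G] ptime_Nil[OF ms])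
    show "?R c (fold (place (I c)) (take m (?js c)) (gaps (I c), []))" for c m
    proof -
      have "small_intervals (?T c) (?n c) (gaps (I c))"
        using gaps_wf(4) by (auto simp: small_intervals_def length_gaps)
      moreover have "\<forall>i\<in>set (take m (?js c)). i \<le> ?n c" by (auto dest: in_set_takeD)
      ultimately have "small_intervals (?T c) (?n c) (fst (fold (place (I c)) (take m (?js c)) (gaps (I c), [])))"
        "small_blocks (?n c) (?T c) (length (take m (?js c)) * ?n c) (snd (fold (place (I c)) (take m (?js c)) (gaps (I c), [])))"
        by (rule place_small)+
      moreover have "length (take m (?js c)) * ?n c \<le> ?n c * ?n c" by (intro mult_le_mono1) simp
      ultimately show ?thesis using small_mono(2) by blast
    qed
    let ?B = "\<lambda>c. 1 + (1 + ?n c * (1 + (1 + bits (enc_nat (?T c)) + bits (enc_nat (?T c))))) +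
      (1 + (?n c * ?n c) * (1 + (1 + bits (enc_nat (?n c)) + (1 + bits (enc_nat (?T c)) + bits (enc_nat (?T c))))))"
    show "poly_bounded (with_var K (\<lambda>c. Collect (?R c))) (\<lambda>z. bits (enc_state (snd z)))"
    proof (rule poly_bounded_with_varI)
      show "poly_bounded K ?B"
        by (intro poly_bounded_add poly_bounded_mult poly_bounded_const ptime_num_jobs(2)[OF G]
          ptime_bits(2)[OF ptime_horizon[OF G]] ptime_bits(2)[OF ptime_num_jobs(1)[OF G]])
      show "bits (enc_state (snd z)) \<le> ?B (fst z)" if "snd z \<in> Collect (?R (fst z))" for z
        by (rule bits_enc_state) (use that in auto)
    qed
    let ?K = "with_var K (\<lambda>c. set (?js c) \<times> Collect (?R c))"
    fix e' assume L: "\<And>g. ptime K e g \<Longrightarrow> ptime ?K e' (\<lambda>z. g (fst z))"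
      and X: "ptime ?K e' (\<lambda>z. enc_nat (fst (snd z)))" and S: "ptime ?K e' (\<lambda>z. enc_state (snd (snd z)))"
    show "ptime ?K e' (\<lambda>z. enc_state (place (I (fst z)) (fst (snd z)) (snd (snd z))))"
      by (rule ptime_place[OF gsp_store_lift[OF G L] X _ S]) auto
  qed
  from ptime_right[OF this[unfolded enc_state_def]] show ?thesis by (simp add: blocks_def)
qed

text \<open>An R2C algorithm may contain queries, all answered by \<open>Num 0\<close>. Under the
  queries of GSP the answers would differ, so the constant takes their place; it costs the same
  time.\<close>

fun without_queries :: "prog \<Rightarrow> prog" where
  "without_queries (Op a) = (case a of Query \<Rightarrow> Op (Const (Num 0)) | _ \<Rightarrow> Op a)"
| "without_queries (Seq f g) = Seq (without_queries f) (without_queries g)"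
| "without_queries (Fork f g) = Fork (without_queries f) (without_queries g)"
| "without_queries (Cond b f g) = Cond (without_queries b) (without_queries f) (without_queries g)"
| "without_queries (While b f) = While (without_queries b) (without_queries f)"

lemma exec_without_queries:
  "exec (\<lambda>_. Num 0) p v t w \<Longrightarrow> exec q (without_queries p) v t w"
proof (induction rule: exec.induct)
  case (Op a v)
  then show ?case
    using exec.Op[of q a v] exec.Op[of q "Const (Num 0)" v] by (cases a) auto
qed (auto intro: exec.intros simp del: One_nat_def add_Suc plus_nat.simps simp: exec.intros)

text \<open>\<open>T\<close> is polynomial in the size of the R2C input, which is itself
  polynomially bounded because it has been computed.\<close>

lemma ptime_without_queries:
  assumes e: "ptime K e f" and T: "poly_bounded K (\<lambda>c. bits (f c)) \<Longrightarrow> poly_bounded K T"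
    and run: "\<And>c. c \<in> contexts K \<Longrightarrow> \<exists>t\<le>T c. exec (\<lambda>_. Num 0) A (f c) t (g c)"
  shows "ptime K e g"
proof (rule ptime_seq[OF e], rule ptimeI)
  show "poly_bounded K T" by (rule T[OF ptime_bits(2)[OF e]])
  show "\<exists>t\<le>T c. exec (queries K c) (without_queries A) (f c) t (g c)" if "c \<in> contexts K" for c
    using run[OF that] exec_without_queries by blast
qed

section \<open>The approximation guarantee and the final algorithm\<close>

lemma R2C_simps [simp]:
  "is_instance R2C = r2c_is_instance" "input R2C = r2c_input" "answer R2C = (\<lambda>I v. Num 0)"
  "input_size R2C = (\<lambda>I. bits (r2c_input I))" "feasible R2C = r2c_feasible" "cost R2C = r2c_cost"
  "describes R2C = (\<lambda>S v. \<exists>is. v = enc_list enc_nat is \<and> set is = S)"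
  by (simp_all add: R2C_def)

lemma GSP_simps [simp]:
  "is_instance GSP = gsp_is_instance" "input GSP = gsp_input" "answer GSP = gsp_answer"
  "input_size GSP = gsp_input_size" "feasible GSP = gsp_feasible" "cost GSP = gsp_cost"
  "describes GSP = (\<lambda>\<sigma> v. \<exists>bs. v = enc_list enc_block bs \<and> describes_schedule bs \<sigma>)"
  by (simp_all add: GSP_def)

lemma r2c_cost_nonneg: "0 \<le> r2c_cost I S"
  by (simp add: r2c_cost_def sum_nonneg)

lemma r2c_optimum_le: "r2c_feasible I S \<Longrightarrow> optimum R2C I \<le> r2c_cost I S"
  unfolding optimum_def R2C_simps by (rule cINF_lower) (auto intro!: bdd_belowI2[of _ 0] r2c_cost_nonneg)

text \<open>Multiplying the bound on the optimum by the ratio needs its sign. One point and one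
  rectangle give optimum 1, for which a negative ratio would demand a negative cost.\<close>

lemma approximation_ratio_nonneg:
  assumes "approximation_algorithm \<alpha> R2C A"
  shows "0 \<le> \<alpha>"
proof (rule ccontr)
  assume neg: "\<not> 0 \<le> \<alpha>"
  define I :: r2c_instance where
    "I = ([\<lparr>xcoord = 0, ycoord = 0, demand = 1\<rparr>], [\<lparr>right = 0, lower = 0, upper = 0, capacity = 1, rweight = 1\<rparr>])"
  have inst: "r2c_is_instance I" by (simp add: I_def r2c_is_instance_def)
  have reg: "{i \<in> S. (0, 0) \<in> region (snd I ! i)} = S" if "S \<subseteq> {..<1}" for S
    using that by (auto simp: I_def region_def)
  have feas: "r2c_feasible I {0}"
    unfolding r2c_feasible_def using reg[of "{0}"] by (simp add: I_def)
  have cost: "r2c_cost I S = 1" if "r2c_feasible I S" for S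
  proof -
    have S: "S \<subseteq> {..<1}" "demand (hd (fst I)) \<le> (\<Sum>i\<in>S. capacity (snd I ! i))"
      using that reg[of S] by (auto simp: r2c_feasible_def I_def)
    then have "S = {0}" by (cases "S = {}") (auto simp: I_def)
    then show ?thesis by (simp add: r2c_cost_def I_def)
  qed
  have "optimum R2C I = 1"
  proof -
    have "(\<lambda>S. r2c_cost I S) ` {S. r2c_feasible I S} = {1}" using cost feas by auto
    then show ?thesis by (simp add: optimum_def)
  qed
  moreover obtain S where "r2c_cost I S \<le> \<alpha> * optimum R2C I"
    using assms inst feas unfolding approximation_algorithm_def R2C_simps by blast
  ultimately show False using neg r2c_cost_nonneg[of I S] by simp
qed

text \<open>Costs are monotone in time, so cutting completion times at the horizon only lowers them
  and the cut disappears here.\<close>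

lemma reduction_optimum_le:
  assumes inst: "gsp_is_instance J" and feas: "gsp_feasible J \<sigma>"
  shows "optimum R2C (reduction J) \<le> 4 * real (scale J) * gsp_cost J \<sigma>"
proof -
  let ?C = "completion_time \<sigma>"
  have "optimum R2C (reduction J) \<le> r2c_cost (reduction J) (picks J ?C)"
    by (intro r2c_optimum_le picks_feasible[OF inst] schedule_hall[OF inst feas])
  also have "\<dots> \<le> 4 * real (scale J) * (\<Sum>i<length J. of_rat (cost_at (J ! i) (min (?C i) (horizon J))))"
    by (rule picks_cost[OF inst])
  also have "\<dots> \<le> 4 * real (scale J) * gsp_cost J \<sigma>"
    unfolding gsp_cost_def
    by (intro mult_left_mono sum_mono) (auto simp: of_rat_less_eq intro!: cost_at_mono[OF inst])
  finally show ?thesis .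
qed

lemma reduction_approximates:
  assumes inst: "gsp_is_instance J" and feas: "r2c_feasible (reduction J) (set ms)" and \<alpha>: "0 \<le> \<alpha>"
    and cost: "r2c_cost (reduction J) (set ms) \<le> \<alpha> * optimum R2C (reduction J)"
  obtains \<sigma> where "describes_schedule (blocks J (due J ms)) \<sigma>" "gsp_feasible J \<sigma>"
    "gsp_cost J \<sigma> \<le> 4 * \<alpha> * optimum GSP J"
proof -
  obtain \<sigma> where \<sigma>: "describes_schedule (blocks J (due J ms)) \<sigma>" "gsp_feasible J \<sigma>"
    "\<And>i. i < length J \<Longrightarrow> completion_time \<sigma> i \<le> due J ms i"
  proof (rule blocks_schedule[OF inst])
    show "hall_at J (due J ms) (release (J ! i)) (due J ms j)" if "i < length J" "j < length J" for i j
      by (rule due_hall[OF inst feas]) (use that due_in_ends[OF inst] in \<open>auto simp: set_starts\<close>)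
  qed (use due_le_horizon[OF inst] in auto)
  have S: "set ms \<subseteq> {..<length J * levels J}"
    using feas reduction_feasible_iff[OF inst] by blast
  have D: "0 < real (scale J)" using scale_pos[OF inst] by simp
  \<comment> \<open>The optimum is an infimum, so the comparison is made with every feasible
    schedule before passing to it.\<close>
  have le: "gsp_cost J \<sigma> \<le> 4 * \<alpha> * gsp_cost J \<sigma>'" if "gsp_feasible J \<sigma>'" for \<sigma>'
  proof -
    have "real (scale J) * gsp_cost J \<sigma> \<le> real (scale J) * (\<Sum>i<length J. of_rat (cost_at (J ! i) (due J ms i)))"
      unfolding gsp_cost_def using \<sigma>(3)
      by (intro mult_left_mono sum_mono) (auto simp: of_rat_less_eq intro!: cost_at_mono[OF inst])
    also have "\<dots> \<le> r2c_cost (reduction J) (set ms)" by (rule due_cost[OF inst S])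
    also have "\<dots> \<le> \<alpha> * (4 * real (scale J) * gsp_cost J \<sigma>')"
      using cost mult_left_mono[OF reduction_optimum_le[OF inst that] \<alpha>] by linarith
    also have "\<dots> = real (scale J) * (4 * \<alpha> * gsp_cost J \<sigma>')" by simp
    finally show ?thesis using D by simp
  qed
  have ne: "{\<sigma>. gsp_feasible J \<sigma>} \<noteq> {}" using \<sigma>(2) by blast
  have "gsp_cost J \<sigma> \<le> 4 * \<alpha> * optimum GSP J"
  proof (cases "\<alpha> = 0")
    \<comment> \<open>Dividing by the ratio is not possible here, but comparing the schedule with
      itself shows that it costs at most 0.\<close>
    case True
    then show ?thesis using le[OF \<sigma>(2)] by simp
  next
    case False
    then have "gsp_cost J \<sigma> / (4 * \<alpha>) \<le> (INF \<sigma>'\<in>{\<sigma>. gsp_feasible J \<sigma>}. gsp_cost J \<sigma>')"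
      using \<alpha> le by (intro cINF_greatest[OF ne]) (auto simp: pos_divide_le_eq mult.commute)
    then show ?thesis using False \<alpha> by (simp add: optimum_def pos_divide_le_eq mult.commute)
  qed
  with \<sigma> that show ?thesis by blast
qed

theorem theorem1:
  fixes \<alpha> :: real
  assumes "\<exists>A. polynomial_time R2C A \<and> approximation_algorithm \<alpha> R2C A"
  shows "\<exists>B. polynomial_time GSP B \<and> approximation_algorithm (4 * \<alpha>) GSP B"
proof -
  obtain A b where apx: "approximation_algorithm \<alpha> R2C A"
    and time: "\<And>I. r2c_is_instance I \<Longrightarrow> \<exists>t v. exec (\<lambda>_. Num 0) A (r2c_input I) t v \<and> t \<le> poly b (bits (r2c_input I))"
    using assms unfolding polynomial_time_def R2C_simps by blast
  \<comment> \<open>In the outermost family a context is just the instance.\<close>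
  define K where "K = \<lparr>queries = gsp_answer, len = gsp_input_size, contexts = Collect gsp_is_instance\<rparr>"
  have "\<exists>ms. (\<exists>t \<le> poly b (bits (r2c_input (reduction J))). exec (\<lambda>_. Num 0) A (r2c_input (reduction J)) t (enc_list enc_nat ms)) \<and>
      r2c_feasible (reduction J) (set ms) \<and> r2c_cost (reduction J) (set ms) \<le> \<alpha> * optimum R2C (reduction J)"
    if J: "gsp_is_instance J" for J
  proof -
    \<comment> \<open>The guarantee of \<open>A\<close> concerns instances with a solution; letting
      all jobs end at the horizon provides one.\<close>
    have "r2c_feasible (reduction J) (picks J (\<lambda>_. horizon J))"
      by (intro picks_feasible[OF J] hall_at_horizon[OF J])
    then obtain t ms where run: "exec (\<lambda>_. Num 0) A (r2c_input (reduction J)) t (enc_list enc_nat ms)"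
      and ms: "r2c_feasible (reduction J) (set ms)" "r2c_cost (reduction J) (set ms) \<le> \<alpha> * optimum R2C (reduction J)"
      using apx reduction_is_instance[OF J] unfolding approximation_algorithm_def R2C_simps by blast
    \<comment> \<open>The guarantee and the time bound each supply a run of \<open>A\<close>;
      determinism shows that the two runs coincide.\<close>
    obtain t' v where "exec (\<lambda>_. Num 0) A (r2c_input (reduction J)) t' v" "t' \<le> poly b (bits (r2c_input (reduction J)))"
      using time[OF reduction_is_instance[OF J]] by blast
    with exec_deterministic[OF run] run have "t \<le> poly b (bits (r2c_input (reduction J)))" by blast
    with run ms show ?thesis by blast
  qed
  then obtain ms where run: "\<And>J. gsp_is_instance J \<Longrightarrow> \<exists>t \<le> poly b (bits (r2c_input (reduction J))).
        exec (\<lambda>_. Num 0) A (r2c_input (reduction J)) t (enc_list enc_nat (ms J))"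
    and ms: "\<And>J. gsp_is_instance J \<Longrightarrow> r2c_feasible (reduction J) (set (ms J))"
      "\<And>J. gsp_is_instance J \<Longrightarrow> r2c_cost (reduction J) (set (ms J)) \<le> \<alpha> * optimum R2C (reduction J)"
    by metis
  have "poly_bounded K (\<lambda>J. bits (gsp_input J))"
    by (rule poly_bounded_mono[OF poly_bounded_len]) (simp add: K_def gsp_input_size_def)
  then have G: "gsp_store K (\<lambda>J. J) gsp_input"
    by (simp add: gsp_store_def ptime_id) (simp add: K_def)
  have "ptime K gsp_input (\<lambda>J. enc_list enc_nat (ms J))"
    by (rule ptime_without_queries[OF ptime_reduction[OF G] poly_bounded_poly]) (use run in \<open>auto simp: K_def\<close>)
  from ptime_blocks[OF G this] obtain B T where T: "poly_bounded K T"
    and B: "\<And>J. gsp_is_instance J \<Longrightarrow> \<exists>t\<le>T J. exec (gsp_answer J) B (gsp_input J) t (enc_list enc_block (blocks J (due J (ms J))))"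
    by (auto simp: ptime_def K_def)
  obtain p where p: "\<And>J. gsp_is_instance J \<Longrightarrow> T J \<le> poly p (gsp_input_size J)"
    using T by (auto simp: poly_bounded_def K_def)
  have "polynomial_time GSP B"
    unfolding polynomial_time_def GSP_simps using B p by (meson order_trans)
  moreover have "approximation_algorithm (4 * \<alpha>) GSP B"
    unfolding approximation_algorithm_def
  proof (intro allI impI)
    fix J assume "is_instance GSP J \<and> (\<exists>s. feasible GSP J s)"
    then have J: "gsp_is_instance J" by simp
    obtain t where t: "exec (gsp_answer J) B (gsp_input J) t (enc_list enc_block (blocks J (due J (ms J))))"
      using B[OF J] by blast
    obtain \<sigma> where "describes_schedule (blocks J (due J (ms J))) \<sigma>" "gsp_feasible J \<sigma>"
      "gsp_cost J \<sigma> \<le> 4 * \<alpha> * optimum GSP J"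
      using reduction_approximates[OF J ms(1)[OF J] approximation_ratio_nonneg[OF apx] ms(2)[OF J]] .
    with t show "\<exists>t v s. exec (answer GSP J) B (input GSP J) t v \<and> describes GSP s v \<and> feasible GSP J s \<and>
        cost GSP J s \<le> 4 * \<alpha> * optimum GSP J"
      unfolding GSP_simps by blast
  qed
  ultimately show ?thesis by blast
qed

end
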